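(* Consider the Liggett-boundary process of the context on $[0,T]$, with $a>0$, $1/2<p\le1$, $\bar p=2p-1$, and with balanced boundary densities $\rho_-(t)=\rho_+(t)=\rho(t)$ for $t\in[0,T]$, where $\rho$ is a $\mathcal C^1$ function with values in $(0,1)$. Let $K=K(N)$ be a sequence of integers with $\sqrt N\ll K\ll\min\{N^a,N\}$. Then $$\lim_{N\to\infty}\mathbb E_N^{\mu_{N,0}}\Big[\big|X_N^F(\psi,\rho)\big|\Big]=0$$ for any initial distributions $\mu_{N,0}$ on $\Omega_N$, any boundary Lax entropy--entropy flux pair $(F,Q)$, and any $\psi\in\mathcal C^2([0,1]\times[0,T])$ such that $\psi(\cdot,0)=\psi(\cdot,T)=0$.
   Context: Notation: $a_N\ll b_N$ means $a_N/b_N\to0$ as $N\to\infty$. $\Sigma_T=[0,1]\times[0,T]$, $T>0$. Configurations: $\Omega_N=\{0,1\}^N$; $\eta^{i,i+1}$ is $\eta$ with $\eta_i,\eta_{i+1}$ exchanged, $\eta^i$ is $\eta$ with $\eta_i$ replaced by $1-\eta_i$. Generator (Liggett boundaries): $L_{N,t}=L_{\rm exc}+L_{-,t}+L_{+,t}$ with $L_{\rm exc}f=\sum_{i=1}^{N-1}c_{i,i+1}[f(\eta^{i,i+1})-f(\eta)]$, $c_{i,j}=p\eta_i(1-\eta_j)+(1-p)\eta_j(1-\eta_i)$, $L_{-,t}f=[\alpha(t)(1-\eta_1)+\gamma(t)\eta_1][f(\eta^1)-f(\eta)]$, $L_{+,t}f=[\delta(t)(1-\eta_N)+\beta(t)\eta_N][f(\eta^N)-f(\eta)]$,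 $\alpha=p\rho_-$, $\gamma=(1-p)(1-\rho_-)$, $\beta=p(1-\rho_+)$, $\delta=(1-p)\rho_+$. $\eta(t)$ is the Markov process on $\Omega_N$ with generator $N^{1+a}L_{N,t}$ and initial distribution $\mu_{N,0}$; $\mathbb E_N^{\mu_{N,0}}$ is the corresponding expectation. Weighted block averages: $\hat\eta_{i,K}=\frac1{K^2}\sum_{|j|<K}(K-|j|)\eta_{i-j}$ for $i=K,\dots,N-K+1$. Let $\chi_{i,N}$ be the indicator function of $[\frac iN-\frac1{2N},\frac iN+\frac1{2N})\cap[0,1]$, and $\hat\rho_N(x,t)=\sum_{i=K+1}^{N-K}\chi_{i,N}(x)\hat\eta_{i,K}(t)$. Boundary Lax entropy--entropy flux pair: with $J(u)=\bar pu(1-u)$, a couple of $\mathcal C^2$ functions $(F,Q):[0,1]\times\mathbb R\to\mathbb R^2$ such that $J'(u)\partial_uF(u,w)=\partial_uQ(u,w)$ for all $u\in[0,1]$, $w\in\mathbb R$, and $F(w,w)=Q(w,w)=\partial_uF(w,w)=0$ for all $w$ for which this makes sense (i.e. $w\in[0,1]$). Boundary entropy production: for $\psi\in\mathcal C^1(\Sigma_T)$ and a $\mathcal C^1$ function $w=w(t)$, $$X_N^F(\psi,w)=N^{-a}\iint_{\Sigma_T}\big[F(\hat\rho_N,w)\,\partial_t\psi+\partial_wF(\hat\rho_N,w)\,w'\,\psi\big]dx\,dt+\iint_{\Sigma_T}Q(\hat\rho_N,w)\,\partial_x\psi\,dx\,dt .$$ *)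

theory Defs
  imports "HOL-Probability.Probability" "HOL-Library.Landau_Symbols"
begin

section \<open>Configurations and the generator with Liggett boundaries\<close>

(* Sites are 1..N.  Occupation numbers are kept as reals 0, 1, so that they can be used
   directly in rates and averages; outside 1..N a configuration is undefined. *)
type_synonym config = "nat \<Rightarrow> real"

definition configs :: "nat \<Rightarrow> config set" where
  "configs N = {1..N} \<rightarrow>\<^sub>E {0, 1}"

definition exchange :: "config \<Rightarrow> nat \<Rightarrow> nat \<Rightarrow> config" where
  "exchange \<eta> i j = \<eta>(i := \<eta> j, j := \<eta> i)"

definition flip :: "config \<Rightarrow> nat \<Rightarrow> config" where
  "flip \<eta> i = \<eta>(i := 1 - \<eta> i)"

definition L_exc :: "real \<Rightarrow> nat \<Rightarrow> (config \<Rightarrow> real) \<Rightarrow> config \<Rightarrow> real" where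
  "L_exc p N f \<eta> = (\<Sum>i = 1..<N.
     (p * \<eta> i * (1 - \<eta> (i + 1)) + (1 - p) * \<eta> (i + 1) * (1 - \<eta> i))
       * (f (exchange \<eta> i (i + 1)) - f \<eta>))"

definition L_left :: "real \<Rightarrow> (real \<Rightarrow> real) \<Rightarrow> real \<Rightarrow> (config \<Rightarrow> real) \<Rightarrow> config \<Rightarrow> real" where
  "L_left p \<rho>l t f \<eta> =
     (let \<alpha> = p * \<rho>l t; \<gamma> = (1 - p) * (1 - \<rho>l t)
      in (\<alpha> * (1 - \<eta> 1) + \<gamma> * \<eta> 1) * (f (flip \<eta> 1) - f \<eta>))"

definition L_right :: "real \<Rightarrow> nat \<Rightarrow> (real \<Rightarrow> real) \<Rightarrow> real \<Rightarrow> (config \<Rightarrow> real) \<Rightarrow> config \<Rightarrow> real" where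
  "L_right p N \<rho>r t f \<eta> =
     (let \<beta> = p * (1 - \<rho>r t); \<delta> = (1 - p) * \<rho>r t
      in (\<delta> * (1 - \<eta> N) + \<beta> * \<eta> N) * (f (flip \<eta> N) - f \<eta>))"

definition L_gen ::
  "real \<Rightarrow> (real \<Rightarrow> real) \<Rightarrow> (real \<Rightarrow> real) \<Rightarrow> nat \<Rightarrow> real \<Rightarrow> (config \<Rightarrow> real) \<Rightarrow> config \<Rightarrow> real" where
  "L_gen p \<rho>l \<rho>r N t f \<eta> = L_exc p N f \<eta> + L_left p \<rho>l t f \<eta> + L_right p N \<rho>r t f \<eta>"

section \<open>Time-inhomogeneous Markov processes on a finite state space\<close>

(* P s t x y is the probability of being in y at time t when started from x at time s.
   The generator enters through the forward equation d/dt P_{s,t} f = P_{s,t} (L_t f).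
   The derivative is two-sided at s < t < T: a right derivative alone would not exclude
   jumps at deterministic times. *)
definition transition_function ::
  "'s set \<Rightarrow> real \<Rightarrow> (real \<Rightarrow> ('s \<Rightarrow> real) \<Rightarrow> 's \<Rightarrow> real) \<Rightarrow> (real \<Rightarrow> real \<Rightarrow> 's \<Rightarrow> 's \<Rightarrow> real) \<Rightarrow> bool" where
  "transition_function S T L P \<longleftrightarrow>
     (\<forall>s t. 0 \<le> s \<longrightarrow> s \<le> t \<longrightarrow> t \<le> T \<longrightarrow>
        (\<forall>x\<in>S. (\<forall>y\<in>S. 0 \<le> P s t x y) \<and> (\<Sum>y\<in>S. P s t x y) = 1)) \<and>
     (\<forall>s\<in>{0..T}. \<forall>x\<in>S. \<forall>y\<in>S. P s s x y = (if x = y then 1 else 0)) \<and>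
     (\<forall>r s t. 0 \<le> r \<longrightarrow> r \<le> s \<longrightarrow> s \<le> t \<longrightarrow> t \<le> T \<longrightarrow>
        (\<forall>x\<in>S. \<forall>z\<in>S. P r t x z = (\<Sum>y\<in>S. P r s x y * P s t y z))) \<and>
     (\<forall>f s t. 0 \<le> s \<longrightarrow> s \<le> t \<longrightarrow> t \<le> T \<longrightarrow>
        (\<forall>x\<in>S. ((\<lambda>t'. \<Sum>y\<in>S. P s t' x y * f y) has_real_derivative
                   (\<Sum>y\<in>S. P s t x y * L t f y)) (at t within {s..T})))"

definition natural_filtration ::
  "'w measure \<Rightarrow> 's set \<Rightarrow> (real \<Rightarrow> 'w \<Rightarrow> 's) \<Rightarrow> real \<Rightarrow> 'w measure" where
  "natural_filtration M S X s =
     sigma (space M) (\<Union>r\<in>{0..s}. {X r -` A \<inter> space M | A. A \<subseteq> S})"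

(* For a finite (discrete) state space, right continuity means being constant on some [t, t + h),
   and having a left limit means being constant on some (t - h, t). *)
definition cadlag_path :: "'s set \<Rightarrow> real \<Rightarrow> (real \<Rightarrow> 's) \<Rightarrow> bool" where
  "cadlag_path S T x \<longleftrightarrow>
     (\<forall>t. 0 \<le> t \<longrightarrow> t < T \<longrightarrow> eventually (\<lambda>r. x r = x t) (at_right t)) \<and>
     (\<forall>t. 0 < t \<longrightarrow> t \<le> T \<longrightarrow> (\<exists>y\<in>S. eventually (\<lambda>r. x r = y) (at_left t)))"

definition markov_process ::
  "'w measure \<Rightarrow> 's set \<Rightarrow> real \<Rightarrow> (real \<Rightarrow> ('s \<Rightarrow> real) \<Rightarrow> 's \<Rightarrow> real) \<Rightarrow> 's pmf
     \<Rightarrow> (real \<Rightarrow> 'w \<Rightarrow> 's) \<Rightarrow> bool" where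
  "markov_process M S T L \<mu> X \<longleftrightarrow>
     prob_space M \<and>
     (\<forall>t\<in>{0..T}. X t \<in> measurable M (count_space S)) \<and>
     (\<forall>\<omega>\<in>space M. cadlag_path S T (\<lambda>t. X t \<omega>)) \<and>
     (\<forall>x\<in>S. measure M {\<omega> \<in> space M. X 0 \<omega> = x} = pmf \<mu> x) \<and>
     (\<exists>P. transition_function S T L P \<and>
        (\<forall>f s t. 0 \<le> s \<longrightarrow> s \<le> t \<longrightarrow> t \<le> T \<longrightarrow>
           (AE \<omega> in M. real_cond_exp M (natural_filtration M S X s) (\<lambda>\<omega>. f (X t \<omega>)) \<omega>
                        = (\<Sum>y\<in>S. P s t (X s \<omega>) y * f y))))"

section \<open>Weighted block averages and the empirical density\<close>

definition block_avg :: "nat \<Rightarrow> config \<Rightarrow> nat \<Rightarrow> real" where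
  "block_avg K \<eta> i =
     1 / (real K)\<^sup>2 * (\<Sum>j\<in>{- int K<..<int K}. (real K - \<bar>real_of_int j\<bar>) * \<eta> (nat (int i - j)))"

definition chi :: "nat \<Rightarrow> nat \<Rightarrow> real \<Rightarrow> real" where
  "chi N i = indicator
     ({real i / real N - 1 / (2 * real N)..<real i / real N + 1 / (2 * real N)} \<inter> {0..1})"

definition rho_hat :: "nat \<Rightarrow> nat \<Rightarrow> config \<Rightarrow> real \<Rightarrow> real" where
  "rho_hat N K \<eta> x = (\<Sum>i = K + 1..N - K. chi N i x * block_avg K \<eta> i)"

section \<open>Functions of class C1 and C2 on a subset of the plane\<close>

(* Derivatives are taken relative to S, i.e. one-sided at the boundary.  They are unique for the
   sets used here, which are products of two nondegenerate intervals. *)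
definition pd1 :: "(real \<times> real) set \<Rightarrow> (real \<times> real \<Rightarrow> real) \<Rightarrow> real \<times> real \<Rightarrow> real" where
  "pd1 S f z = frechet_derivative f (at z within S) (1, 0)"

definition pd2 :: "(real \<times> real) set \<Rightarrow> (real \<times> real \<Rightarrow> real) \<Rightarrow> real \<times> real \<Rightarrow> real" where
  "pd2 S f z = frechet_derivative f (at z within S) (0, 1)"

definition C1_on :: "(real \<times> real) set \<Rightarrow> (real \<times> real \<Rightarrow> real) \<Rightarrow> bool" where
  "C1_on S f \<longleftrightarrow> f differentiable_on S \<and> continuous_on S (pd1 S f) \<and> continuous_on S (pd2 S f)"

definition C2_on :: "(real \<times> real) set \<Rightarrow> (real \<times> real \<Rightarrow> real) \<Rightarrow> bool" where
  "C2_on S f \<longleftrightarrow> C1_on S f \<and> C1_on S (pd1 S f) \<and> C1_on S (pd2 S f)"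

(* The library's C1_differentiable_on uses two-sided derivatives at the endpoints. *)
definition C1_interval :: "real \<Rightarrow> real \<Rightarrow> (real \<Rightarrow> real) \<Rightarrow> bool" where
  "C1_interval a b w \<longleftrightarrow> w differentiable_on {a..b} \<and>
     continuous_on {a..b} (\<lambda>t. vector_derivative w (at t within {a..b}))"

section \<open>Boundary Lax entropy--entropy flux pairs and the boundary entropy production\<close>

definition flux :: "real \<Rightarrow> real \<Rightarrow> real" where
  "flux p u = (2 * p - 1) * u * (1 - u)"

definition ent_dom :: "(real \<times> real) set" where
  "ent_dom = {0..1} \<times> UNIV"

definition boundary_Lax_pair ::
  "real \<Rightarrow> (real \<times> real \<Rightarrow> real) \<Rightarrow> (real \<times> real \<Rightarrow> real) \<Rightarrow> bool" where
  "boundary_Lax_pair p F Q \<longleftrightarrow>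
     C2_on ent_dom F \<and> C2_on ent_dom Q \<and>
     (\<forall>u\<in>{0..1}. \<forall>w. deriv (flux p) u * pd1 ent_dom F (u, w) = pd1 ent_dom Q (u, w)) \<and>
     (\<forall>w\<in>{0..1}. F (w, w) = 0 \<and> Q (w, w) = 0 \<and> pd1 ent_dom F (w, w) = 0)"

definition space_time :: "real \<Rightarrow> (real \<times> real) set" where
  "space_time T = {0..1} \<times> {0..T}"

definition entropy_production ::
  "real \<Rightarrow> real \<Rightarrow> nat \<Rightarrow> nat \<Rightarrow> (real \<times> real \<Rightarrow> real) \<Rightarrow> (real \<times> real \<Rightarrow> real)
     \<Rightarrow> (real \<times> real \<Rightarrow> real) \<Rightarrow> (real \<Rightarrow> real) \<Rightarrow> (real \<Rightarrow> config) \<Rightarrow> real" where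
  "entropy_production a T N K F Q \<psi> w \<eta> =
     real N powr (- a) *
       (LINT z:space_time T|lborel. (case z of (x, t) \<Rightarrow>
          F (rho_hat N K (\<eta> t) x, w t) * pd2 (space_time T) \<psi> (x, t)
          + pd2 ent_dom F (rho_hat N K (\<eta> t) x, w t)
              * vector_derivative w (at t within {0..T}) * \<psi> (x, t)))
     + (LINT z:space_time T|lborel. (case z of (x, t) \<Rightarrow>
          Q (rho_hat N K (\<eta> t) x, w t) * pd1 (space_time T) \<psi> (x, t)))"

end

theory Submission
  imports Defs
begin

text \<open>
  The terms carrying the factor \<open>N\<^sup>-\<^sup>a\<close> are bounded, so only the integral of \<open>Q \<partial>\<^sub>x\<psi>\<close> matters.
  Summation by parts compares it with the time integral of \<open>U = L \<Phi>\<close>, where \<open>\<Phi>\<close> is the sum over the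
  cells of \<open>\<psi> F(u\<^sub>i, \<rho>)\<close> and \<open>u\<^sub>i\<close> is the block average at \<open>i\<close>. The error consists of the squares of the
  gradients \<open>K (u\<^sub>i\<^sub>+\<^sub>1 - u\<^sub>i)\<close> and of the one-block defects, summed over \<open>i\<close> and divided by \<open>K\<close>, and of
  \<open>u\<^sub>i - \<rho>\<close> at the two end blocks.

  The time integral of \<open>U\<close> is small in \<open>L\<^sup>2\<close>: its second moment is a double time integral in which the
  inner conditional expectation is \<open>O(N\<^sup>-\<^sup>a)\<close> by the forward equation.

  For the error, the Bernoulli measure \<open>\<nu>\<close> of density \<open>\<rho>(t)\<close> is stationary for the generator at time
  \<open>t\<close>. The entropy of \<open>m = (\<mu> + \<nu>)/2\<close>, with \<open>\<mu>\<close> the law of the process, relative to \<open>\<nu>\<close> is at most of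
  order \<open>N\<close> initially, and its production bounds the time integral of the Dirichlet form of \<open>m\<close> by a
  constant times \<open>N\<^sup>-\<^sup>a\<close>; the mixture keeps the density above \<open>1/2\<close>, and nonnegative functions have
  \<open>\<mu>\<close>-expectation at most twice their \<open>m\<close>-expectation. No logarithmic Sobolev inequality is needed: a
  function \<open>g\<close> that is an average of terms \<open>h (\<eta>\<^sub>a - \<eta>\<^sub>b)\<close> satisfies, by exchanging \<open>a\<close> and \<open>b\<close> in the
  expectation of \<open>g h (\<eta>\<^sub>a - \<eta>\<^sub>b)\<close>, a bound of the second moment by \<open>1/K\<close> plus \<open>K\<close> times the Dirichlet
  form of the block. Both errors vanish because \<open>\<surd>N \<lless> K \<lless> N\<^sup>a\<close>.
\<close>

section \<open>Relative entropy and dissipation of finite jump processes\<close>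

text \<open>Where the two conditions on \<open>K\<close> come from: a second-moment estimate on one
  block costs \<open>K\<close> times the Dirichlet form of its bonds plus \<open>1/K\<close>; each
  bond lies in at most \<open>2K\<close> blocks and the error functional carries a factor
  \<open>1/K\<close>, so summation over the blocks gives \<open>K N^-a + N/K^2\<close>. The second
  moment of the time integral of \<open>U\<close> has order \<open>N^(1-a)/K\<close>, the product of
  these two quantities. The obstacle is that for \<open>p > 1/2\<close> the Bernoulli measure is
  stationary but not reversible, and that it moves with \<open>\<rho>\<close>. Stationarity
  suffices, because \<open>ln y <= y - 1\<close>, applied to square roots of densities, splits the
  production into a term linear in the density, which stationarity cancels, and minus a sum of
  squares, in which only symmetrized rates survive. The motion of \<open>\<nu>\<close> produces a
  \<open>\<nu>\<close>-average of \<open>(d/dt ln \<nu>) ln f\<close>, where \<open>f\<close> is the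
  density of \<open>m\<close>; this calls for a lower bound on \<open>f\<close>, which the mixture
  supplies. Second moments become first moments through
  \<open>|v| <= \<delta> + v^2/\<delta>\<close>, with \<open>\<delta>\<close> sent to
  \<open>0\<close> after \<open>N\<close> goes to infinity.\<close>

lemma sum_involution:
  assumes "\<And>x. x \<in> S \<Longrightarrow> \<sigma> x \<in> S" "\<And>x. x \<in> S \<Longrightarrow> \<sigma> (\<sigma> x) = x"
  shows "(\<Sum>x\<in>S. f (\<sigma> x)) = (\<Sum>x\<in>S. f x)"
  by (rule sum.reindex_bij_witness[of _ \<sigma> \<sigma>]) (use assms in auto)

text \<open>Since \<open>d\<close> is odd, averaging the sum with its image under
  \<open>\<sigma>\<close> turns \<open>f g d\<close> into half of
  \<open>(f - f\<sigma>) g d + f\<sigma> (g - g\<sigma>) d\<close>. In the first part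
  \<open>f - f\<sigma>\<close> factors into a difference and a sum of square roots, which Young
  separates; the second part costs \<open>\<epsilon>\<close>. The coefficient \<open>1/4\<close>
  matters: two such terms can still be absorbed when the second moment of \<open>g\<close> is itself
  the quantity to be estimated.\<close>

lemma involution_by_parts:
  fixes f g d \<kappa> :: "'s \<Rightarrow> real"
  assumes S: "\<And>x. x \<in> S \<Longrightarrow> \<sigma> x \<in> S" "\<And>x. x \<in> S \<Longrightarrow> \<sigma> (\<sigma> x) = x"
    and \<kappa>: "\<And>x. x \<in> S \<Longrightarrow> \<kappa> x \<ge> 0" "\<And>x. x \<in> S \<Longrightarrow> \<kappa> (\<sigma> x) = \<kappa> x"
    and f: "\<And>x. x \<in> S \<Longrightarrow> f x \<ge> 0"
    and d: "\<And>x. x \<in> S \<Longrightarrow> d (\<sigma> x) = - d x" "\<And>x. x \<in> S \<Longrightarrow> \<bar>d x\<bar> \<le> 1"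
    and g: "\<And>x. x \<in> S \<Longrightarrow> \<bar>g (\<sigma> x) - g x\<bar> \<le> \<epsilon>"
  shows "\<bar>\<Sum>x\<in>S. \<kappa> x * f x * g x * d x\<bar> \<le>
     2 * (\<Sum>x\<in>S. \<kappa> x * (sqrt (f (\<sigma> x)) - sqrt (f x))\<^sup>2)
     + 1/4 * (\<Sum>x\<in>S. \<kappa> x * f x * (g x)\<^sup>2) + (\<epsilon> + \<epsilon>\<^sup>2) * (\<Sum>x\<in>S. \<kappa> x * f x)"
proof -
  let ?A = "\<Sum>x\<in>S. \<kappa> x * f x * g x * d x"
  let ?D = "\<Sum>x\<in>S. \<kappa> x * (sqrt (f (\<sigma> x)) - sqrt (f x))\<^sup>2"
  let ?V = "\<Sum>x\<in>S. \<kappa> x * f x * (g x)\<^sup>2"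
  let ?M = "\<Sum>x\<in>S. \<kappa> x * f x"
  have A2: "?A = (\<Sum>x\<in>S. \<kappa> x * f (\<sigma> x) * g (\<sigma> x) * (- d x))"
    by (subst sum_involution[symmetric, of S \<sigma>]) (use S \<kappa> d in auto)
  have M2: "(\<Sum>x\<in>S. \<kappa> x * f (\<sigma> x)) = ?M"
    by (subst (2) sum_involution[symmetric, of S \<sigma>]) (use S \<kappa> d in auto)
  have V2: "(\<Sum>x\<in>S. \<kappa> x * f (\<sigma> x) * (g x)\<^sup>2) = (\<Sum>x\<in>S. \<kappa> x * f x * (g (\<sigma> x))\<^sup>2)"
    by (subst sum_involution[symmetric, of S \<sigma>]) (use S \<kappa> d in auto)
  have V3: "(\<Sum>x\<in>S. \<kappa> x * f x * (g (\<sigma> x))\<^sup>2) \<le> (\<Sum>x\<in>S. \<kappa> x * f x * (2 * (g x)\<^sup>2 + 2 * \<epsilon>\<^sup>2))"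
  proof (intro sum_mono mult_left_mono)
    fix x assume x: "x \<in> S"
    have "(g (\<sigma> x) - g x)\<^sup>2 \<le> \<epsilon>\<^sup>2" using power_mono[OF g[OF x], of 2] by simp
    moreover have "(g (\<sigma> x))\<^sup>2 \<le> 2 * (g x)\<^sup>2 + 2 * (g (\<sigma> x) - g x)\<^sup>2"
      using zero_le_power2[of "g (\<sigma> x) - 2 * g x"] by (simp add: power2_eq_square algebra_simps)
    ultimately show "(g (\<sigma> x))\<^sup>2 \<le> 2 * (g x)\<^sup>2 + 2 * \<epsilon>\<^sup>2" by simp
    show "0 \<le> \<kappa> x * f x" using \<kappa> f x by simp
  qed
  also have "\<dots> = 2 * ?V + 2 * \<epsilon>\<^sup>2 * ?M"
    by (simp add: algebra_simps sum.distrib sum_distrib_left)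
  finally have V4: "(\<Sum>x\<in>S. \<kappa> x * f (\<sigma> x) * (g x)\<^sup>2) \<le> 2 * ?V + 2 * \<epsilon>\<^sup>2 * ?M" using V2 by simp
  have "2 * ?A = (\<Sum>x\<in>S. \<kappa> x * f x * g x * d x) + (\<Sum>x\<in>S. \<kappa> x * f (\<sigma> x) * g (\<sigma> x) * (- d x))"
    using A2 by simp
  also have "\<dots> = (\<Sum>x\<in>S. \<kappa> x * ((f x - f (\<sigma> x)) * g x * d x) + \<kappa> x * (f (\<sigma> x) * (g x - g (\<sigma> x)) * d x))"
    unfolding sum.distrib[symmetric] by (intro sum.cong) (auto simp: algebra_simps)
  finally have "2 * \<bar>?A\<bar> = \<bar>\<Sum>x\<in>S. \<kappa> x * ((f x - f (\<sigma> x)) * g x * d x) + \<kappa> x * (f (\<sigma> x) * (g x - g (\<sigma> x)) * d x)\<bar>"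
    by simp
  also have "\<dots> \<le> (\<Sum>x\<in>S. \<bar>\<kappa> x * ((f x - f (\<sigma> x)) * g x * d x) + \<kappa> x * (f (\<sigma> x) * (g x - g (\<sigma> x)) * d x)\<bar>)"
    by (rule sum_abs)
  also have "\<dots> \<le> (\<Sum>x\<in>S. 3 * (\<kappa> x * (sqrt (f (\<sigma> x)) - sqrt (f x))\<^sup>2)
      + 1/6 * (\<kappa> x * f x * (g x)\<^sup>2 + \<kappa> x * f (\<sigma> x) * (g x)\<^sup>2) + \<epsilon> * (\<kappa> x * f (\<sigma> x)))"
  proof (rule sum_mono)
    fix x assume x: "x \<in> S"
    define u v where "u = sqrt (f x)" and "v = sqrt (f (\<sigma> x))"
    have u: "u \<ge> 0" "v \<ge> 0" "f x = u\<^sup>2" "f (\<sigma> x) = v\<^sup>2"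
      using f[OF x] f[OF S(1)[OF x]] by (auto simp: u_def v_def)
    have "\<bar>(f x - f (\<sigma> x)) * g x * d x\<bar> \<le> \<bar>(f x - f (\<sigma> x)) * g x\<bar>"
      using d(2)[OF x] by (simp add: abs_mult mult_left_le)
    also have "\<dots> = \<bar>v - u\<bar> * \<bar>(u + v) * g x\<bar>"
      unfolding u by (simp add: abs_mult[symmetric]) (simp add: power2_eq_square algebra_simps abs_minus_commute)
    \<comment> \<open>The Young weights \<open>3\<close> and \<open>1/12\<close> are chosen so that,
      after \<open>(u + v)^2 <= 2 (u^2 + v^2)\<close> and \<open>V4\<close>, the coefficient of
      \<open>?V\<close> in the bound of twice the sum is \<open>1/6 (1 + 2) = 1/2\<close>.\<close>
    also have "\<dots> \<le> 3 * (v - u)\<^sup>2 + 1/12 * ((u + v) * g x)\<^sup>2"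
      using zero_le_power2[of "6 * \<bar>v - u\<bar> - \<bar>(u + v) * g x\<bar>"]
      by (simp add: power2_diff power_mult_distrib)
    also have "((u + v) * g x)\<^sup>2 \<le> 2 * (u\<^sup>2 + v\<^sup>2) * (g x)\<^sup>2"
      unfolding power_mult_distrib
      by (intro mult_right_mono) (use zero_le_power2[of "u - v"] in \<open>auto simp: power2_eq_square algebra_simps\<close>)
    finally have 1: "\<bar>(f x - f (\<sigma> x)) * g x * d x\<bar> \<le> 3 * (v - u)\<^sup>2 + 1/6 * (u\<^sup>2 + v\<^sup>2) * (g x)\<^sup>2"
      by (simp add: algebra_simps)
    have "\<bar>(g x - g (\<sigma> x)) * d x\<bar> \<le> \<epsilon> * 1"
      unfolding abs_mult by (intro mult_mono) (use g[OF x] d(2)[OF x] in auto)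
    then have 2: "\<bar>f (\<sigma> x) * (g x - g (\<sigma> x)) * d x\<bar> \<le> \<epsilon> * f (\<sigma> x)"
      using f[OF S(1)[OF x]] mult_left_mono[of "\<bar>(g x - g (\<sigma> x)) * d x\<bar>" \<epsilon> "f (\<sigma> x)"]
      by (simp add: abs_mult mult.assoc mult.commute mult.left_commute)
    have "\<bar>\<kappa> x * ((f x - f (\<sigma> x)) * g x * d x) + \<kappa> x * (f (\<sigma> x) * (g x - g (\<sigma> x)) * d x)\<bar>
      = \<kappa> x * \<bar>(f x - f (\<sigma> x)) * g x * d x + f (\<sigma> x) * (g x - g (\<sigma> x)) * d x\<bar>"
      using \<kappa>(1)[OF x] by (simp add: abs_mult distrib_left[symmetric])
    also have "\<dots> \<le> \<kappa> x * (3 * (v - u)\<^sup>2 + 1/6 * (u\<^sup>2 + v\<^sup>2) * (g x)\<^sup>2 + \<epsilon> * f (\<sigma> x))"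
      by (intro mult_left_mono) (use 1 2 \<kappa>(1)[OF x] in auto)
    also have "\<dots> = 3 * (\<kappa> x * (sqrt (f (\<sigma> x)) - sqrt (f x))\<^sup>2)
      + 1/6 * (\<kappa> x * f x * (g x)\<^sup>2 + \<kappa> x * f (\<sigma> x) * (g x)\<^sup>2) + \<epsilon> * (\<kappa> x * f (\<sigma> x))"
      unfolding u_def[symmetric] v_def[symmetric] u(3,4) using u(1,2) by (simp add: algebra_simps)
    finally show "\<bar>\<kappa> x * ((f x - f (\<sigma> x)) * g x * d x) + \<kappa> x * (f (\<sigma> x) * (g x - g (\<sigma> x)) * d x)\<bar> \<le> \<dots>" .
  qed
  also have "\<dots> = 3 * ?D + 1/6 * (?V + (\<Sum>x\<in>S. \<kappa> x * f (\<sigma> x) * (g x)\<^sup>2)) + \<epsilon> * ?M"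
    by (simp add: sum.distrib sum_distrib_left[symmetric] sum_divide_distrib[symmetric] M2)
  also have "\<dots> \<le> 3 * ?D + 1/6 * (?V + (2 * ?V + 2 * \<epsilon>\<^sup>2 * ?M)) + \<epsilon> * ?M"
    using V4 by simp
  finally have fin: "2 * \<bar>?A\<bar> \<le> 3 * ?D + 1/2 * ?V + (1/3 * \<epsilon>\<^sup>2 + \<epsilon>) * ?M" by (simp add: algebra_simps)
  have nn: "0 \<le> ?D" "0 \<le> \<epsilon>\<^sup>2 * ?M" using \<kappa> f by (auto intro!: sum_nonneg mult_nonneg_nonneg)
  have "\<epsilon> * ?M \<ge> 0"
  proof (cases "S = {}")
    case False
    then obtain x where "x \<in> S" by auto
    from g[OF this] have "\<epsilon> \<ge> 0" by linarith
    then show ?thesis using \<kappa> f by (auto intro!: sum_nonneg mult_nonneg_nonneg)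
  qed auto
  then show ?thesis using fin nn unfolding distrib_right by linarith
qed

text \<open>Every move is a map \<open>\<tau> k\<close> with a state-dependent rate, so bulk
  exchanges and boundary flips are treated alike and the entropy production is computed once for any
  family of moves.\<close>

definition jump_gen :: "'k set \<Rightarrow> ('k \<Rightarrow> 's \<Rightarrow> real) \<Rightarrow> ('k \<Rightarrow> 's \<Rightarrow> 's) \<Rightarrow> ('s \<Rightarrow> real) \<Rightarrow> 's \<Rightarrow> real" where
  "jump_gen I r \<tau> f x = (\<Sum>k\<in>I. r k x * (f (\<tau> k x) - f x))"

text \<open>Linearity on a finite state space, written with indicators because the forward equation
  for point masses involves the generator only through them.\<close>

lemma jump_gen_decompose:
  assumes "finite S" "\<And>k. k \<in> I \<Longrightarrow> \<tau> k x \<in> S" "x \<in> S"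
  shows "(\<Sum>y\<in>S. f y * jump_gen I r \<tau> (\<lambda>z. if z = y then 1 else 0) x) = jump_gen I r \<tau> f x"
proof -
  have "(\<Sum>y\<in>S. f y * jump_gen I r \<tau> (\<lambda>z. if z = y then 1 else 0) x)
    = (\<Sum>k\<in>I. r k x * (\<Sum>y\<in>S. f y * ((if \<tau> k x = y then 1 else 0) - (if x = y then 1 else 0))))"
    unfolding jump_gen_def sum_distrib_left by (subst sum.swap) (simp add: algebra_simps)
  also have "\<dots> = jump_gen I r \<tau> f x"
    unfolding jump_gen_def
    by (intro sum.cong refl arg_cong2[where f="(*)"])
       (use assms in \<open>simp add: right_diff_distrib sum_subtractf if_distrib[where f="\<lambda>a. _ * a"] sum.delta cong: if_cong\<close>)
  finally show ?thesis .
qed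

text \<open>The proof differentiates the relative entropy \<open>H\<close> of
  \<open>m = (\<mu> + nu)/2\<close> with respect to the moving measure \<open>nu = exp lnu\<close>,
  assumed stationary but not reversible. \<open>H0\<close> bounds \<open>H 0\<close> because
  \<open>ln (m 0 x) <= 0\<close>, and \<open>H T >= 0\<close>. The constant \<open>3 B\<close>
  covers the contributions of the motion of \<open>nu\<close>, namely \<open>B\<close>,
  \<open>B/2\<close> and \<open>B\<close> from \<open>e4\<close>, \<open>e5\<close> and
  \<open>e6\<close>. Prescribing \<open>lnu\<close> rather than \<open>nu\<close> makes positivity
  automatic, and for product measures its derivative is a sum over sites.\<close>

lemma entropy_dissipation:
  fixes \<mu> lnu b :: "real \<Rightarrow> 's \<Rightarrow> real"
    and r :: "real \<Rightarrow> 'k \<Rightarrow> 's \<Rightarrow> real"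
  assumes S: "finite S" and \<tau>: "\<And>k x. k \<in> I \<Longrightarrow> x \<in> S \<Longrightarrow> \<tau> k x \<in> S"
    and T: "T > 0" and \<Lambda>: "\<Lambda> \<ge> 0"
    and r0: "\<And>t k x. t \<in> {0..T} \<Longrightarrow> k \<in> I \<Longrightarrow> x \<in> S \<Longrightarrow> r t k x \<ge> 0"
    and \<mu>0: "\<And>t x. t \<in> {0..T} \<Longrightarrow> x \<in> S \<Longrightarrow> \<mu> t x \<ge> 0"
    and \<mu>1: "\<And>t. t \<in> {0..T} \<Longrightarrow> (\<Sum>x\<in>S. \<mu> t x) = 1"
    and fwd: "\<And>t y. t \<in> {0..T} \<Longrightarrow> y \<in> S \<Longrightarrow> ((\<lambda>t. \<mu> t y) has_real_derivative
        (\<Sum>x\<in>S. \<mu> t x * (\<Lambda> * jump_gen I (r t) \<tau> (\<lambda>z. if z = y then 1 else 0) x))) (at t within {0..T})"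
    and lnu: "\<And>t x. t \<in> {0..T} \<Longrightarrow> x \<in> S \<Longrightarrow> ((\<lambda>t. lnu t x) has_real_derivative b t x) (at t within {0..T})"
    and b: "\<And>t x. t \<in> {0..T} \<Longrightarrow> x \<in> S \<Longrightarrow> \<bar>b t x\<bar> \<le> B"
    and nu1: "\<And>t. t \<in> {0..T} \<Longrightarrow> (\<Sum>x\<in>S. exp (lnu t x)) = 1"
    and stat: "\<And>t f. t \<in> {0..T} \<Longrightarrow> (\<Sum>x\<in>S. exp (lnu t x) * jump_gen I (r t) \<tau> f x) = 0"
    and H0: "\<And>x. x \<in> S \<Longrightarrow> - lnu 0 x \<le> H0"
    and f: "\<And>t x. f t x = (\<mu> t x + exp (lnu t x)) / (2 * exp (lnu t x))"
    and dis: "\<And>t. dis t = (\<Sum>x\<in>S. exp (lnu t x) * (\<Sum>k\<in>I. r t k x * (sqrt (f t (\<tau> k x)) - sqrt (f t x))\<^sup>2))"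
    and cont: "continuous_on {0..T} dis"
  shows "\<Lambda> * integral {0..T} dis \<le> H0 + 3 * B * T"
proof -
  define nu where "nu t x = exp (lnu t x)" for t x
  define m where "m t x = (\<mu> t x + nu t x) / 2" for t x
  define \<mu>' where "\<mu>' t y = (\<Sum>x\<in>S. \<mu> t x * (\<Lambda> * jump_gen I (r t) \<tau> (\<lambda>z. if z = y then 1 else 0) x))" for t y
  define l where "l t x = ln (m t x) - lnu t x" for t x
  define H where "H t = (\<Sum>x\<in>S. m t x * l t x)" for t
  have nupos: "nu t x > 0" for t x by (simp add: nu_def)
  have mpos: "m t x > 0" if "t \<in> {0..T}" "x \<in> S" for t x
    using \<mu>0[OF that] nupos[of t x] by (simp add: m_def)
  have fm: "f t x = m t x / nu t x" for t x
    by (simp add: f m_def nu_def field_simps)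
  have fpos: "f t x \<ge> 1/2" if "t \<in> {0..T}" "x \<in> S" for t x
    using \<mu>0[OF that] nupos[of t x] unfolding f nu_def[symmetric] by (simp add: field_simps)
  have lf: "l t x = ln (f t x)" if "t \<in> {0..T}" "x \<in> S" for t x
    using mpos[OF that] nupos[of t x] unfolding fm l_def by (simp add: ln_div nu_def)
  have m1: "(\<Sum>x\<in>S. m t x) = 1" if "t \<in> {0..T}" for t
    using \<mu>1[OF that] nu1[OF that] by (simp add: m_def nu_def sum_divide_distrib[symmetric] sum.distrib)
  have dm: "((\<lambda>t. m t x) has_real_derivative (\<mu>' t x + nu t x * b t x) / 2) (at t within {0..T})"
    if "t \<in> {0..T}" "x \<in> S" for t x
    unfolding m_def nu_def \<mu>'_def
    by (rule derivative_eq_intros fwd[OF that] lnu[OF that] refl)+ (simp_all add: field_simps)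
  have dl: "((\<lambda>t. l t x) has_real_derivative ((\<mu>' t x + nu t x * b t x) / 2) / m t x - b t x) (at t within {0..T})"
    if "t \<in> {0..T}" "x \<in> S" for t x
    unfolding l_def
    by (rule derivative_eq_intros dm[OF that] lnu[OF that] refl mpos[OF that])+ (simp add: field_simps)
  define H' where "H' t = (\<Sum>x\<in>S. (\<mu>' t x + nu t x * b t x) / 2 * l t x
      + m t x * (((\<mu>' t x + nu t x * b t x) / 2) / m t x - b t x))" for t
  have dH: "(H has_real_derivative H' t) (at t within {0..T})" if "t \<in> {0..T}" for t
    unfolding H_def H'_def
  proof (rule DERIV_sum)
    fix x assume x: "x \<in> S"
    show "((\<lambda>t. m t x * l t x) has_real_derivative (\<mu>' t x + nu t x * b t x) / 2 * l t x
      + m t x * (((\<mu>' t x + nu t x * b t x) / 2) / m t x - b t x)) (at t within {0..T})"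
      by (rule derivative_eq_intros dm[OF that x] dl[OF that x] refl)+ simp
  qed
  have H'le: "H' t \<le> - \<Lambda> * dis t + 3 * B" if t: "t \<in> {0..T}" for t
  proof -
    have B0: "B \<ge> 0"
    proof -
      from m1[OF t] have "S \<noteq> {}" by auto
      then obtain x where "x \<in> S" by auto
      from b[OF t this] show ?thesis by linarith
    qed
    have swap: "(\<Sum>y\<in>S. \<mu>' t y * h y) = \<Lambda> * (\<Sum>x\<in>S. \<mu> t x * jump_gen I (r t) \<tau> h x)" for h
    proof -
      have "(\<Sum>y\<in>S. \<mu>' t y * h y) = (\<Sum>x\<in>S. \<Lambda> * \<mu> t x * (\<Sum>y\<in>S. h y * jump_gen I (r t) \<tau> (\<lambda>z. if z = y then 1 else 0) x))"
        unfolding \<mu>'_def sum_distrib_right sum_distrib_left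
        by (subst sum.swap) (simp add: algebra_simps)
      also have "\<dots> = (\<Sum>x\<in>S. \<Lambda> * \<mu> t x * jump_gen I (r t) \<tau> h x)"
        by (intro sum.cong refl arg_cong2[where f="(*)"] jump_gen_decompose) (use S \<tau> in auto)
      finally show ?thesis by (simp add: sum_distrib_left mult.assoc)
    qed
    have mu0: "(\<Sum>y\<in>S. \<mu>' t y) = 0"
      using swap[of "\<lambda>_. 1"] by (simp add: jump_gen_def)
    have e1: "H' t = (\<Sum>x\<in>S. \<mu>' t x * l t x) / 2 + (\<Sum>x\<in>S. nu t x * b t x * l t x) / 2
        + (\<Sum>x\<in>S. \<mu>' t x) / 2 + (\<Sum>x\<in>S. nu t x * b t x) / 2 - (\<Sum>x\<in>S. m t x * b t x)"
    proof -
      have "H' t = (\<Sum>x\<in>S. \<mu>' t x * l t x / 2 + nu t x * b t x * l t x / 2 + \<mu>' t x / 2 + nu t x * b t x / 2 - m t x * b t x)"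
        unfolding H'_def
      proof (intro sum.cong refl)
        fix x assume "x \<in> S"
        from mpos[OF t this] show "(\<mu>' t x + nu t x * b t x) / 2 * l t x
          + m t x * (((\<mu>' t x + nu t x * b t x) / 2) / m t x - b t x)
          = \<mu>' t x * l t x / 2 + nu t x * b t x * l t x / 2 + \<mu>' t x / 2 + nu t x * b t x / 2 - m t x * b t x"
          by (simp add: field_simps)
      qed
      then show ?thesis by (simp add: sum.distrib sum_subtractf sum_divide_distrib)
    qed
    \<comment> \<open>The average of \<open>jump_gen\<close> under \<open>nu\<close> vanishes by
      stationarity, so half the average under \<open>\<mu>\<close> equals the full average under the
      mixture \<open>m\<close>.\<close>
    have e2: "(\<Sum>x\<in>S. \<mu>' t x * l t x) / 2 = \<Lambda> * (\<Sum>x\<in>S. m t x * jump_gen I (r t) \<tau> (l t) x)"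
      using stat[OF t, of "l t"] unfolding swap m_def
      by (simp add: nu_def sum_divide_distrib[symmetric] add_divide_distrib distrib_right sum.distrib)
    have e3: "(\<Sum>x\<in>S. m t x * jump_gen I (r t) \<tau> (l t) x) \<le> - dis t"
    proof -
      have "(\<Sum>x\<in>S. m t x * jump_gen I (r t) \<tau> (l t) x)
        \<le> (\<Sum>x\<in>S. nu t x * (jump_gen I (r t) \<tau> (f t) x - (\<Sum>k\<in>I. r t k x * (sqrt (f t (\<tau> k x)) - sqrt (f t x))\<^sup>2)))"
      proof (intro sum_mono)
        fix x assume x: "x \<in> S"
        have "f t x * jump_gen I (r t) \<tau> (l t) x
          \<le> (\<Sum>k\<in>I. r t k x * ((f t (\<tau> k x) - f t x) - (sqrt (f t (\<tau> k x)) - sqrt (f t x))\<^sup>2))"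
          unfolding jump_gen_def sum_distrib_left
        proof (intro sum_mono)
          fix k assume k: "k \<in> I"
          let ?y = "\<tau> k x"
          have y: "?y \<in> S" using \<tau> k x by auto
          have p: "f t x > 0" "f t ?y > 0" using fpos[OF t x] fpos[OF t y] by auto
          \<comment> \<open>Applying \<open>ln y <= y - 1\<close> to the ratio of the square roots,
            not of the densities, leaves the squared difference of square roots as a gain. What
            remains is linear in \<open>f\<close> and sums to \<open>jump_gen\<close> of
            \<open>f\<close>, whose \<open>nu\<close>-average is \<open>0\<close>.\<close>
          have "ln (sqrt (f t ?y) / sqrt (f t x)) \<le> sqrt (f t ?y) / sqrt (f t x) - 1"
            by (rule ln_le_minus_one) (use p in simp)
          also have "ln (sqrt (f t ?y) / sqrt (f t x)) = (l t ?y - l t x) / 2"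
            using p x y t by (simp add: ln_div ln_sqrt lf diff_divide_distrib)
          finally have "f t x * (l t ?y - l t x) \<le> f t x * (2 * (sqrt (f t ?y) / sqrt (f t x) - 1))"
            using p by (intro mult_left_mono) (auto simp: mult.commute)
          also have "\<dots> = 2 * sqrt (f t x) * sqrt (f t ?y) - 2 * f t x"
          proof -
            have "f t x = sqrt (f t x) * sqrt (f t x)" using p by simp
            moreover have "sqrt (f t x) > 0" using p by simp
            ultimately show ?thesis by (simp add: field_simps)
          qed
          also have "\<dots> = (f t ?y - f t x) - (sqrt (f t ?y) - sqrt (f t x))\<^sup>2"
            using p by (simp add: power2_diff)
          finally have "r t k x * (f t x * (l t ?y - l t x)) \<le> r t k x * ((f t ?y - f t x) - (sqrt (f t ?y) - sqrt (f t x))\<^sup>2)"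
            by (intro mult_left_mono r0[OF t k x])
          then show "f t x * (r t k x * (l t ?y - l t x)) \<le> r t k x * ((f t ?y - f t x) - (sqrt (f t ?y) - sqrt (f t x))\<^sup>2)"
            by (simp add: algebra_simps)
        qed
        also have "\<dots> = jump_gen I (r t) \<tau> (f t) x - (\<Sum>k\<in>I. r t k x * (sqrt (f t (\<tau> k x)) - sqrt (f t x))\<^sup>2)"
          by (simp add: jump_gen_def right_diff_distrib sum_subtractf)
        finally have "nu t x * (f t x * jump_gen I (r t) \<tau> (l t) x) \<le> nu t x * \<dots>"
          by (intro mult_left_mono) (use nupos[of t x] in auto)
        moreover have "nu t x * f t x = m t x" using nupos[of t x] by (simp add: fm)
        ultimately show "m t x * jump_gen I (r t) \<tau> (l t) x \<le> nu t x * (jump_gen I (r t) \<tau> (f t) x - (\<Sum>k\<in>I. r t k x * (sqrt (f t (\<tau> k x)) - sqrt (f t x))\<^sup>2))"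
          by (simp add: mult.assoc[symmetric])
      qed
      also have "\<dots> = - dis t"
        using stat[OF t, of "f t"] by (simp add: right_diff_distrib sum_subtractf dis nu_def)
      finally show ?thesis .
    qed
    have nuone: "(\<Sum>x\<in>S. nu t x) = 1" using nu1[OF t] by (simp add: nu_def)
    \<comment> \<open>Here the mixture is used: \<open>f >= 1/2\<close> gives
      \<open>l >= -1\<close>; together with \<open>l <= f - 1\<close> this yields
      \<open>|l| <= f + 1\<close>, whose \<open>nu\<close>-average is \<open>2\<close>.\<close>
    have e4: "(\<Sum>x\<in>S. nu t x * b t x * l t x) \<le> 2 * B"
    proof -
      have "(\<Sum>x\<in>S. nu t x * b t x * l t x) \<le> (\<Sum>x\<in>S. B * (m t x - nu t x) + 2 * B * nu t x)"
      proof (intro sum_mono)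
        fix x assume x: "x \<in> S"
        have "l t x \<le> f t x - 1" unfolding lf[OF t x] by (rule ln_le_minus_one) (use fpos[OF t x] in simp)
        moreover have "l t x \<ge> -1"
        proof -
          have "ln (1 / f t x) \<le> 1 / f t x - 1" by (rule ln_le_minus_one) (use fpos[OF t x] in simp)
          moreover have "1 / f t x \<le> 2" using fpos[OF t x] by (simp add: field_simps)
          moreover have "ln (1 / f t x) = - l t x" using fpos[OF t x] unfolding lf[OF t x] by (simp add: ln_div)
          ultimately show ?thesis by linarith
        qed
        ultimately have "\<bar>l t x\<bar> \<le> f t x - 1 + 2" using fpos[OF t x] by linarith
        then have "\<bar>b t x\<bar> * \<bar>l t x\<bar> \<le> B * (f t x - 1 + 2)"
          using b[OF t x] B0 by (intro mult_mono) auto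
        then have "nu t x * (b t x * l t x) \<le> nu t x * (B * (f t x - 1 + 2))"
          using nupos[of t x] abs_ge_self[of "b t x * l t x"] by (intro mult_left_mono) (auto simp: abs_mult)
        moreover have "nu t x * f t x = m t x" using nupos[of t x] by (simp add: fm)
        ultimately show "nu t x * b t x * l t x \<le> B * (m t x - nu t x) + 2 * B * nu t x"
          by (simp add: algebra_simps)
      qed
      also have "\<dots> = 2 * B" using nuone m1[OF t] 
        by (simp add: sum.distrib sum_distrib_left[symmetric] sum_subtractf)
      finally show ?thesis .
    qed
    have e5: "(\<Sum>x\<in>S. nu t x * b t x) \<le> B"
    proof -
      have "(\<Sum>x\<in>S. nu t x * b t x) \<le> (\<Sum>x\<in>S. nu t x * B)"
        by (intro sum_mono mult_left_mono) (use b[OF t] nupos[of t] in \<open>auto simp: abs_le_iff less_imp_le\<close>)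
      then show ?thesis using nuone by (simp add: sum_distrib_right[symmetric])
    qed
    have e6: "- (\<Sum>x\<in>S. m t x * b t x) \<le> B"
    proof -
      have "(\<Sum>x\<in>S. m t x * (- b t x)) \<le> (\<Sum>x\<in>S. m t x * B)"
        by (intro sum_mono mult_left_mono) (use b[OF t] mpos[OF t] in \<open>auto simp: abs_le_iff less_imp_le\<close>)
      then show ?thesis using m1[OF t] by (simp add: sum_distrib_right[symmetric] sum_negf)
    qed
    have "\<Lambda> * (\<Sum>x\<in>S. m t x * jump_gen I (r t) \<tau> (l t) x) \<le> \<Lambda> * (- dis t)"
      by (intro mult_left_mono e3 \<Lambda>)
    then show ?thesis using e1 e2 mu0 e4 e5 e6 B0 by simp
  qed
  define G where "G t = H t + \<Lambda> * integral {0..t} dis - 3 * B * t" for t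
  have dG: "(G has_real_derivative (H' t + \<Lambda> * dis t - 3 * B)) (at t within {0..T})" if "t \<in> {0..T}" for t
  proof -
    have "((\<lambda>t. integral {0..t} dis) has_real_derivative dis t) (at t within {0..T})"
      using integral_has_vector_derivative[OF cont that] by (simp add: has_real_derivative_iff_has_vector_derivative)
    then show ?thesis unfolding G_def
      by (auto intro!: derivative_eq_intros dH[OF that])
  qed
  have "G T \<le> G 0"
  proof (rule DERIV_nonpos_imp_decreasing_open[of 0 T G])
    show "0 \<le> T" using T by simp
    show "continuous_on {0..T} G"
      by (rule DERIV_continuous_on[OF dG])
    fix x assume "0 < x" "x < T"
    then show "\<exists>y. (G has_real_derivative y) (at x) \<and> y \<le> 0"
      using dG[of x] H'le[of x] by (auto simp: at_within_Icc_at)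
  qed
  moreover have "H T \<ge> 0"
  proof -
    have "0 = (\<Sum>x\<in>S. m T x - nu T x)"
      using m1[of T] nu1[of T] T by (simp add: sum_subtractf nu_def)
    also have "\<dots> \<le> H T" unfolding H_def
    proof (intro sum_mono)
      fix x assume x: "x \<in> S"
      have T': "T \<in> {0..T}" using T by simp
      have "ln (1 / f T x) \<le> 1 / f T x - 1" by (rule ln_le_minus_one) (use fpos[OF T' x] in simp)
      then have "1 - 1 / f T x \<le> l T x" using fpos[OF T' x] by (simp add: lf[OF T' x] ln_div)
      then have "m T x * (1 - 1 / f T x) \<le> m T x * l T x" using mpos[OF T' x] by (intro mult_left_mono) auto
      moreover have "m T x * (1 - 1 / f T x) = m T x - nu T x"
        using mpos[OF T' x] nupos[of T x] by (simp add: fm field_simps)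
      ultimately show "m T x - nu T x \<le> m T x * l T x" by simp
    qed
    finally show ?thesis .
  qed
  moreover have "H 0 \<le> H0"
  proof -
    have Z: "0 \<in> {0..T}" using T by simp
    have "H 0 \<le> (\<Sum>x\<in>S. m 0 x * H0)" unfolding H_def
    proof (intro sum_mono mult_left_mono)
      fix x assume x: "x \<in> S"
      have "m 0 x \<le> (\<Sum>x\<in>S. m 0 x)" using x S mpos[OF Z] by (intro member_le_sum) (auto simp: less_imp_le)
      then have "ln (m 0 x) \<le> 0" using m1[OF Z] mpos[OF Z x] by simp
      then show "l 0 x \<le> H0" using H0[OF x] by (simp add: l_def)
    qed (use mpos[OF Z] in \<open>auto simp: less_imp_le\<close>)
    then show ?thesis using m1[OF Z] by (simp add: sum_distrib_right[symmetric])
  qed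
  ultimately show ?thesis by (simp add: G_def)
qed

section \<open>Time integrals along a finite Markov process\<close>

text \<open>\<open>L_linear\<close> states the linearity of \<open>L t\<close> through indicators,
  the form in which the forward equation for point masses combines with a time-dependent
  observable.\<close>

locale finite_markov_process =
  fixes M :: "'w measure" and S :: "'s set" and T :: real
    and L :: "real \<Rightarrow> ('s \<Rightarrow> real) \<Rightarrow> 's \<Rightarrow> real" and \<mu> :: "'s pmf" and X :: "real \<Rightarrow> 'w \<Rightarrow> 's"
  assumes markov: "markov_process M S T L \<mu> X"
    and finite_states: "finite S"
    and T_pos: "0 < T"
    and L_linear: "\<And>t f x. t \<in> {0..T} \<Longrightarrow> x \<in> S \<Longrightarrow>
      (\<Sum>y\<in>S. f y * L t (\<lambda>z. if z = y then 1 else 0) x) = L t f x"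
begin

sublocale prob_space M
  using markov by (simp add: markov_process_def)

abbreviation time :: "real measure" where
  "time \<equiv> restrict_space lborel {0..T}"

lemma finite_measure_time: "finite_measure time"
  by (rule finite_measureI) (use T_pos in \<open>simp add: emeasure_restrict_space\<close>)

sublocale time: finite_measure time by (rule finite_measure_time)

sublocale time_M: pair_sigma_finite time M ..

sublocale time_time: pair_sigma_finite time time ..

lemma space_time_measure [simp]: "space time = {0..T}"
  by (simp add: space_restrict_space)

lemma measure_time: "measure time {0..T} = T"
  using T_pos by (simp add: measure_restrict_space)

lemma X_measurable: "t \<in> {0..T} \<Longrightarrow> X t \<in> measurable M (count_space S)"
  using markov by (simp add: markov_process_def)

lemma X_state: "t \<in> {0..T} \<Longrightarrow> \<omega> \<in> space M \<Longrightarrow> X t \<omega> \<in> S"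
  using measurable_space[OF X_measurable] by fastforce

definition law :: "real \<Rightarrow> 's \<Rightarrow> real" where
  "law t y = measure M {\<omega> \<in> space M. X t \<omega> = y}"

lemma state_set_measurable: "t \<in> {0..T} \<Longrightarrow> {\<omega> \<in> space M. X t \<omega> = y} \<in> sets M"
proof (cases "y \<in> S")
  case True
  assume t: "t \<in> {0..T}"
  have "X t -` {y} \<inter> space M \<in> sets M"
    by (rule measurable_sets[OF X_measurable[OF t]]) (use True in auto)
  also have "X t -` {y} \<inter> space M = {\<omega> \<in> space M. X t \<omega> = y}" by auto
  finally show ?thesis .
next
  case False
  assume t: "t \<in> {0..T}"
  have "{\<omega> \<in> space M. X t \<omega> = y} = {}" using X_state[OF t] False by auto
  then show ?thesis by (metis sets.empty_sets)
qed

lemma law_nonneg: "law t y \<ge> 0"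
  by (simp add: law_def)

lemma fun_X_expand:
  assumes "t \<in> {0..T}" "\<omega> \<in> space M"
  shows "h (X t \<omega>) = (\<Sum>y\<in>S. h y * indicator {\<omega> \<in> space M. X t \<omega> = y} \<omega> :: real)"
proof -
  have "(\<Sum>y\<in>S. h y * indicator {\<omega> \<in> space M. X t \<omega> = y} \<omega>) = (\<Sum>y\<in>S. if X t \<omega> = y then h y else 0)"
    by (intro sum.cong) (use assms in \<open>auto simp: indicator_def\<close>)
  then show ?thesis using X_state[OF assms] finite_states by (simp add: sum.delta')
qed

lemma fun_X_integrable:
  assumes "t \<in> {0..T}"
  shows "integrable M (\<lambda>\<omega>. h (X t \<omega>) :: real)"
proof -
  have "integrable M (\<lambda>\<omega>. \<Sum>y\<in>S. h y * indicator {\<omega> \<in> space M. X t \<omega> = y} \<omega> :: real)"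
    by (intro Bochner_Integration.integrable_sum integrable_mult_right integrable_real_indicator)
       (use state_set_measurable[OF assms] in \<open>auto simp: emeasure_eq_measure\<close>)
  then show ?thesis
    by (rule Bochner_Integration.integrable_cong[THEN iffD2, rotated -1])
       (use fun_X_expand[OF assms] in auto)
qed

lemma expectation_fun_X:
  assumes "t \<in> {0..T}"
  shows "(\<integral>\<omega>. h (X t \<omega>) \<partial>M) = (\<Sum>y\<in>S. law t y * h y)"
proof -
  have "(\<integral>\<omega>. h (X t \<omega>) \<partial>M) = (\<integral>\<omega>. (\<Sum>y\<in>S. h y * indicator {\<omega> \<in> space M. X t \<omega> = y} \<omega>) \<partial>M)"
    by (intro Bochner_Integration.integral_cong refl fun_X_expand assms)
  also have "\<dots> = (\<Sum>y\<in>S. \<integral>\<omega>. h y * indicator {\<omega> \<in> space M. X t \<omega> = y} \<omega> \<partial>M)"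
    by (intro Bochner_Integration.integral_sum integrable_mult_right integrable_real_indicator)
       (use state_set_measurable[OF assms] in \<open>auto simp: emeasure_eq_measure\<close>)
  also have "\<dots> = (\<Sum>y\<in>S. law t y * h y)"
    by (intro sum.cong refl) (simp add: law_def mult.commute Int_def conj_commute)
  finally show ?thesis .
qed

lemma law_sum: "t \<in> {0..T} \<Longrightarrow> (\<Sum>y\<in>S. law t y) = 1"
  using expectation_fun_X[of t "\<lambda>_. 1"] by (simp add: prob_space)

definition P :: "real \<Rightarrow> real \<Rightarrow> 's \<Rightarrow> 's \<Rightarrow> real" where
  "P = (SOME P. transition_function S T L P \<and>
        (\<forall>f s t. 0 \<le> s \<longrightarrow> s \<le> t \<longrightarrow> t \<le> T \<longrightarrow>
           (AE \<omega> in M. real_cond_exp M (natural_filtration M S X s) (\<lambda>\<omega>. f (X t \<omega>)) \<omega>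
                        = (\<Sum>y\<in>S. P s t (X s \<omega>) y * f y))))"

lemma P_ex: "transition_function S T L P \<and>
        (\<forall>f s t. 0 \<le> s \<longrightarrow> s \<le> t \<longrightarrow> t \<le> T \<longrightarrow>
           (AE \<omega> in M. real_cond_exp M (natural_filtration M S X s) (\<lambda>\<omega>. f (X t \<omega>)) \<omega>
                        = (\<Sum>y\<in>S. P s t (X s \<omega>) y * f y)))"
  using someI_ex[OF markov[unfolded markov_process_def, THEN conjunct2, THEN conjunct2, THEN conjunct2, THEN conjunct2]]
  unfolding P_def .

lemma P_transition: "transition_function S T L P"
  using P_ex by simp

lemma P_nonneg: "0 \<le> s \<Longrightarrow> s \<le> t \<Longrightarrow> t \<le> T \<Longrightarrow> x \<in> S \<Longrightarrow> y \<in> S \<Longrightarrow> 0 \<le> P s t x y"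
  and P_sum: "0 \<le> s \<Longrightarrow> s \<le> t \<Longrightarrow> t \<le> T \<Longrightarrow> x \<in> S \<Longrightarrow> (\<Sum>y\<in>S. P s t x y) = 1"
  using P_transition[unfolded transition_function_def, THEN conjunct1] by blast+

lemma P_forward: "0 \<le> s \<Longrightarrow> s \<le> t \<Longrightarrow> t \<le> T \<Longrightarrow> x \<in> S \<Longrightarrow>
    ((\<lambda>t'. \<Sum>y\<in>S. P s t' x y * f y) has_real_derivative (\<Sum>y\<in>S. P s t x y * L t f y)) (at t within {s..T})"
  using P_transition[unfolded transition_function_def, THEN conjunct2, THEN conjunct2, THEN conjunct2] by blast

lemma P_deriv:
  assumes "0 \<le> s" "s \<le> t" "t \<le> T" "x \<in> S" "y \<in> S"
  shows "((\<lambda>t'. P s t' x y) has_real_derivative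
    (\<Sum>z\<in>S. P s t x z * L t (\<lambda>z. if z = y then 1 else 0) z)) (at t within {s..T})"
  using P_forward[OF assms(1-4), of "\<lambda>z. if z = y then 1 else 0"] assms finite_states
  by (simp add: if_distrib[where f="\<lambda>a. _ * a"] sum.delta cong: if_cong)

lemma P_average_le:
  assumes "0 \<le> s" "s \<le> t" "t \<le> T" "x \<in> S" "\<And>y. y \<in> S \<Longrightarrow> \<bar>h y\<bar> \<le> A"
  shows "\<bar>\<Sum>y\<in>S. P s t x y * h y\<bar> \<le> A"
proof -
  have "\<bar>\<Sum>y\<in>S. P s t x y * h y\<bar> \<le> (\<Sum>y\<in>S. \<bar>P s t x y * h y\<bar>)" by (rule sum_abs)
  also have "\<dots> \<le> (\<Sum>y\<in>S. P s t x y * A)"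
    by (intro sum_mono) (use P_nonneg assms in \<open>auto simp: abs_mult intro!: mult_mono\<close>)
  finally show ?thesis using P_sum[OF assms(1-4)] by (simp add: sum_distrib_right[symmetric])
qed

text \<open>\<open>g (X s)\<close> is measurable for the past up to time \<open>s\<close> and may be
  moved inside the conditional expectation, which the Markov property expresses through
  \<open>P s t\<close>. Two-time marginals are all that the second moment of a time integral
  requires.\<close>

lemma two_time_law:
  assumes st: "0 \<le> s" "s \<le> t" "t \<le> T"
  shows "(\<integral>\<omega>. g (X s \<omega>) * f (X t \<omega>) \<partial>M) = (\<Sum>x\<in>S. law s x * (g x * (\<Sum>y\<in>S. P s t x y * f y)))"
proof -
  let ?F = "natural_filtration M S X s"
  have s: "s \<in> {0..T}" and t: "t \<in> {0..T}" using st by auto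
  have F_sub: "(\<Union>r\<in>{0..s}. {X r -` A \<inter> space M | A. A \<subseteq> S}) \<subseteq> sets M"
    using st by (auto intro!: measurable_sets[OF X_measurable])
  then have F_pow: "(\<Union>r\<in>{0..s}. {X r -` A \<inter> space M | A. A \<subseteq> S}) \<subseteq> Pow (space M)"
    using sets.sets_into_space by blast
  have subalg: "subalgebra M ?F"
    unfolding subalgebra_def natural_filtration_def
    using F_pow F_sub sets.sigma_sets_subset[of _ M] by (simp add: space_measure_of_conv sets_measure_of)
  interpret F: finite_measure_subalgebra M ?F
    by standard (rule subalg)
  have gmeas: "(\<lambda>\<omega>. g (X s \<omega>)) \<in> borel_measurable ?F"
  proof -
    have "{\<omega> \<in> space M. X s \<omega> = y} \<in> sets ?F" if "y \<in> S" for y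
    proof -
      have "X s -` {y} \<inter> space M \<in> sets ?F"
        unfolding natural_filtration_def sets_measure_of[OF F_pow]
        by (rule sigma_sets.Basic) (use that st in \<open>auto intro!: bexI[of _ s] exI[of _ "{y}"]\<close>)
      also have "X s -` {y} \<inter> space M = {\<omega> \<in> space M. X s \<omega> = y}" by auto
      finally show ?thesis .
    qed
    then have "(\<lambda>\<omega>. \<Sum>y\<in>S. g y * indicator {\<omega> \<in> space M. X s \<omega> = y} \<omega> :: real) \<in> borel_measurable ?F"
      by (intro borel_measurable_sum borel_measurable_times borel_measurable_const borel_measurable_indicator)
    moreover have "space ?F = space M" using subalg by (simp add: subalgebra_def)
    ultimately show ?thesis
      using fun_X_expand[OF s] by (subst measurable_cong[where g="\<lambda>\<omega>. \<Sum>y\<in>S. g y * indicator {\<omega> \<in> space M. X s \<omega> = y} \<omega>"]) auto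
  qed
  have gf_int: "integrable M (\<lambda>\<omega>. g (X s \<omega>) * f (X t \<omega>))"
  proof -
    have "integrable M (\<lambda>\<omega>. (\<Sum>x\<in>S. g x * indicator {\<omega> \<in> space M. X s \<omega> = x} \<omega>) * f (X t \<omega>))"
      unfolding sum_distrib_right
      by (intro Bochner_Integration.integrable_sum)
         (use integrable_real_mult_indicator[OF state_set_measurable[OF s] fun_X_integrable[OF t, of "\<lambda>y. g _ * f y"]]
          in \<open>simp add: ac_simps\<close>)
    then show ?thesis
      by (rule Bochner_Integration.integrable_cong[THEN iffD2, rotated -1])
         (use fun_X_expand[OF s] in auto)
  qed
  have "(\<integral>\<omega>. g (X s \<omega>) * f (X t \<omega>) \<partial>M) = (\<integral>\<omega>. g (X s \<omega>) * real_cond_exp M ?F (\<lambda>\<omega>. f (X t \<omega>)) \<omega> \<partial>M)"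
    by (rule F.real_cond_exp_intg(2)[symmetric, OF gf_int gmeas])
       (use fun_X_integrable[OF t, of f] in auto)
  also have "\<dots> = (\<integral>\<omega>. g (X s \<omega>) * (\<Sum>y\<in>S. P s t (X s \<omega>) y * f y) \<partial>M)"
  proof (rule integral_cong_AE)
    show "(\<lambda>\<omega>. g (X s \<omega>) * (\<Sum>y\<in>S. P s t (X s \<omega>) y * f y)) \<in> borel_measurable M"
      using fun_X_integrable[OF s, of "\<lambda>x. g x * (\<Sum>y\<in>S. P s t x y * f y)"] by auto
    show "(\<lambda>\<omega>. g (X s \<omega>) * real_cond_exp M ?F (\<lambda>\<omega>. f (X t \<omega>)) \<omega>) \<in> borel_measurable M"
      using fun_X_integrable[OF s, of g] by (intro borel_measurable_times) (auto intro: borel_measurable_cond_exp2)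
    have "AE \<omega> in M. real_cond_exp M ?F (\<lambda>\<omega>. f (X t \<omega>)) \<omega> = (\<Sum>y\<in>S. P s t (X s \<omega>) y * f y)"
      using P_ex st by blast
    then show "AE \<omega> in M. g (X s \<omega>) * real_cond_exp M ?F (\<lambda>\<omega>. f (X t \<omega>)) \<omega> = g (X s \<omega>) * (\<Sum>y\<in>S. P s t (X s \<omega>) y * f y)"
      by eventually_elim simp
  qed
  also have "\<dots> = (\<Sum>x\<in>S. law s x * (g x * (\<Sum>y\<in>S. P s t x y * f y)))"
    by (rule expectation_fun_X[OF s])
  finally show ?thesis .
qed

lemma law_P:
  assumes "t \<in> {0..T}" "y \<in> S"
  shows "law t y = (\<Sum>x\<in>S. law 0 x * P 0 t x y)"
  using two_time_law[of 0 t "\<lambda>_. 1" "\<lambda>z. if z = y then 1 else 0"] assms finite_states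
    expectation_fun_X[of t "\<lambda>z. if z = y then 1 else 0"]
  by (simp add: if_distrib[where f="\<lambda>a. _ * a"] sum.delta cong: if_cong)

lemma law_forward:
  assumes t: "t \<in> {0..T}" and y: "y \<in> S"
  shows "((\<lambda>t. law t y) has_real_derivative
    (\<Sum>x\<in>S. law t x * L t (\<lambda>z. if z = y then 1 else 0) x)) (at t within {0..T})"
proof -
  let ?l = "\<lambda>z. L t (\<lambda>z. if z = y then 1 else 0) z"
  have "((\<lambda>t. \<Sum>x\<in>S. law 0 x * P 0 t x y) has_real_derivative
     (\<Sum>x\<in>S. law 0 x * (\<Sum>z\<in>S. P 0 t x z * ?l z))) (at t within {0..T})"
    by (intro DERIV_sum DERIV_cmult P_deriv) (use t y in auto)
  also have "(\<Sum>x\<in>S. law 0 x * (\<Sum>z\<in>S. P 0 t x z * ?l z)) = (\<Sum>z\<in>S. law t z * ?l z)"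
    unfolding sum_distrib_left
    by (subst sum.swap) (simp add: law_P[OF t] sum_distrib_right mult.assoc)
  finally show ?thesis
    by (rule has_field_derivative_transform_within[where d=1]) (use law_P y t in auto)
qed

section \<open>Joint measurability in time and chance, and occupation integrals\<close>

text \<open>Paths are right-continuous, so the process is the pointwise limit of its values at the
  next point to the right on the grid of mesh \<open>1/(n+1)\<close>. For fixed \<open>n\<close>
  only countably many times occur, and each of them gives a measurable function.\<close>

lemma state_indicator_measurable [measurable]:
  "(\<lambda>(t, \<omega>). if X t \<omega> = y then 1 else 0 :: real) \<in> borel_measurable (time \<Otimes>\<^sub>M M)"
proof -
  \<comment> \<open>The grid point is strictly larger than \<open>t\<close>, as right continuity
    requires; cutting it off at \<open>T\<close> keeps it admissible and returns \<open>T\<close>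
    itself when \<open>t = T\<close>.\<close>
  define \<tau> where "\<tau> n k = max 0 (min T ((real_of_int k + 1) / (real n + 1)))" for n :: nat and k :: int
  define ind where "ind n = (\<lambda>(t, \<omega>). if X (\<tau> n \<lfloor>(real n + 1) * t\<rfloor>) \<omega> = y then 1 else 0 :: real)" for n
  have \<tau>_in: "\<tau> n k \<in> {0..T}" for n k using T_pos by (auto simp: \<tau>_def)
  have single: "(\<lambda>(t, \<omega>). if X (\<tau> n k) \<omega> = y then 1 else 0 :: real) \<in> borel_measurable (time \<Otimes>\<^sub>M M)" for n k
  proof -
    have "(\<lambda>\<omega>. if X (\<tau> n k) \<omega> = y then 1 else 0 :: real) \<in> borel_measurable M"
      using fun_X_integrable[OF \<tau>_in, of "\<lambda>z. if z = y then 1 else 0"] by auto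
    from measurable_compose[OF measurable_snd this, of time] show ?thesis by (simp add: case_prod_beta)
  qed
  have fl: "(\<lambda>z. \<lfloor>(real n + 1) * fst z\<rfloor>) \<in> measurable (time \<Otimes>\<^sub>M M) (count_space UNIV)" for n
  proof -
    have "fst \<in> borel_measurable (time \<Otimes>\<^sub>M M)"
      using measurable_compose[OF measurable_fst measurable_restrict_space1[of "\<lambda>x. x" lborel borel "{0..T}"], of M] by simp
    then show ?thesis by measurable
  qed
  have "ind n \<in> borel_measurable (time \<Otimes>\<^sub>M M)" for n
    using measurable_compose_countable[OF single[of n] fl[of n]] by (simp add: ind_def case_prod_beta)
  moreover have "(\<lambda>n. ind n z) \<longlonglongrightarrow> (case z of (t, \<omega>) \<Rightarrow> (if X t \<omega> = y then 1 else 0))"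
    if "z \<in> space (time \<Otimes>\<^sub>M M)" for z
  proof -
    obtain t \<omega> where z: "z = (t, \<omega>)" by (cases z)
    have t: "t \<in> {0..T}" and \<omega>: "\<omega> \<in> space M" using that by (auto simp: z space_pair_measure)
    have "eventually (\<lambda>n. X (\<tau> n \<lfloor>(real n + 1) * t\<rfloor>) \<omega> = X t \<omega>) sequentially"
    proof (cases "t = T")
      case True
      have "\<tau> n \<lfloor>(real n + 1) * t\<rfloor> = t" for n
      proof -
        have "(real n + 1) * t < real_of_int \<lfloor>(real n + 1) * t\<rfloor> + 1" by linarith
        then have "t < (real_of_int \<lfloor>(real n + 1) * t\<rfloor> + 1) / (real n + 1)"
          by (simp add: pos_less_divide_eq mult.commute)
        then show ?thesis unfolding \<tau>_def using True T_pos by linarith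
      qed
      then show ?thesis by simp
    next
      case False
      then have tT: "0 \<le> t" "t < T" using t by auto
      have "cadlag_path S T (\<lambda>t. X t \<omega>)" using markov \<omega> by (simp add: markov_process_def)
      then have "eventually (\<lambda>r. X r \<omega> = X t \<omega>) (at_right t)"
        using tT by (simp add: cadlag_path_def)
      then obtain b where b: "b > t" "\<And>r. t < r \<Longrightarrow> r < b \<Longrightarrow> X r \<omega> = X t \<omega>"
        unfolding eventually_at_right_field by auto
      have "(\<lambda>n. 1 / (real n + 1)) \<longlonglongrightarrow> 0"
        using LIMSEQ_inverse_real_of_nat by (simp add: inverse_eq_divide add.commute)
      then have "eventually (\<lambda>n. 1 / (real n + 1) < min b T - t) sequentially"
        by (rule order_tendstoD) (use b tT in simp)
      then show ?thesis
      proof eventually_elim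
        case (elim n)
        let ?u = "(real_of_int \<lfloor>(real n + 1) * t\<rfloor> + 1) / (real n + 1)"
        have "(real n + 1) * t < real_of_int \<lfloor>(real n + 1) * t\<rfloor> + 1" by linarith
        then have 1: "t < ?u" by (simp add: pos_less_divide_eq mult.commute)
        have "?u \<le> ((real n + 1) * t + 1) / (real n + 1)" by (intro divide_right_mono) linarith+
        also have "\<dots> = t + 1 / (real n + 1)" by (simp add: field_simps)
        finally have 2: "?u < min b T" using elim by linarith
        have "\<tau> n \<lfloor>(real n + 1) * t\<rfloor> = ?u" using 1 2 tT unfolding \<tau>_def by linarith
        then show ?case using b(2)[OF 1] 2 by simp
      qed
    qed
    then have "eventually (\<lambda>n. ind n z = (case z of (t, \<omega>) \<Rightarrow> (if X t \<omega> = y then 1 else 0))) sequentially"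
      by (rule eventually_mono) (simp add: z ind_def)
    then show ?thesis by (rule tendsto_eventually)
  qed
  ultimately show ?thesis
    by (rule borel_measurable_LIMSEQ_real[where u=ind, rotated])
qed

lemma occupation_expand:
  assumes "t \<in> {0..T}" "\<omega> \<in> space M"
  shows "e (X t \<omega>) = (\<Sum>y\<in>S. e y * (if X t \<omega> = y then 1 else 0 :: real))"
  using X_state[OF assms] finite_states
  by (simp add: if_distrib[where f="\<lambda>a. _ * a"] sum.delta' cong: if_cong)

lemma occupation_measurable:
  assumes "\<And>y. y \<in> S \<Longrightarrow> (\<lambda>t. e t y) \<in> borel_measurable time"
  shows "(\<lambda>(t, \<omega>). e t (X t \<omega>) :: real) \<in> borel_measurable (time \<Otimes>\<^sub>M M)"
proof -
  have m: "(\<lambda>z. \<Sum>y\<in>S. e (fst z) y * (case z of (t, \<omega>) \<Rightarrow> (if X t \<omega> = y then 1 else 0 :: real))) \<in> borel_measurable (time \<Otimes>\<^sub>M M)"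
  proof (intro borel_measurable_sum borel_measurable_times)
    fix y assume "y \<in> S"
    from measurable_compose[OF measurable_fst assms[OF this], of M]
    show "(\<lambda>z. e (fst z) y) \<in> borel_measurable (time \<Otimes>\<^sub>M M)" .
    show "(\<lambda>z. case z of (t, \<omega>) \<Rightarrow> (if X t \<omega> = y then 1 else 0 :: real)) \<in> borel_measurable (time \<Otimes>\<^sub>M M)"
      by (rule state_indicator_measurable)
  qed
  have eq: "(case z of (t, \<omega>) \<Rightarrow> e t (X t \<omega>)) = (\<Sum>y\<in>S. e (fst z) y * (case z of (t, \<omega>) \<Rightarrow> (if X t \<omega> = y then 1 else 0 :: real)))"
    if "z \<in> space (time \<Otimes>\<^sub>M M)" for z
  proof -
    have "fst z \<in> {0..T}" "snd z \<in> space M" using that by (auto simp: space_pair_measure)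
    from occupation_expand[OF this, of "e (fst z)"] show ?thesis unfolding case_prod_beta .
  qed
  have "((\<lambda>z. case z of (t, \<omega>) \<Rightarrow> e t (X t \<omega>)) \<in> borel_measurable (time \<Otimes>\<^sub>M M))
      = ((\<lambda>z. \<Sum>y\<in>S. e (fst z) y * (case z of (t, \<omega>) \<Rightarrow> (if X t \<omega> = y then 1 else 0 :: real))) \<in> borel_measurable (time \<Otimes>\<^sub>M M))"
    by (rule measurable_cong) (rule eq)
  then show ?thesis using m by (rule iffD2)
qed

lemma occupation_path_measurable:
  assumes "\<And>y. y \<in> S \<Longrightarrow> (\<lambda>t. e t y) \<in> borel_measurable time" "\<omega> \<in> space M"
  shows "(\<lambda>t. e t (X t \<omega>) :: real) \<in> borel_measurable time"
  using measurable_compose[OF measurable_Pair2'[OF assms(2)] occupation_measurable[of e, OF assms(1)]]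
  by (simp only: prod.case)

lemma occupation_integrable:
  assumes "\<And>y. y \<in> S \<Longrightarrow> (\<lambda>t. e t y) \<in> borel_measurable time"
    and "\<And>t y. t \<in> {0..T} \<Longrightarrow> y \<in> S \<Longrightarrow> \<bar>e t y\<bar> \<le> B"
  shows "integrable (time \<Otimes>\<^sub>M M) (\<lambda>(t, \<omega>). e t (X t \<omega>) :: real)"
proof -
  interpret TM: finite_measure "time \<Otimes>\<^sub>M M"
    by (rule finite_measure_pair_measure) unfold_locales
  show ?thesis
    by (rule TM.integrable_const_bound[of _ B])
       (use occupation_measurable[of e] X_state assms in \<open>auto simp: space_pair_measure\<close>)
qed

lemma occupation_path_integrable:
  assumes "\<And>y. y \<in> S \<Longrightarrow> (\<lambda>t. e t y) \<in> borel_measurable time"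
    and "\<And>t y. t \<in> {0..T} \<Longrightarrow> y \<in> S \<Longrightarrow> \<bar>e t y\<bar> \<le> B" and "\<omega> \<in> space M"
  shows "integrable time (\<lambda>t. e t (X t \<omega>) :: real)"
  by (rule time.integrable_const_bound[of _ B])
     (use occupation_path_measurable[of e] X_state assms in auto)

lemma
  assumes "\<And>y. y \<in> S \<Longrightarrow> (\<lambda>t. e t y) \<in> borel_measurable time"
    and "\<And>t y. t \<in> {0..T} \<Longrightarrow> y \<in> S \<Longrightarrow> \<bar>e t y\<bar> \<le> B"
  shows occupation_time_integrable: "integrable M (\<lambda>\<omega>. \<integral>t. e t (X t \<omega>) \<partial>time)"
    and expectation_occupation: "(\<integral>\<omega>. (\<integral>t. e t (X t \<omega>) \<partial>time) \<partial>M) = (\<integral>t. (\<Sum>y\<in>S. law t y * e t y) \<partial>time)"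
proof -
  note int = occupation_integrable[of e, OF assms]
  show "integrable M (\<lambda>\<omega>. \<integral>t. e t (X t \<omega>) \<partial>time)"
    using time_M.integrable_snd[OF int] by simp
  have "(\<integral>\<omega>. (\<integral>t. e t (X t \<omega>) \<partial>time) \<partial>M) = (\<integral>t. (\<integral>\<omega>. e t (X t \<omega>) \<partial>M) \<partial>time)"
    using time_M.Fubini_integral[OF int] by simp
  also have "\<dots> = (\<integral>t. (\<Sum>y\<in>S. law t y * e t y) \<partial>time)"
    by (intro Bochner_Integration.integral_cong refl expectation_fun_X) simp
  finally show "(\<integral>\<omega>. (\<integral>t. e t (X t \<omega>) \<partial>time) \<partial>M) = (\<integral>t. (\<Sum>y\<in>S. law t y * e t y) \<partial>time)" .
qed

lemma law_average_le:
  assumes "t \<in> {0..T}" "\<And>y. y \<in> S \<Longrightarrow> \<bar>h y\<bar> \<le> A"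
  shows "\<bar>\<Sum>y\<in>S. law t y * h y\<bar> \<le> A"
proof -
  have "\<bar>\<Sum>y\<in>S. law t y * h y\<bar> \<le> (\<Sum>y\<in>S. \<bar>law t y * h y\<bar>)" by (rule sum_abs)
  also have "\<dots> \<le> (\<Sum>y\<in>S. law t y * A)"
    by (intro sum_mono) (use law_nonneg assms in \<open>auto simp: abs_mult intro!: mult_mono\<close>)
  finally show ?thesis using law_sum[OF assms(1)] by (simp add: sum_distrib_right[symmetric])
qed

lemma set_integral_time:
  assumes "s \<in> {0..T}" "continuous_on {s..T} h"
  shows "(\<integral>t. indicator {s..} t * h t \<partial>time) = integral {s..T} (h :: real \<Rightarrow> real)"
proof -
  have "(\<integral>t. indicator {s..} t * h t \<partial>time) = (LINT t:{0..T}|lborel. indicator {s..} t * h t)"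
    by (subst integral_restrict_space) (auto simp: set_lebesgue_integral_def)
  also have "\<dots> = (LINT t:{s..T}|lborel. h t)"
    unfolding set_lebesgue_integral_def
    by (intro Bochner_Integration.integral_cong refl) (use assms(1) in \<open>auto simp: indicator_def\<close>)
  also have "\<dots> = integral {s..T} h"
    by (intro set_borel_integral_eq_integral borel_integrable_atLeastAtMost')
       (use assms in auto)
  finally show ?thesis .
qed

section \<open>Dynkin estimate and second moment of a time integral\<close>

text \<open>Under \<open>P s t x\<close> the forward equation and the product rule give the mean of
  \<open>\<Lambda> U + \<Phi>'\<close> as the time derivative of the mean of
  \<open>\<Phi> t\<close>. After integration only the end values of \<open>\<Phi>\<close> and the
  integral of \<open>\<Phi>'\<close> remain, and the acceleration \<open>\<Lambda>\<close> divides
  them.\<close>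

lemma dynkin_bound:
  fixes U \<Phi> \<Phi>' :: "real \<Rightarrow> 's \<Rightarrow> real"
  assumes s: "s \<in> {0..T}" and x: "x \<in> S" and \<Lambda>: "\<Lambda> > 0"
    and U: "\<And>y. y \<in> S \<Longrightarrow> continuous_on {0..T} (\<lambda>t. U t y)"
    and LU: "\<And>t y. t \<in> {0..T} \<Longrightarrow> y \<in> S \<Longrightarrow> L t (\<Phi> t) y = \<Lambda> * U t y"
    and d: "\<And>t y. t \<in> {0..T} \<Longrightarrow> y \<in> S \<Longrightarrow> ((\<lambda>t. \<Phi> t y) has_real_derivative \<Phi>' t y) (at t within {0..T})"
    and A: "\<And>t y. t \<in> {0..T} \<Longrightarrow> y \<in> S \<Longrightarrow> \<bar>\<Phi> t y\<bar> \<le> A"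
    and A1: "\<And>t y. t \<in> {0..T} \<Longrightarrow> y \<in> S \<Longrightarrow> \<bar>\<Phi>' t y\<bar> \<le> A1"
  shows "continuous_on {s..T} (\<lambda>t. \<Sum>y\<in>S. P s t x y * U t y)"
    and "\<bar>integral {s..T} (\<lambda>t. \<Sum>y\<in>S. P s t x y * U t y)\<bar> \<le> (2 * A + T * A1) / \<Lambda>"
proof -
  let ?h = "\<lambda>t. \<Sum>y\<in>S. P s t x y * U t y"
  have sub: "{s..T} \<subseteq> {0..T}" using s by auto
  have contP: "continuous_on {s..T} (\<lambda>t. P s t x y)" if "y \<in> S" for y
    by (rule DERIV_continuous_on, rule P_deriv) (use s x that in auto)
  show cont: "continuous_on {s..T} ?h"
    by (intro continuous_intros contP) (use U continuous_on_subset[OF _ sub] in auto)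
  define Z where "Z t = \<Lambda> * integral {s..t} ?h - (\<Sum>y\<in>S. P s t x y * \<Phi> t y)" for t
  have dZ: "(Z has_real_derivative - (\<Sum>y\<in>S. P s t x y * \<Phi>' t y)) (at t within {s..T})"
    if t: "t \<in> {s..T}" for t
  proof -
    have t0: "t \<in> {0..T}" using t sub by auto
    let ?l = "\<lambda>y z. L t (\<lambda>z. if z = y then 1 else 0) z"
    have 1: "((\<lambda>t. integral {s..t} ?h) has_real_derivative ?h t) (at t within {s..T})"
      using integral_has_vector_derivative[OF cont t] by (simp add: has_real_derivative_iff_has_vector_derivative)
    have 2: "((\<lambda>t. \<Sum>y\<in>S. P s t x y * \<Phi> t y) has_real_derivative
        (\<Sum>y\<in>S. (\<Sum>z\<in>S. P s t x z * ?l y z) * \<Phi> t y + \<Phi>' t y * P s t x y)) (at t within {s..T})"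
      by (intro DERIV_sum DERIV_mult P_deriv DERIV_subset[OF d sub]) (use t t0 s x in auto)
    have "(\<Sum>y\<in>S. (\<Sum>z\<in>S. P s t x z * ?l y z) * \<Phi> t y) = (\<Sum>z\<in>S. P s t x z * (\<Sum>y\<in>S. \<Phi> t y * ?l y z))"
      unfolding sum_distrib_left sum_distrib_right by (subst sum.swap) (simp add: ac_simps)
    also have "\<dots> = \<Lambda> * ?h t"
      unfolding sum_distrib_left[of \<Lambda>]
      by (intro sum.cong refl) (simp add: L_linear[OF t0] LU[OF t0] ac_simps)
    finally have 3: "(\<Sum>y\<in>S. (\<Sum>z\<in>S. P s t x z * ?l y z) * \<Phi> t y + \<Phi>' t y * P s t x y)
        = \<Lambda> * ?h t + (\<Sum>y\<in>S. P s t x y * \<Phi>' t y)"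
      by (simp add: sum.distrib mult.commute)
    show ?thesis unfolding Z_def
      using DERIV_diff[OF DERIV_cmult[OF 1, of \<Lambda>] 2[unfolded 3]] by simp
  qed
  have "norm (Z T - Z s) \<le> A1 * norm (T - s)"
  proof (rule field_differentiable_bound[OF _ dZ])
    fix t assume t: "t \<in> {s..T}"
    show "norm (- (\<Sum>y\<in>S. P s t x y * \<Phi>' t y)) \<le> A1"
      using P_average_le[of s t x "\<Phi>' t" A1] A1[of t] t s x by auto
  qed (use s in auto)
  moreover have "A1 * norm (T - s) \<le> T * A1"
  proof -
    have "A1 \<ge> 0" using A1[OF s x] by linarith
    then show ?thesis using s mult_left_mono[of "T - s" T A1] by (simp add: mult.commute)
  qed
  moreover have "\<bar>\<Sum>y\<in>S. P s t x y * \<Phi> t y\<bar> \<le> A" if "t \<in> {s..T}" for t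
    using P_average_le[of s t x "\<Phi> t" A] A[of t] that s x by auto
  from this[of s] this[of T] have "\<bar>\<Sum>y\<in>S. P s s x y * \<Phi> s y\<bar> \<le> A" "\<bar>\<Sum>y\<in>S. P s T x y * \<Phi> T y\<bar> \<le> A"
    using s by auto
  ultimately have "\<bar>\<Lambda> * integral {s..T} ?h\<bar> \<le> 2 * A + T * A1"
    unfolding Z_def real_norm_def by (simp add: abs_le_iff)
  then show "\<bar>integral {s..T} ?h\<bar> \<le> (2 * A + T * A1) / \<Lambda>"
    using \<Lambda> by (simp add: abs_mult field_simps)
qed

text \<open>By symmetry the second moment is twice the integral of the correlation
  \<open>c s t\<close> over \<open>s <= t\<close>. For fixed \<open>s\<close>, conditioning on
  \<open>X s\<close> leaves the integral over \<open>t\<close> of \<open>P s t\<close> applied to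
  \<open>U t\<close>, which \<open>dynkin_bound\<close> controls; the outer factor
  \<open>U s\<close> is merely bounded by \<open>B\<close>. The gain \<open>1/\<Lambda>\<close>
  appears once, against a single crude bound on \<open>U\<close>.\<close>

lemma second_moment_time_integral:
  fixes U \<Phi> \<Phi>' :: "real \<Rightarrow> 's \<Rightarrow> real"
  assumes \<Lambda>: "\<Lambda> > 0"
    and U: "\<And>y. y \<in> S \<Longrightarrow> continuous_on {0..T} (\<lambda>t. U t y)"
    and B: "\<And>t y. t \<in> {0..T} \<Longrightarrow> y \<in> S \<Longrightarrow> \<bar>U t y\<bar> \<le> B"
    and LU: "\<And>t y. t \<in> {0..T} \<Longrightarrow> y \<in> S \<Longrightarrow> L t (\<Phi> t) y = \<Lambda> * U t y"
    and d: "\<And>t y. t \<in> {0..T} \<Longrightarrow> y \<in> S \<Longrightarrow> ((\<lambda>t. \<Phi> t y) has_real_derivative \<Phi>' t y) (at t within {0..T})"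
    and A: "\<And>t y. t \<in> {0..T} \<Longrightarrow> y \<in> S \<Longrightarrow> \<bar>\<Phi> t y\<bar> \<le> A"
    and A1: "\<And>t y. t \<in> {0..T} \<Longrightarrow> y \<in> S \<Longrightarrow> \<bar>\<Phi>' t y\<bar> \<le> A1"
  shows "integrable M (\<lambda>\<omega>. (\<integral>t. U t (X t \<omega>) \<partial>time)\<^sup>2)"
    and "(\<integral>\<omega>. (\<integral>t. U t (X t \<omega>) \<partial>time)\<^sup>2 \<partial>M) \<le> 2 * T * B * ((2 * A + T * A1) / \<Lambda>)"
proof -
  define u where "u t \<omega> = U t (X t \<omega>)" for t \<omega>
  define I where "I \<omega> = (\<integral>t. u t \<omega> \<partial>time)" for \<omega>
  define D where "D = (2 * A + T * A1) / \<Lambda>"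
  define c where "c s t = (\<integral>\<omega>. u s \<omega> * u t \<omega> \<partial>M)" for s t
  define h where "h s t = indicator {s..} t * c s t" for s t
  have Um: "(\<lambda>t. U t y) \<in> borel_measurable time" if "y \<in> S" for y
    using borel_measurable_continuous_on_restrict[OF U[OF that]]
    by (simp add: measurable_def space_restrict_space sets_restrict_space)
  note um = occupation_measurable[of U, OF Um, folded u_def]
  have ub: "\<bar>u t \<omega>\<bar> \<le> B" if "t \<in> {0..T}" "\<omega> \<in> space M" for t \<omega>
    using B X_state that by (simp add: u_def)
  have B0: "B \<ge> 0"
  proof -
    have "0 \<in> {0..T}" using T_pos by simp
    moreover obtain \<omega> where "\<omega> \<in> space M" using not_empty by auto
    ultimately show ?thesis using ub[of 0 \<omega>] by linarith
  qed
  have Iint: "integrable M I"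
    using occupation_time_integrable[of U B, OF Um B] by (simp add: I_def[abs_def] u_def)
  have Ib: "\<bar>I \<omega>\<bar> \<le> B * T" if "\<omega> \<in> space M" for \<omega>
  proof -
    have "\<bar>I \<omega>\<bar> \<le> (\<integral>t. \<bar>u t \<omega>\<bar> \<partial>time)" unfolding I_def by (rule integral_abs_bound)
    also have "\<dots> \<le> (\<integral>t. B \<partial>time)"
      by (rule integral_mono)
         (use occupation_path_integrable[of U B, OF Um B that] ub that in \<open>auto simp: u_def[symmetric]\<close>)
    finally show ?thesis by (simp add: measure_time mult.commute)
  qed
  have I2: "\<bar>I \<omega> * I \<omega>\<bar> \<le> B * T * (B * T)" if "\<omega> \<in> space M" for \<omega>
    unfolding abs_mult by (intro mult_mono Ib that) (use B0 T_pos in auto)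
  show "integrable M (\<lambda>\<omega>. (\<integral>t. U t (X t \<omega>) \<partial>time)\<^sup>2)"
    unfolding u_def[symmetric] I_def[symmetric] power2_eq_square
    by (rule integrable_const_bound[of _ "B * T * (B * T)"]) (use I2 Iint in auto)
  interpret TM: finite_measure "time \<Otimes>\<^sub>M M"
    by (rule finite_measure_pair_measure) unfold_locales
  interpret TT: finite_measure "time \<Otimes>\<^sub>M time"
    by (rule finite_measure_pair_measure) unfold_locales
  have int1: "integrable (time \<Otimes>\<^sub>M M) (\<lambda>(t, \<omega>). u t \<omega> * I \<omega>)"
  proof (rule TM.integrable_const_bound[of _ "B * (B * T)"])
    have "(\<lambda>z. I (snd z)) \<in> borel_measurable (time \<Otimes>\<^sub>M M)"
      by (rule measurable_compose[OF measurable_snd]) (use Iint in auto)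
    then show "(\<lambda>(t, \<omega>). u t \<omega> * I \<omega>) \<in> borel_measurable (time \<Otimes>\<^sub>M M)"
      using um by (simp add: case_prod_beta)
    show "AE z in time \<Otimes>\<^sub>M M. norm (case z of (t, \<omega>) \<Rightarrow> u t \<omega> * I \<omega>) \<le> B * (B * T)"
      by (rule AE_I2) (use B0 ub Ib in \<open>auto simp: space_pair_measure abs_mult intro!: mult_mono\<close>)
  qed
  have int2: "integrable (time \<Otimes>\<^sub>M M) (\<lambda>(t, \<omega>). u s \<omega> * u t \<omega>)" if s: "s \<in> {0..T}" for s
  proof (rule TM.integrable_const_bound[of _ "B * B"])
    have "(\<lambda>z. u s (snd z)) \<in> borel_measurable (time \<Otimes>\<^sub>M M)"
      by (rule measurable_compose[OF measurable_snd]) (use fun_X_integrable[OF s, of "U s"] in \<open>auto simp: u_def\<close>)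
    then show "(\<lambda>(t, \<omega>). u s \<omega> * u t \<omega>) \<in> borel_measurable (time \<Otimes>\<^sub>M M)"
      using um by (simp add: case_prod_beta)
    show "AE z in time \<Otimes>\<^sub>M M. norm (case z of (t, \<omega>) \<Rightarrow> u s \<omega> * u t \<omega>) \<le> B * B"
      by (rule AE_I2) (use B0 ub s in \<open>auto simp: space_pair_measure abs_mult intro!: mult_mono\<close>)
  qed
  have cm: "(\<lambda>(s, t). c s t) \<in> borel_measurable (time \<Otimes>\<^sub>M time)"
  proof -
    have 1: "(\<lambda>z. u (fst (fst z)) (snd z)) \<in> borel_measurable ((time \<Otimes>\<^sub>M time) \<Otimes>\<^sub>M M)"
    proof -
      have "(\<lambda>z. (fst (fst z), snd z)) \<in> measurable ((time \<Otimes>\<^sub>M time) \<Otimes>\<^sub>M M) (time \<Otimes>\<^sub>M M)" by measurable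
      from measurable_compose[OF this um] show ?thesis by simp
    qed
    have 2: "(\<lambda>z. u (snd (fst z)) (snd z)) \<in> borel_measurable ((time \<Otimes>\<^sub>M time) \<Otimes>\<^sub>M M)"
    proof -
      have "(\<lambda>z. (snd (fst z), snd z)) \<in> measurable ((time \<Otimes>\<^sub>M time) \<Otimes>\<^sub>M M) (time \<Otimes>\<^sub>M M)" by measurable
      from measurable_compose[OF this um] show ?thesis by simp
    qed
    have "(\<lambda>(z, \<omega>). u (fst z) \<omega> * u (snd z) \<omega>) \<in> borel_measurable ((time \<Otimes>\<^sub>M time) \<Otimes>\<^sub>M M)"
      using borel_measurable_times[OF 1 2] by (simp add: case_prod_beta)
    from borel_measurable_lebesgue_integral[OF this] show ?thesis
      by (simp add: c_def case_prod_beta)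
  qed
  have cb: "\<bar>c s t\<bar> \<le> B * B" if "s \<in> {0..T}" "t \<in> {0..T}" for s t
  proof -
    have m: "(\<lambda>\<omega>. u s \<omega> * u t \<omega>) \<in> borel_measurable M"
      using fun_X_integrable[OF that(1), of "U s"] fun_X_integrable[OF that(2), of "U t"] by (auto simp: u_def)
    have b: "\<bar>u s \<omega> * u t \<omega>\<bar> \<le> B * B" if "\<omega> \<in> space M" for \<omega>
      unfolding abs_mult by (intro mult_mono ub \<open>s \<in> _\<close> \<open>t \<in> _\<close> that B0) auto
    have i: "integrable M (\<lambda>\<omega>. u s \<omega> * u t \<omega>)"
      by (rule integrable_const_bound[of _ "B * B"]) (use b m in auto)
    have "\<bar>c s t\<bar> \<le> (\<integral>\<omega>. \<bar>u s \<omega> * u t \<omega>\<bar> \<partial>M)" unfolding c_def by (rule integral_abs_bound)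
    also have "\<dots> \<le> (\<integral>\<omega>. B * B \<partial>M)"
      by (rule integral_mono) (use i b in auto)
    finally show ?thesis by (simp add: prob_space)
  qed
  have csym: "c s t = c t s" for s t by (simp add: c_def mult.commute)
  have tm: "fst \<in> borel_measurable (time \<Otimes>\<^sub>M time)" "snd \<in> borel_measurable (time \<Otimes>\<^sub>M time)"
    using measurable_compose[OF measurable_fst measurable_restrict_space1[of "\<lambda>x. x" lborel borel "{0..T}"], of time]
      measurable_compose[OF measurable_snd measurable_restrict_space1[of "\<lambda>x. x" lborel borel "{0..T}"], of time] by auto
  have hint: "integrable (time \<Otimes>\<^sub>M time) (\<lambda>(s, t). h s t)"
  proof (rule TT.integrable_const_bound[of _ "B * B"])
    have "(\<lambda>z. (if fst z \<le> snd z then 1 else 0) * c (fst z) (snd z)) \<in> borel_measurable (time \<Otimes>\<^sub>M time)"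
    proof (intro borel_measurable_times measurable_If measurable_const)
      show "{z \<in> space (time \<Otimes>\<^sub>M time). fst z \<le> snd z} \<in> sets (time \<Otimes>\<^sub>M time)"
        by (rule borel_measurable_le[OF tm])
    qed (use cm in \<open>auto simp: case_prod_beta\<close>)
    then show "(\<lambda>(s, t). h s t) \<in> borel_measurable (time \<Otimes>\<^sub>M time)"
      by (simp add: h_def case_prod_beta indicator_def of_bool_def)
    show "AE z in time \<Otimes>\<^sub>M time. norm (case z of (s, t) \<Rightarrow> h s t) \<le> B * B"
      by (rule AE_I2) (use cb B0 in \<open>auto simp: space_pair_measure h_def indicator_def\<close>)
  qed
  have hint': "integrable (time \<Otimes>\<^sub>M time) (\<lambda>(s, t). h t s)"
    using time_time.integrable_product_swap[OF hint] by (simp add: case_prod_beta)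
  have h_path: "integrable time (\<lambda>t. h s t)" "integrable time (\<lambda>t. h t s)" if s: "s \<in> {0..T}" for s
  proof -
    have "(\<lambda>t. h s t) \<in> borel_measurable time" "(\<lambda>t. h t s) \<in> borel_measurable time"
      using measurable_compose[OF measurable_Pair1' borel_measurable_integrable[OF hint], of s]
        measurable_compose[OF measurable_Pair2' borel_measurable_integrable[OF hint], of s] s by simp_all
    then show "integrable time (\<lambda>t. h s t)" "integrable time (\<lambda>t. h t s)"
      using s B0 by (auto intro!: time.integrable_const_bound[of _ "B * B"] AE_I2 cb simp: h_def indicator_def)
  qed
  have inner: "\<bar>\<integral>t. h s t \<partial>time\<bar> \<le> B * D" if s: "s \<in> {0..T}" for s
  proof -
    let ?K = "\<lambda>x t. \<Sum>y\<in>S. P s t x y * U t y"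
    let ?H = "\<lambda>t. \<Sum>x\<in>S. law s x * (U s x * ?K x t)"
    note db = dynkin_bound[where U=U and \<Phi>=\<Phi> and \<Phi>'=\<Phi>' and A=A and ?A1.0=A1, OF s _ \<Lambda> U LU d A A1]
    have contH: "continuous_on {s..T} ?H"
      by (intro continuous_on_sum continuous_on_mult continuous_on_const db(1))
    have "(\<integral>t. h s t \<partial>time) = (\<integral>t. indicator {s..} t * ?H t \<partial>time)"
    proof (intro Bochner_Integration.integral_cong refl)
      fix t assume t: "t \<in> space time"
      show "h s t = indicator {s..} t * ?H t"
        using two_time_law[of s t "U s" "U t"] s t
        by (auto simp: h_def c_def u_def indicator_def)
    qed
    also have "\<dots> = integral {s..T} ?H" by (rule set_integral_time[OF s contH])
    also have "\<dots> = (\<Sum>x\<in>S. law s x * (U s x * integral {s..T} (?K x)))"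
    proof (subst integral_sum[OF finite_states])
      show "(\<lambda>t. law s x * (U s x * ?K x t)) integrable_on {s..T}" if "x \<in> S" for x
        by (intro integrable_continuous_real continuous_on_mult continuous_on_const db(1) that)
    qed (simp add: integral_mult_right)
    finally have e: "(\<integral>t. h s t \<partial>time) = (\<Sum>x\<in>S. law s x * (U s x * integral {s..T} (?K x)))" .
    show ?thesis unfolding e
    proof (rule law_average_le[OF s])
      fix x assume x: "x \<in> S"
      show "\<bar>U s x * integral {s..T} (?K x)\<bar> \<le> B * D"
        unfolding abs_mult D_def by (intro mult_mono db(2) B s x B0) auto
    qed
  qed
  have e1: "(\<integral>\<omega>. I \<omega> * I \<omega> \<partial>M) = (\<integral>s. (\<integral>\<omega>. u s \<omega> * I \<omega> \<partial>M) \<partial>time)"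
    using time_M.Fubini_integral[OF int1] by (simp add: I_def)
  have e2: "(\<integral>\<omega>. u s \<omega> * I \<omega> \<partial>M) = (\<integral>t. c s t \<partial>time)" if s: "s \<in> {0..T}" for s
    using time_M.Fubini_integral[OF int2[OF s]] by (simp add: I_def c_def)
  \<comment> \<open>The two triangles cover the square and overlap only in the diagonal; for fixed
    \<open>s\<close> this is the single point \<open>t = s\<close>, a null set.\<close>
  have e3: "(\<integral>t. c s t \<partial>time) = (\<integral>t. h s t \<partial>time) + (\<integral>t. h t s \<partial>time)" if s: "s \<in> {0..T}" for s
  proof -
    have "(\<integral>t. c s t \<partial>time) = (\<integral>t. h s t + h t s \<partial>time)"
    proof (rule integral_cong_AE)
      show "(\<lambda>t. h s t + h t s) \<in> borel_measurable time" using h_path[OF s] by auto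
      show "(\<lambda>t. c s t) \<in> borel_measurable time"
        using measurable_compose[OF measurable_Pair1' cm, of s] s by simp
      have "AE t in time. t \<noteq> s"
        by (subst AE_restrict_space_iff) (use AE_lborel_singleton[of s] in auto)
      then show "AE t in time. c s t = h s t + h t s"
        by eventually_elim (auto simp: h_def indicator_def csym)
    qed
    then show ?thesis using h_path[OF s] by simp
  qed
  have hi: "integrable time (\<lambda>s. \<integral>t. h s t \<partial>time)" "integrable time (\<lambda>s. \<integral>t. h t s \<partial>time)"
    using time_time.integrable_fst[OF hint] time_time.integrable_fst[OF hint'] by simp_all
  have sw: "(\<integral>s. \<integral>t. h t s \<partial>time \<partial>time) = (\<integral>s. \<integral>t. h s t \<partial>time \<partial>time)"
    using time_time.Fubini_integral[OF hint] .
  have "(\<integral>\<omega>. I \<omega> * I \<omega> \<partial>M) = (\<integral>s. (\<integral>t. h s t \<partial>time) + (\<integral>t. h t s \<partial>time) \<partial>time)"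
    unfolding e1 by (intro Bochner_Integration.integral_cong refl) (use e2 e3 in auto)
  also have "\<dots> = 2 * (\<integral>s. \<integral>t. h s t \<partial>time \<partial>time)"
    using hi sw by simp
  also have "\<dots> \<le> 2 * (\<integral>s. B * D \<partial>time)"
    by (intro mult_left_mono integral_mono hi(1)) (use inner in \<open>auto simp: abs_le_iff\<close>)
  also have "\<dots> = 2 * T * B * D" by (simp add: measure_time)
  finally show "(\<integral>\<omega>. (\<integral>t. U t (X t \<omega>) \<partial>time)\<^sup>2 \<partial>M) \<le> 2 * T * B * ((2 * A + T * A1) / \<Lambda>)"
    by (simp add: I_def u_def D_def power2_eq_square)
qed

end

section \<open>Exchanges and flips under a weight on configurations\<close>

lemma finite_configs: "finite (configs N)"
  by (simp add: configs_def finite_PiE)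

lemma configs_value: "\<eta> \<in> configs N \<Longrightarrow> k \<in> {1..N} \<Longrightarrow> \<eta> k = 0 \<or> \<eta> k = 1"
  by (auto simp: configs_def PiE_def Pi_def)

lemma configs_bounds: "\<eta> \<in> configs N \<Longrightarrow> k \<in> {1..N} \<Longrightarrow> 0 \<le> \<eta> k \<and> \<eta> k \<le> 1"
  using configs_value by fastforce

lemma exchange_configs:
  "\<eta> \<in> configs N \<Longrightarrow> a \<in> {1..N} \<Longrightarrow> b \<in> {1..N} \<Longrightarrow> exchange \<eta> a b \<in> configs N"
  by (auto simp: configs_def exchange_def PiE_def Pi_def extensional_def)

lemma flip_configs: "\<eta> \<in> configs N \<Longrightarrow> s \<in> {1..N} \<Longrightarrow> flip \<eta> s \<in> configs N"
  by (auto simp: configs_def flip_def PiE_def Pi_def extensional_def)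

lemma exchange_exchange [simp]: "exchange (exchange \<eta> a b) a b = \<eta>"
  by (auto simp: exchange_def fun_eq_iff)

lemma flip_flip [simp]: "flip (flip \<eta> s) s = \<eta>"
  by (auto simp: flip_def fun_eq_iff)

lemma exchange_same [simp]: "exchange \<eta> a a = \<eta>"
  by (auto simp: exchange_def fun_eq_iff)

lemma exchange_apply [simp]:
  "exchange \<eta> a b a = \<eta> b" "exchange \<eta> a b b = \<eta> a"
  "k \<noteq> a \<Longrightarrow> k \<noteq> b \<Longrightarrow> exchange \<eta> a b k = \<eta> k"
  by (auto simp: exchange_def)

lemma flip_apply [simp]: "flip \<eta> s s = 1 - \<eta> s" "k \<noteq> s \<Longrightarrow> flip \<eta> s k = \<eta> k"
  by (auto simp: flip_def)

lemma exchange_commute: "exchange \<eta> a b = exchange \<eta> b a"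
  by (auto simp: exchange_def fun_eq_iff)

section \<open>Dirichlet form of exchanges and comparison along paths\<close>

text \<open>Exchanges preserve every \<open>bern w N\<close>, so \<open>bern\<close> times the
  squared increment of \<open>sqrt (m / bern)\<close> is the squared increment of
  \<open>sqrt m\<close>. The bulk part of the Dirichlet form therefore contains neither the
  reference density nor its motion.\<close>

definition swapD :: "nat \<Rightarrow> (config \<Rightarrow> real) \<Rightarrow> nat \<Rightarrow> nat \<Rightarrow> real" where
  "swapD N m a b = (\<Sum>x\<in>configs N. (sqrt (m (exchange x a b)) - sqrt (m x))\<^sup>2)"

lemma swapD_nonneg: "swapD N m a b \<ge> 0"
  by (simp add: swapD_def sum_nonneg)

lemma swapD_commute: "swapD N m a b = swapD N m b a"
  by (simp add: swapD_def exchange_commute)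

text \<open>The exchange of \<open>a\<close> and \<open>b + 1\<close> is the exchange of
  \<open>a\<close> and \<open>b\<close> conjugated by the nearest-neighbour exchange of
  \<open>b\<close> and \<open>b + 1\<close>. All three factors preserve counting measure, so the
  triangle inequality for the Euclidean norm adds their increments; the conjugating factor counts
  twice.\<close>

lemma swapD_step:
  assumes "1 \<le> a" "a < b" "Suc b \<le> N"
  shows "sqrt (swapD N m a (Suc b)) \<le> sqrt (swapD N m a b) + 2 * sqrt (swapD N m b (Suc b))"
proof -
  let ?S = "configs N"
  define g where "g x = sqrt (m x)" for x
  define \<sigma> where "\<sigma> x = exchange x b (Suc b)" for x :: config
  define \<tau> where "\<tau> x = exchange x a b" for x :: config
  have L2: "sqrt (swapD N m a b) = L2_set (\<lambda>x. g (exchange x a b) - g x) ?S" for a b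
    by (simp add: swapD_def L2_set_def g_def)
  have \<sigma>S: "\<sigma> x \<in> ?S" "\<sigma> (\<sigma> x) = x" and \<tau>S: "\<tau> x \<in> ?S" "\<tau> (\<tau> x) = x" if "x \<in> ?S" for x
    using that assms by (auto simp: \<sigma>_def \<tau>_def intro!: exchange_configs)
  have reS: "L2_set (\<lambda>x. F (\<sigma> x)) ?S = L2_set F ?S" for F :: "config \<Rightarrow> real"
    unfolding L2_set_def using sum_involution[of ?S \<sigma> "\<lambda>x. (F x)\<^sup>2"] \<sigma>S by simp
  have reT: "L2_set (\<lambda>x. F (\<tau> x)) ?S = L2_set F ?S" for F :: "config \<Rightarrow> real"
    unfolding L2_set_def using sum_involution[of ?S \<tau> "\<lambda>x. (F x)\<^sup>2"] \<tau>S by simp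
  have e: "exchange x a (Suc b) = \<sigma> (\<tau> (\<sigma> x))" for x
    using assms by (auto simp: \<sigma>_def \<tau>_def exchange_def fun_eq_iff)
  have "sqrt (swapD N m a (Suc b)) = L2_set (\<lambda>x. (g (\<sigma> (\<tau> (\<sigma> x))) - g (\<tau> (\<sigma> x))) + ((g (\<tau> (\<sigma> x)) - g (\<sigma> x)) + (g (\<sigma> x) - g x))) ?S"
    unfolding L2 e by simp
  also have "\<dots> \<le> L2_set (\<lambda>x. g (\<sigma> (\<tau> (\<sigma> x))) - g (\<tau> (\<sigma> x))) ?S + L2_set (\<lambda>x. (g (\<tau> (\<sigma> x)) - g (\<sigma> x)) + (g (\<sigma> x) - g x)) ?S"
    by (rule L2_set_triangle_ineq)
  also have "L2_set (\<lambda>x. (g (\<tau> (\<sigma> x)) - g (\<sigma> x)) + (g (\<sigma> x) - g x)) ?S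
      \<le> L2_set (\<lambda>x. g (\<tau> (\<sigma> x)) - g (\<sigma> x)) ?S + L2_set (\<lambda>x. g (\<sigma> x) - g x) ?S"
    by (rule L2_set_triangle_ineq)
  also have "L2_set (\<lambda>x. g (\<tau> (\<sigma> x)) - g (\<sigma> x)) ?S = L2_set (\<lambda>x. g (\<tau> x) - g x) ?S"
    by (rule reS[of "\<lambda>x. g (\<tau> x) - g x"])
  also have "L2_set (\<lambda>x. g (\<sigma> (\<tau> (\<sigma> x))) - g (\<tau> (\<sigma> x))) ?S = L2_set (\<lambda>x. g (\<sigma> x) - g x) ?S"
    using reS[of "\<lambda>x. g (\<sigma> (\<tau> x)) - g (\<tau> x)"] reT[of "\<lambda>x. g (\<sigma> x) - g x"] by simp
  finally show ?thesis
    unfolding L2 \<sigma>_def \<tau>_def by simp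
qed

lemma swapD_path_sqrt:
  assumes "1 \<le> a" "a < b" "b \<le> N"
  shows "sqrt (swapD N m a b) \<le> 2 * (\<Sum>l\<in>{a..<b}. sqrt (swapD N m l (Suc l)))"
proof -
  have "Suc a \<le> b" using assms by simp
  then show ?thesis using assms(3)
  proof (induction b rule: dec_induct)
    case base
    then show ?case using swapD_nonneg[of N m a "Suc a"] by simp
  next
    case (step b)
    then show ?case using swapD_step[of a b N m] assms(1) by simp
  qed
qed

text \<open>Cauchy-Schwarz over the at most \<open>n\<close> bonds of the path turns the squared sum
  of norms into \<open>n\<close> times a sum of squares, and the squared factor \<open>2\<close>
  gives \<open>4\<close>. The larger set \<open>J\<close> lets all pairs of sites of a block share
  one set of bonds.\<close>

lemma swapD_path:
  assumes "1 \<le> a" "a < b" "b \<le> N" "b \<le> a + n" and sub: "{a..<b} \<subseteq> J" "finite J"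
  shows "swapD N m a b \<le> 4 * real n * (\<Sum>l\<in>J. swapD N m l (Suc l))"
proof -
  let ?s = "\<lambda>l. sqrt (swapD N m l (Suc l))"
  have "swapD N m a b = (sqrt (swapD N m a b))\<^sup>2" by (simp add: swapD_nonneg)
  also have "\<dots> \<le> (2 * (\<Sum>l\<in>{a..<b}. ?s l))\<^sup>2"
    by (intro power_mono swapD_path_sqrt assms) (simp add: swapD_nonneg)
  also have "\<dots> = 4 * (\<Sum>l\<in>{a..<b}. ?s l)\<^sup>2" by (simp add: power_mult_distrib)
  also have "(\<Sum>l\<in>{a..<b}. ?s l)\<^sup>2 \<le> real (card {a..<b}) * (\<Sum>l\<in>{a..<b}. (?s l)\<^sup>2)"
    using sum_squared_le_sum_of_squares[of ?s "{a..<b}"] by (simp add: mult.commute)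
  also have "(\<Sum>l\<in>{a..<b}. (?s l)\<^sup>2) = (\<Sum>l\<in>{a..<b}. swapD N m l (Suc l))"
    by (simp add: swapD_nonneg)
  also have "real (card {a..<b}) * (\<Sum>l\<in>{a..<b}. swapD N m l (Suc l)) \<le> real n * (\<Sum>l\<in>J. swapD N m l (Suc l))"
    by (intro mult_mono sum_mono2 sub sum_nonneg swapD_nonneg) (use assms in auto)
  finally show ?thesis by simp
qed

text \<open>\<open>involution_by_parts\<close> with \<open>\<kappa> = 1\<close>, the weight
  \<open>m\<close> itself being the density. Invariance of \<open>h\<close> under the exchange is
  what keeps \<open>h (x a - x b)\<close> odd.\<close>

lemma swap_by_parts:
  assumes ab: "a \<in> {1..N}" "b \<in> {1..N}"
    and m: "\<And>x. x \<in> configs N \<Longrightarrow> m x \<ge> 0" "(\<Sum>x\<in>configs N. m x) = 1"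
    and h: "\<And>x. x \<in> configs N \<Longrightarrow> h (exchange x a b) = h x" "\<And>x. x \<in> configs N \<Longrightarrow> \<bar>h x\<bar> \<le> 1"
    and g: "\<And>x. x \<in> configs N \<Longrightarrow> \<bar>g (exchange x a b) - g x\<bar> \<le> \<epsilon>"
  shows "\<bar>\<Sum>x\<in>configs N. m x * g x * (h x * (x a - x b))\<bar>
    \<le> 2 * swapD N m a b + 1/4 * (\<Sum>x\<in>configs N. m x * (g x)\<^sup>2) + (\<epsilon> + \<epsilon>\<^sup>2)"
proof -
  have "\<bar>\<Sum>x\<in>configs N. 1 * m x * g x * (h x * (x a - x b))\<bar> \<le>
     2 * (\<Sum>x\<in>configs N. 1 * (sqrt (m (exchange x a b)) - sqrt (m x))\<^sup>2)
     + 1/4 * (\<Sum>x\<in>configs N. 1 * m x * (g x)\<^sup>2) + (\<epsilon> + \<epsilon>\<^sup>2) * (\<Sum>x\<in>configs N. 1 * m x)"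
  proof (rule involution_by_parts)
    fix x assume x: "x \<in> configs N"
    show "exchange x a b \<in> configs N" by (intro exchange_configs x ab)
    show "h (exchange x a b) * (exchange x a b a - exchange x a b b) = - (h x * (x a - x b))"
      using h(1)[OF x] by (simp add: algebra_simps)
    have "\<bar>x a - x b\<bar> \<le> 1" using configs_bounds[OF x ab(1)] configs_bounds[OF x ab(2)] by linarith
    then show "\<bar>h x * (x a - x b)\<bar> \<le> 1" using h(2)[OF x] by (simp add: abs_mult mult_le_one)
  qed (use m g in auto)
  then show ?thesis using m(2) by (simp add: swapD_def)
qed

text \<open>One factor of \<open>g^2\<close> is replaced by a combination of terms
  \<open>h (x a - x b)\<close>, and each of them is integrated by parts against the other factor.
  Since the weights \<open>p\<close> sum to at most \<open>1\<close>, only a quarter of the second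
  moment has to be absorbed, however many terms there are. \<open>R\<close> collects what the
  representation misses. The bound on \<open>swapD\<close> is asked only where \<open>p\<close> is
  nonzero, because in the applications the weights vanish outside the block.\<close>

lemma swap_variance:
  assumes fin: "finite \<Theta>" and p: "\<And>\<theta>. \<theta> \<in> \<Theta> \<Longrightarrow> p \<theta> \<ge> 0" "(\<Sum>\<theta>\<in>\<Theta>. p \<theta>) \<le> 1"
    and ab: "\<And>\<theta>. \<theta> \<in> \<Theta> \<Longrightarrow> a \<theta> \<in> {1..N}" "\<And>\<theta>. \<theta> \<in> \<Theta> \<Longrightarrow> b \<theta> \<in> {1..N}"
    and m: "\<And>x. x \<in> configs N \<Longrightarrow> m x \<ge> 0" "(\<Sum>x\<in>configs N. m x) = 1"
    and h: "\<And>\<theta> x. \<theta> \<in> \<Theta> \<Longrightarrow> x \<in> configs N \<Longrightarrow> h \<theta> (exchange x (a \<theta>) (b \<theta>)) = h \<theta> x"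
      "\<And>\<theta> x. \<theta> \<in> \<Theta> \<Longrightarrow> x \<in> configs N \<Longrightarrow> \<bar>h \<theta> x\<bar> \<le> 1"
    and g: "\<And>x a b. x \<in> configs N \<Longrightarrow> a \<in> {1..N} \<Longrightarrow> b \<in> {1..N} \<Longrightarrow> \<bar>g (exchange x a b) - g x\<bar> \<le> \<epsilon>"
    and D: "\<And>\<theta>. \<theta> \<in> \<Theta> \<Longrightarrow> p \<theta> \<noteq> 0 \<Longrightarrow> swapD N m (a \<theta>) (b \<theta>) \<le> D" "D \<ge> 0"
    and \<epsilon>: "\<epsilon> \<ge> 0"
    and rest: "\<bar>\<Sum>x\<in>configs N. m x * (g x * (g x - (\<Sum>\<theta>\<in>\<Theta>. p \<theta> * (h \<theta> x * (x (a \<theta>) - x (b \<theta>))))))\<bar> \<le> R"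
  shows "(\<Sum>x\<in>configs N. m x * (g x)\<^sup>2) \<le> 1/4 * (\<Sum>x\<in>configs N. m x * (g x)\<^sup>2) + 2 * D + (\<epsilon> + \<epsilon>\<^sup>2) + R"
proof -
  let ?V = "\<Sum>x\<in>configs N. m x * (g x)\<^sup>2"
  let ?B = "2 * D + 1/4 * ?V + (\<epsilon> + \<epsilon>\<^sup>2)"
  have V0: "?V \<ge> 0" using m by (intro sum_nonneg) auto
  have "?V = (\<Sum>x\<in>configs N. m x * (g x * (\<Sum>\<theta>\<in>\<Theta>. p \<theta> * (h \<theta> x * (x (a \<theta>) - x (b \<theta>))))))
     + (\<Sum>x\<in>configs N. m x * (g x * (g x - (\<Sum>\<theta>\<in>\<Theta>. p \<theta> * (h \<theta> x * (x (a \<theta>) - x (b \<theta>)))))))"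
    unfolding sum.distrib[symmetric] by (intro sum.cong refl) (simp add: power2_eq_square algebra_simps)
  also have "\<dots> \<le> (\<Sum>x\<in>configs N. m x * (g x * (\<Sum>\<theta>\<in>\<Theta>. p \<theta> * (h \<theta> x * (x (a \<theta>) - x (b \<theta>)))))) + R"
    using rest by linarith
  also have "(\<Sum>x\<in>configs N. m x * (g x * (\<Sum>\<theta>\<in>\<Theta>. p \<theta> * (h \<theta> x * (x (a \<theta>) - x (b \<theta>))))))
     = (\<Sum>\<theta>\<in>\<Theta>. p \<theta> * (\<Sum>x\<in>configs N. m x * g x * (h \<theta> x * (x (a \<theta>) - x (b \<theta>)))))"
    unfolding sum_distrib_left by (subst sum.swap) (simp add: ac_simps)
  also have "\<dots> \<le> (\<Sum>\<theta>\<in>\<Theta>. p \<theta> * ?B)"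
  proof (rule sum_mono)
    fix \<theta> assume \<theta>: "\<theta> \<in> \<Theta>"
    show "p \<theta> * (\<Sum>x\<in>configs N. m x * g x * (h \<theta> x * (x (a \<theta>) - x (b \<theta>)))) \<le> p \<theta> * ?B"
    proof (cases "p \<theta> = 0")
      case False
      show ?thesis
      proof (rule mult_left_mono)
        have "\<bar>\<Sum>x\<in>configs N. m x * g x * (h \<theta> x * (x (a \<theta>) - x (b \<theta>)))\<bar>
          \<le> 2 * swapD N m (a \<theta>) (b \<theta>) + 1/4 * ?V + (\<epsilon> + \<epsilon>\<^sup>2)"
          by (rule swap_by_parts) (use \<theta> ab m h g in auto)
        then show "(\<Sum>x\<in>configs N. m x * g x * (h \<theta> x * (x (a \<theta>) - x (b \<theta>)))) \<le> ?B"
          using D(1)[OF \<theta> False] by linarith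
      qed (use p \<theta> in auto)
    qed simp
  qed
  also have "\<dots> = (\<Sum>\<theta>\<in>\<Theta>. p \<theta>) * ?B" by (simp add: sum_distrib_right)
  also have "\<dots> \<le> 1 * ?B"
    by (intro mult_right_mono p) (use V0 D \<epsilon> in auto)
  finally show ?thesis by simp
qed

section \<open>Bernoulli measures and reservoir flips\<close>

definition bern :: "real \<Rightarrow> nat \<Rightarrow> config \<Rightarrow> real" where
  "bern w N x = (\<Prod>k\<in>{1..N}. x k * w + (1 - x k) * (1 - w))"

lemma bern_factor_pos:
  assumes "x \<in> configs N" "k \<in> {1..N}" "0 < w" "w < 1"
  shows "0 < x k * w + (1 - x k) * (1 - w)"
  using configs_value[OF assms(1,2)] assms(3,4) by auto

lemma bern_pos: "x \<in> configs N \<Longrightarrow> 0 < w \<Longrightarrow> w < 1 \<Longrightarrow> bern w N x > 0"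
  unfolding bern_def by (intro prod_pos bern_factor_pos) auto

lemma bern_split:
  "s \<in> {1..N} \<Longrightarrow> bern w N x = (x s * w + (1 - x s) * (1 - w)) * (\<Prod>k\<in>{1..N}-{s}. x k * w + (1 - x k) * (1 - w))"
  unfolding bern_def by (subst prod.remove[of _ s]) auto

text \<open>Detailed balance for the rate \<open>1 - w\<close> of emptying an occupied site and
  \<open>w\<close> of filling an empty one: both sides are \<open>w (1 - w)\<close> times the weight
  of the other sites.\<close>

lemma bern_flip:
  assumes "x \<in> configs N" "s \<in> {1..N}"
  shows "bern w N (flip x s) * (flip x s s * (1 - w) + (1 - flip x s s) * w) = bern w N x * (x s * (1 - w) + (1 - x s) * w)"
proof -
  have "(\<Prod>k\<in>{1..N}-{s}. flip x s k * w + (1 - flip x s k) * (1 - w)) = (\<Prod>k\<in>{1..N}-{s}. x k * w + (1 - x k) * (1 - w))"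
    by (intro prod.cong) auto
  then show ?thesis
    using configs_value[OF assms] by (auto simp: bern_split[OF assms(2)])
qed

lemma bern_exchange:
  assumes "a \<in> {1..N}" "b \<in> {1..N}"
  shows "bern w N (exchange x a b) = bern w N x"
proof -
  let ?\<pi> = "\<lambda>k. if k = a then b else if k = b then a else k"
  have "exchange x a b k = x (?\<pi> k)" for k by (auto simp: exchange_def)
  then show ?thesis unfolding bern_def
    by (intro prod.reindex_bij_witness[of _ ?\<pi> ?\<pi>]) (use assms in auto)
qed

lemma sum_bern: "(\<Sum>x\<in>configs N. bern w N x) = 1"
proof -
  have "(\<Sum>x\<in>configs N. bern w N x) = (\<Prod>k\<in>{1..N}. \<Sum>v\<in>{0,1}. v * w + (1 - v) * (1 - w))"
    unfolding configs_def bern_def by (subst prod_sum_PiE) auto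
  then show ?thesis by simp
qed

text \<open>The rate is the reversible one for density \<open>w\<close>; it is also the
  symmetrization of either boundary rate of the process, whatever \<open>p\<close> is. Unlike in
  \<open>swapD\<close> the densities relative to \<open>bern\<close> must be kept, since a flip
  changes \<open>bern\<close>.\<close>

definition flipD :: "real \<Rightarrow> nat \<Rightarrow> (config \<Rightarrow> real) \<Rightarrow> nat \<Rightarrow> real" where
  "flipD w N m s = (\<Sum>x\<in>configs N. bern w N x * (x s * (1 - w) + (1 - x s) * w)
     * (sqrt (m (flip x s) / bern w N (flip x s)) - sqrt (m x / bern w N x))\<^sup>2)"

lemma flipD_nonneg: "0 < w \<Longrightarrow> w < 1 \<Longrightarrow> s \<in> {1..N} \<Longrightarrow> flipD w N m s \<ge> 0"
  unfolding flipD_def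
  by (intro sum_nonneg mult_nonneg_nonneg add_nonneg_nonneg)
     (auto simp: configs_bounds less_imp_le[OF bern_pos])

text \<open>With respect to the flip-invariant weight \<open>\<kappa>\<close> the odd function is
  \<open>2 x s - 1\<close>. As \<open>\<kappa>\<close> equals \<open>bern\<close> times
  \<open>1 - w\<close> or \<open>w\<close> according to the occupation, this is the same as
  \<open>x s - w\<close> with respect to \<open>bern\<close>, so flips compare the site with the
  reservoir density.\<close>

lemma flip_by_parts:
  assumes s: "s \<in> {1..N}" and w: "0 < w" "w < 1"
    and m: "\<And>x. x \<in> configs N \<Longrightarrow> m x \<ge> 0" "(\<Sum>x\<in>configs N. m x) = 1"
    and g: "\<And>x. x \<in> configs N \<Longrightarrow> \<bar>g (flip x s) - g x\<bar> \<le> \<epsilon>" and \<epsilon>: "\<epsilon> \<ge> 0"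
  shows "\<bar>\<Sum>x\<in>configs N. m x * g x * (x s - w)\<bar>
    \<le> 2 * flipD w N m s + 1/4 * (\<Sum>x\<in>configs N. m x * (g x)\<^sup>2) + (\<epsilon> + \<epsilon>\<^sup>2)"
proof -
  define \<kappa> where "\<kappa> x = bern w N x * (x s * (1 - w) + (1 - x s) * w)" for x
  define f where "f x = m x / bern w N x" for x
  have \<kappa>0: "0 \<le> \<kappa> x" "\<kappa> x \<le> bern w N x" if "x \<in> configs N" for x
    using configs_value[OF that s] bern_pos[OF that w] w by (auto simp: \<kappa>_def)
  have f0: "0 \<le> f x" and fm: "bern w N x * f x = m x" if "x \<in> configs N" for x
    using bern_pos[OF that w] m(1)[OF that] by (auto simp: f_def)
  have \<kappa>f: "\<kappa> x * f x \<le> m x" if "x \<in> configs N" for x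
    using mult_right_mono[OF \<kappa>0(2)[OF that] f0[OF that]] fm[OF that] by simp
  have "\<bar>\<Sum>x\<in>configs N. \<kappa> x * f x * g x * (2 * x s - 1)\<bar> \<le>
     2 * (\<Sum>x\<in>configs N. \<kappa> x * (sqrt (f (flip x s)) - sqrt (f x))\<^sup>2)
     + 1/4 * (\<Sum>x\<in>configs N. \<kappa> x * f x * (g x)\<^sup>2) + (\<epsilon> + \<epsilon>\<^sup>2) * (\<Sum>x\<in>configs N. \<kappa> x * f x)"
  proof (rule involution_by_parts)
    fix x assume x: "x \<in> configs N"
    show "flip x s \<in> configs N" by (intro flip_configs x s)
    show "\<kappa> (flip x s) = \<kappa> x" unfolding \<kappa>_def by (rule bern_flip[OF x s])
    show "\<bar>2 * x s - 1\<bar> \<le> 1" using configs_bounds[OF x s] by linarith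
  qed (use \<kappa>0 f0 g in auto)
  also have "(\<Sum>x\<in>configs N. \<kappa> x * f x * g x * (2 * x s - 1)) = (\<Sum>x\<in>configs N. m x * g x * (x s - w))"
  proof (intro sum.cong refl)
    fix x assume x: "x \<in> configs N"
    have "\<kappa> x * f x * (2 * x s - 1) = bern w N x * f x * (x s - w)"
      using configs_value[OF x s] by (auto simp: \<kappa>_def)
    have "\<kappa> x * f x * g x * (2 * x s - 1) = (\<kappa> x * f x * (2 * x s - 1)) * g x"
      by (simp only: ac_simps)
    also have "\<dots> = m x * (x s - w) * g x"
      unfolding \<open>\<kappa> x * f x * (2 * x s - 1) = _\<close> fm[OF x] ..
    finally show "\<kappa> x * f x * g x * (2 * x s - 1) = m x * g x * (x s - w)"
      by (simp only: ac_simps)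
  qed
  also have "(\<Sum>x\<in>configs N. \<kappa> x * (sqrt (f (flip x s)) - sqrt (f x))\<^sup>2) = flipD w N m s"
    by (simp add: flipD_def \<kappa>_def f_def)
  also have "2 * flipD w N m s + 1/4 * (\<Sum>x\<in>configs N. \<kappa> x * f x * (g x)\<^sup>2) + (\<epsilon> + \<epsilon>\<^sup>2) * (\<Sum>x\<in>configs N. \<kappa> x * f x)
     \<le> 2 * flipD w N m s + 1/4 * (\<Sum>x\<in>configs N. m x * (g x)\<^sup>2) + (\<epsilon> + \<epsilon>\<^sup>2) * (\<Sum>x\<in>configs N. m x)"
    by (intro add_mono mult_left_mono sum_mono mult_right_mono \<kappa>f) (use \<epsilon> in auto)
  finally show ?thesis using m(2) by simp
qed

section \<open>Weighted block averages\<close>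

text \<open>The triangular weights are extended by \<open>0\<close> to all sites, so averages are
  sums over a range that does not depend on the block, and the integer offsets of
  \<open>block_avg\<close> disappear whenever the block fits into \<open>{1..N}\<close>.\<close>

definition wt :: "nat \<Rightarrow> nat \<Rightarrow> nat \<Rightarrow> real" where
  "wt K i k = max 0 (real K - \<bar>real i - real k\<bar>) / (real K)\<^sup>2"

definition wavg :: "nat \<Rightarrow> nat \<Rightarrow> nat \<Rightarrow> config \<Rightarrow> real" where
  "wavg N K i \<eta> = (\<Sum>k\<in>{1..N}. wt K i k * \<eta> k)"

definition wpair :: "nat \<Rightarrow> nat \<Rightarrow> nat \<Rightarrow> config \<Rightarrow> real" where
  "wpair N K i \<eta> = (\<Sum>l\<in>{1..<N}. wt K i l * (\<eta> l * \<eta> (Suc l)))"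

lemma wt_nonneg: "wt K i k \<ge> 0"
  by (simp add: wt_def)

lemma wt_le: "K \<ge> 1 \<Longrightarrow> wt K i k \<le> 1 / real K"
proof -
  assume "K \<ge> 1"
  then have "wt K i k \<le> real K / (real K)\<^sup>2" unfolding wt_def by (intro divide_right_mono) auto
  then show ?thesis using \<open>K \<ge> 1\<close> by (simp add: power2_eq_square)
qed

lemma wt_zero: "real K \<le> \<bar>real i - real k\<bar> \<Longrightarrow> wt K i k = 0"
  by (simp add: wt_def)

lemma wt_Suc_Suc: "wt K (Suc i) (Suc l) = wt K i l"
  by (simp add: wt_def)

lemma wt_lipschitz: "\<bar>wt K i (Suc l) - wt K i l\<bar> \<le> 1 / (real K)\<^sup>2"
proof -
  have "\<bar>max 0 (real K - \<bar>real i - real (Suc l)\<bar>) - max 0 (real K - \<bar>real i - real l\<bar>)\<bar> \<le> 1"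
    by (simp add: max_def) linarith
  then show ?thesis unfolding wt_def diff_divide_distrib[symmetric] abs_divide
    by (simp add: divide_right_mono)
qed

lemma block_avg_eq_wavg:
  assumes K: "1 \<le> K" "K \<le> i" "i + K \<le> Suc N"
  shows "block_avg K \<eta> i = wavg N K i \<eta>"
proof -
  let ?I = "{k \<in> {1..N}. \<bar>int i - int k\<bar> < int K}"
  have "(\<Sum>j\<in>{- int K<..<int K}. (real K - \<bar>real_of_int j\<bar>) * \<eta> (nat (int i - j)))
     = (\<Sum>k\<in>?I. (real K - \<bar>real i - real k\<bar>) * \<eta> k)"
    by (rule sum.reindex_bij_witness[of _ "\<lambda>k. int i - int k" "\<lambda>j. nat (int i - j)"])
       (use K in auto)
  also have "\<dots> = (\<Sum>k\<in>?I. max 0 (real K - \<bar>real i - real k\<bar>) * \<eta> k)"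
    by (intro sum.cong refl arg_cong2[where f="(*)"]) auto
  also have "\<dots> = (\<Sum>k\<in>{1..N}. max 0 (real K - \<bar>real i - real k\<bar>) * \<eta> k)"
    by (rule sum.mono_neutral_left) auto
  finally show ?thesis
    by (simp add: block_avg_def wavg_def wt_def sum_divide_distrib)
qed

lemma sum_triangle: "K \<ge> 1 \<Longrightarrow> (\<Sum>j\<in>{- int K<..<int K}. real K - \<bar>real_of_int j\<bar>) = (real K)\<^sup>2"
proof (induction K rule: nat_induct_at_least)
  case base
  have "{- int 1<..<int 1} = {0}" by auto
  then show ?case by simp
next
  case (Suc K)
  have e: "{- int (Suc K)<..<int (Suc K)} = insert (int K) (insert (- int K) {- int K<..<int K})"
    by auto
  have "(\<Sum>j\<in>{- int (Suc K)<..<int (Suc K)}. real (Suc K) - \<bar>real_of_int j\<bar>)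
     = 2 + (\<Sum>j\<in>{- int K<..<int K}. (real K - \<bar>real_of_int j\<bar>) + 1)"
  proof -
    have 1: "int K \<notin> insert (- int K) {- int K<..<int K}" "- int K \<notin> {- int K<..<int K}" using Suc.hyps by auto
    have 2: "real (Suc K) - \<bar>real_of_int j\<bar> = (real K - \<bar>real_of_int j\<bar>) + 1" for j by simp
    show ?thesis unfolding e 2 using 1 by simp
  qed
  also have "\<dots> = 2 + (real K)\<^sup>2 + real (card {- int K<..<int K})"
    using Suc.IH by (simp add: sum.distrib)
  also have "card {- int K<..<int K} = 2 * K - 1" by simp
  finally show ?case using Suc.hyps by (simp add: power2_eq_square algebra_simps of_nat_diff)
qed

lemma sum_wt:
  assumes "1 \<le> K" "K \<le> i" "i + K \<le> Suc N"
  shows "(\<Sum>k\<in>{1..N}. wt K i k) = 1"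
  using block_avg_eq_wavg[OF assms, of "\<lambda>_. 1"] sum_triangle[OF assms(1)] assms(1)
  by (simp add: block_avg_def wavg_def)

lemma wavg_bounds:
  assumes "1 \<le> K" "K \<le> i" "i + K \<le> Suc N" "\<eta> \<in> configs N"
  shows "0 \<le> wavg N K i \<eta>" "wavg N K i \<eta> \<le> 1"
proof -
  show "0 \<le> wavg N K i \<eta>" unfolding wavg_def
    by (intro sum_nonneg mult_nonneg_nonneg wt_nonneg) (use configs_bounds[OF assms(4)] in auto)
  have "wavg N K i \<eta> \<le> (\<Sum>k\<in>{1..N}. wt K i k * 1)" unfolding wavg_def
    by (intro sum_mono mult_left_mono wt_nonneg) (use configs_bounds[OF assms(4)] in auto)
  then show "wavg N K i \<eta> \<le> 1" using sum_wt[OF assms(1-3)] by simp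
qed

lemma wpair_bounds:
  assumes "1 \<le> K" "K \<le> i" "i + K \<le> Suc N" "\<eta> \<in> configs N"
  shows "0 \<le> wpair N K i \<eta>" "wpair N K i \<eta> \<le> 1"
proof -
  have b: "0 \<le> \<eta> l * \<eta> (Suc l) \<and> \<eta> l * \<eta> (Suc l) \<le> 1" if "l \<in> {1..<N}" for l
    using configs_bounds[OF assms(4), of l] configs_bounds[OF assms(4), of "Suc l"] that
    by (auto intro: mult_le_one)
  show "0 \<le> wpair N K i \<eta>" unfolding wpair_def
    by (intro sum_nonneg mult_nonneg_nonneg[OF wt_nonneg]) (use b in auto)
  have "wpair N K i \<eta> \<le> (\<Sum>l\<in>{1..<N}. wt K i l * 1)" unfolding wpair_def
    by (intro sum_mono mult_left_mono wt_nonneg) (use b in auto)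
  also have "\<dots> \<le> (\<Sum>k\<in>{1..N}. wt K i k)"
    by (simp, intro sum_mono2) (auto simp: wt_nonneg)
  finally show "wpair N K i \<eta> \<le> 1" using sum_wt[OF assms(1-3)] by simp
qed

text \<open>Moving the centre of a triangle by one site changes the weight by a step function:
  \<open>1/K^2\<close> on the \<open>K\<close> sites to the right of \<open>i\<close> and
  \<open>-1/K^2\<close> on the \<open>K\<close> sites up to \<open>i\<close>. This is the point of
  the triangular shape: consecutive averages differ by \<open>1/K\<close> times a difference of two
  flat means.\<close>

lemma wavg_diff:
  assumes K: "1 \<le> K" "K \<le> i" "i + K \<le> N"
  shows "wavg N K (Suc i) \<eta> - wavg N K i \<eta> = ((\<Sum>a\<in>{Suc i..i+K}. \<eta> a) - (\<Sum>b\<in>{Suc i-K..i}. \<eta> b)) / (real K)\<^sup>2"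
proof -
  have w: "wt K (Suc i) k - wt K i k = ((if k \<in> {Suc i..i+K} then 1 else 0) - (if k \<in> {Suc i-K..i} then 1 else 0)) / (real K)\<^sup>2"
    for k
  proof -
    have "max 0 (real K - \<bar>real (Suc i) - real k\<bar>) - max 0 (real K - \<bar>real i - real k\<bar>)
       = (if k \<in> {Suc i..i+K} then 1 else 0) - (if k \<in> {Suc i-K..i} then 1 else 0)"
    proof (cases "k \<le> i")
      case True
      then show ?thesis using K by (auto simp: max_def)
    next
      case False
      then show ?thesis using K by (auto simp: max_def)
    qed
    then show ?thesis unfolding wt_def diff_divide_distrib[symmetric] by simp
  qed
  have "wavg N K (Suc i) \<eta> - wavg N K i \<eta> = (\<Sum>k\<in>{1..N}. (wt K (Suc i) k - wt K i k) * \<eta> k)"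
    by (simp add: wavg_def left_diff_distrib sum_subtractf)
  also have "\<dots> = (\<Sum>k\<in>{1..N}. (if k \<in> {Suc i..i+K} then \<eta> k else 0) - (if k \<in> {Suc i-K..i} then \<eta> k else 0)) / (real K)\<^sup>2"
    unfolding w sum_divide_distrib by (intro sum.cong refl) auto
  also have "\<dots> = ((\<Sum>k\<in>{1..N} \<inter> {Suc i..i+K}. \<eta> k) - (\<Sum>k\<in>{1..N} \<inter> {Suc i-K..i}. \<eta> k)) / (real K)\<^sup>2"
    by (simp only: sum_subtractf sum.inter_restrict[OF finite_atLeastAtMost])
  also have "{1..N} \<inter> {Suc i..i+K} = {Suc i..i+K}" using K by auto
  also have "{1..N} \<inter> {Suc i-K..i} = {Suc i-K..i}" using K by auto
  finally show ?thesis .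
qed

text \<open>A difference of two means over \<open>K\<close> sites is the mean over all
  \<open>K^2\<close> pairs, the form required by \<open>swap_variance\<close>.\<close>

lemma wavg_gradient:
  assumes K: "1 \<le> K" "K \<le> i" "i + K \<le> N"
  shows "real K * (wavg N K (Suc i) \<eta> - wavg N K i \<eta>)
    = (\<Sum>(a, b)\<in>{Suc i..i+K} \<times> {Suc i-K..i}. 1 / (real K)\<^sup>2 * (\<eta> a - \<eta> b))"
proof -
  have "(\<Sum>(a, b)\<in>{Suc i..i+K} \<times> {Suc i-K..i}. 1 / (real K)\<^sup>2 * (\<eta> a - \<eta> b))
     = 1 / (real K)\<^sup>2 * (\<Sum>a\<in>{Suc i..i+K}. \<Sum>b\<in>{Suc i-K..i}. \<eta> a - \<eta> b)"
    by (subst sum.cartesian_product[symmetric]) (simp only: sum_distrib_left)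
  also have "(\<Sum>a\<in>{Suc i..i+K}. \<Sum>b\<in>{Suc i-K..i}. \<eta> a - \<eta> b)
     = real K * (\<Sum>a\<in>{Suc i..i+K}. \<eta> a) - real K * (\<Sum>b\<in>{Suc i-K..i}. \<eta> b)"
    using K by (simp add: sum_subtractf sum_distrib_left)
  finally show ?thesis unfolding wavg_diff[OF K] using K by (simp add: right_diff_distrib diff_divide_distrib)
qed

lemma wavg_gradient_le:
  assumes K: "1 \<le> K" "K \<le> i" "i + K \<le> N" and \<eta>: "\<eta> \<in> configs N"
  shows "\<bar>real K * (wavg N K (Suc i) \<eta> - wavg N K i \<eta>)\<bar> \<le> 1"
proof -
  have "\<bar>real K * (wavg N K (Suc i) \<eta> - wavg N K i \<eta>)\<bar>
     \<le> (\<Sum>(a, b)\<in>{Suc i..i+K} \<times> {Suc i-K..i}. 1 / (real K)\<^sup>2)"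
    unfolding wavg_gradient[OF K]
  proof (rule order_trans[OF sum_abs], intro sum_mono, clarify)
    fix a b assume ab: "a \<in> {Suc i..i+K}" "b \<in> {Suc i-K..i}"
    then have "a \<in> {1..N}" "b \<in> {1..N}" using K by auto
    then have "\<bar>\<eta> a - \<eta> b\<bar> \<le> 1" using configs_bounds[OF \<eta>] by (smt (verit))
    then have "1 / (real K)\<^sup>2 * \<bar>\<eta> a - \<eta> b\<bar> \<le> 1 / (real K)\<^sup>2 * 1" by (intro mult_left_mono) auto
    then show "\<bar>1 / (real K)\<^sup>2 * (\<eta> a - \<eta> b)\<bar> \<le> 1 / (real K)\<^sup>2" by (simp add: abs_mult)
  qed
  also have "\<dots> \<le> 1" using K by (simp add: power2_eq_square case_prod_beta)
  finally show ?thesis .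
qed

lemma weighted_sum_change:
  fixes c \<phi> \<phi>' :: "nat \<Rightarrow> real"
  assumes "finite I" "finite J" "card J \<le> n"
    and c: "\<And>k. k \<in> I \<Longrightarrow> \<bar>c k\<bar> \<le> \<epsilon>"
    and \<phi>: "\<And>k. k \<in> I \<Longrightarrow> k \<notin> J \<Longrightarrow> \<phi>' k = \<phi> k" "\<And>k. k \<in> I \<Longrightarrow> \<bar>\<phi>' k - \<phi> k\<bar> \<le> 1" and \<epsilon>: "\<epsilon> \<ge> 0"
  shows "\<bar>(\<Sum>k\<in>I. c k * \<phi>' k) - (\<Sum>k\<in>I. c k * \<phi> k)\<bar> \<le> real n * \<epsilon>"
proof -
  have "(\<Sum>k\<in>I. c k * \<phi>' k) - (\<Sum>k\<in>I. c k * \<phi> k) = (\<Sum>k\<in>I. c k * (\<phi>' k - \<phi> k))"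
    by (simp add: right_diff_distrib sum_subtractf)
  also have "\<dots> = (\<Sum>k\<in>I \<inter> J. c k * (\<phi>' k - \<phi> k))"
    by (rule sum.mono_neutral_right) (use assms in auto)
  also have "\<bar>\<dots>\<bar> \<le> (\<Sum>k\<in>I \<inter> J. \<bar>c k\<bar> * \<bar>\<phi>' k - \<phi> k\<bar>)"
    unfolding abs_mult[symmetric] by (rule sum_abs)
  also have "\<dots> \<le> (\<Sum>k\<in>I \<inter> J. \<epsilon> * 1)"
    by (intro sum_mono mult_mono) (use assms in auto)
  also have "\<dots> = real (card (I \<inter> J)) * \<epsilon>" by simp
  also have "\<dots> \<le> real n * \<epsilon>"
  proof -
    have "card (I \<inter> J) \<le> n" using assms(2,3) card_mono[of J "I \<inter> J"] by auto
    then show ?thesis using \<epsilon> by (intro mult_right_mono) auto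
  qed
  finally show ?thesis .
qed

lemma occupation_diff_le:
  "x \<in> configs N \<Longrightarrow> y \<in> configs N \<Longrightarrow> k \<in> {1..N} \<Longrightarrow> \<bar>y k - x k\<bar> \<le> 1"
  using configs_bounds[of x N k] configs_bounds[of y N k] by linarith

lemma wavg_exchange_le:
  assumes K: "1 \<le> K" and x: "x \<in> configs N" and ab: "a \<in> {1..N}" "b \<in> {1..N}"
  shows "\<bar>wavg N K i (exchange x a b) - wavg N K i x\<bar> \<le> 2 / real K"
proof -
  have "\<bar>wavg N K i (exchange x a b) - wavg N K i x\<bar> \<le> real 2 * (1 / real K)"
    unfolding wavg_def
    by (rule weighted_sum_change[where J="{a,b}"])
       (use wt_le[OF K] wt_nonneg occupation_diff_le[OF x exchange_configs[OF x ab]] in \<open>auto simp: card_insert_if\<close>)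
  then show ?thesis by simp
qed

lemma wavg_flip_le:
  assumes K: "1 \<le> K" and x: "x \<in> configs N" and s: "s \<in> {1..N}"
  shows "\<bar>wavg N K i (flip x s) - wavg N K i x\<bar> \<le> 2 / real K"
proof -
  have "\<bar>wavg N K i (flip x s) - wavg N K i x\<bar> \<le> real 2 * (1 / real K)"
    unfolding wavg_def
    by (rule weighted_sum_change[where J="{s}"])
       (use wt_le[OF K] wt_nonneg occupation_diff_le[OF x flip_configs[OF x s]] in \<open>auto simp: card_insert_if\<close>)
  then show ?thesis by simp
qed

lemma wpair_exchange_le:
  assumes K: "1 \<le> K" and x: "x \<in> configs N" and ab: "a \<in> {1..N}" "b \<in> {1..N}"
  shows "\<bar>wpair N K i (exchange x a b) - wpair N K i x\<bar> \<le> 4 / real K"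
proof -
  let ?y = "exchange x a b"
  have y: "?y \<in> configs N" by (intro exchange_configs x ab)
  have "\<bar>wpair N K i ?y - wpair N K i x\<bar> \<le> real 4 * (1 / real K)"
    unfolding wpair_def
  proof (rule weighted_sum_change[where J="{a,b,a-1,b-1}"])
    show "card {a, b, a - 1, b - 1} \<le> 4" by (auto simp: card_insert_if)
    fix k assume k: "k \<in> {1..<N}"
    show "\<bar>wt K i k\<bar> \<le> 1 / real K" using wt_le[OF K, of i k] wt_nonneg[of K i k] by simp
    have "0 \<le> x k * x (Suc k)" "x k * x (Suc k) \<le> 1" "0 \<le> ?y k * ?y (Suc k)" "?y k * ?y (Suc k) \<le> 1"
      using configs_bounds[OF x, of k] configs_bounds[OF x, of "Suc k"] configs_bounds[OF y, of k] configs_bounds[OF y, of "Suc k"] k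
      by (auto intro: mult_le_one)
    then show "\<bar>?y k * ?y (Suc k) - x k * x (Suc k)\<bar> \<le> 1" by linarith
    assume "k \<notin> {a,b,a-1,b-1}"
    then show "?y k * ?y (Suc k) = x k * x (Suc k)" by (auto simp: exchange_def)
  qed (use K in auto)
  then show ?thesis by simp
qed

text \<open>Up to sign and a gradient, \<open>2p - 1\<close> times this quantity is the difference
  between the averaged microscopic current and the flux \<open>(2p-1) u (1-u)\<close> at the block
  density \<open>u\<close>.\<close>

definition wdefect :: "nat \<Rightarrow> nat \<Rightarrow> nat \<Rightarrow> config \<Rightarrow> real" where
  "wdefect N K i \<eta> = wpair N K i \<eta> - (wavg N K i \<eta>)\<^sup>2"

lemma wdefect_exchange_le:
  assumes K: "1 \<le> K" "K \<le> i" "i + K \<le> Suc N" and x: "x \<in> configs N" and ab: "a \<in> {1..N}" "b \<in> {1..N}"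
  shows "\<bar>wdefect N K i (exchange x a b) - wdefect N K i x\<bar> \<le> 8 / real K"
proof -
  let ?y = "exchange x a b"
  have y: "?y \<in> configs N" by (intro exchange_configs x ab)
  have "(wavg N K i ?y)\<^sup>2 - (wavg N K i x)\<^sup>2 = (wavg N K i ?y - wavg N K i x) * (wavg N K i ?y + wavg N K i x)"
    by (simp add: power2_eq_square algebra_simps)
  also have "\<bar>\<dots>\<bar> \<le> 2 / real K * 2"
    unfolding abs_mult
    by (intro mult_mono wavg_exchange_le K x ab) (use wavg_bounds[OF K x] wavg_bounds[OF K y] in auto)
  finally have "\<bar>(wavg N K i ?y)\<^sup>2 - (wavg N K i x)\<^sup>2\<bar> \<le> 4 / real K" by simp
  moreover have "8 / real K = 4 / real K + 4 / real K" by simp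
  ultimately show ?thesis using wpair_exchange_le[OF K(1) x ab, of i] unfolding wdefect_def by linarith
qed

lemma wdefect_bounds:
  assumes "1 \<le> K" "K \<le> i" "i + K \<le> Suc N" "\<eta> \<in> configs N"
  shows "\<bar>wdefect N K i \<eta>\<bar> \<le> 1"
proof -
  have "0 \<le> (wavg N K i \<eta>)\<^sup>2" "(wavg N K i \<eta>)\<^sup>2 \<le> 1"
    using wavg_bounds[OF assms] by (auto simp: power_le_one)
  then show ?thesis using wpair_bounds[OF assms] unfolding wdefect_def by linarith
qed

section \<open>Second-moment estimates on one block\<close>

text \<open>The sites \<open>i+1-K, ..., i+K\<close> form the union of the supports of the weights
  centred at \<open>i\<close> and at \<open>i + 1\<close>; the sum runs over the
  \<open>2K - 1\<close> bonds between them.\<close>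

definition blockD :: "nat \<Rightarrow> nat \<Rightarrow> nat \<Rightarrow> (config \<Rightarrow> real) \<Rightarrow> real" where
  "blockD N K i m = (\<Sum>l\<in>{Suc i-K..<i+K}. swapD N m l (Suc l))"

lemma blockD_nonneg: "blockD N K i m \<ge> 0"
  by (simp add: blockD_def sum_nonneg swapD_nonneg)

lemma swapD_block:
  assumes K: "K \<le> i" "i + K \<le> N" and ab: "a \<in> {Suc i-K..i+K}" "b \<in> {Suc i-K..i+K}"
  shows "swapD N m a b \<le> 8 * real K * blockD N K i m"
proof -
  have main: "swapD N m a b \<le> 8 * real K * blockD N K i m"
    if "a < b" "a \<in> {Suc i-K..i+K}" "b \<in> {Suc i-K..i+K}" for a b
    using swapD_path[of a b N "2 * K" "{Suc i-K..<i+K}" m] that K by (auto simp: blockD_def)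
  consider "a < b" | "b < a" | "a = b" by linarith
  then show ?thesis
  proof cases
    case 2
    then show ?thesis using main[OF 2] ab by (simp add: swapD_commute)
  next
    case 3
    then show ?thesis by (simp add: swapD_def[of N m b b] blockD_nonneg)
  qed (use main ab in auto)
qed

lemma inverse_K_square:
  assumes "1 \<le> K"
  shows "(c / real K)\<^sup>2 \<le> c\<^sup>2 / real K"
proof -
  have "c\<^sup>2 / real K * (1 / real K) \<le> c\<^sup>2 / real K * 1"
    using assms by (intro mult_left_mono) auto
  then show ?thesis by (simp add: power2_eq_square)
qed

text \<open>Pairs across the two halves of the block represent the gradient exactly, so the
  remainder is \<open>0\<close>. An exchange alters each flat mean by at most \<open>2/K\<close>,
  whence \<open>4/K\<close> for their difference. Absorbing a quarter of the second moment leaves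
  the factor \<open>4/3\<close>, rounded up to \<open>2\<close>.\<close>

lemma gradient_variance:
  assumes K: "1 \<le> K" "K \<le> i" "i + K \<le> N"
    and m: "\<And>x. x \<in> configs N \<Longrightarrow> m x \<ge> 0" "(\<Sum>x\<in>configs N. m x) = 1"
  shows "(\<Sum>x\<in>configs N. m x * (real K * (wavg N K (Suc i) x - wavg N K i x))\<^sup>2)
    \<le> 32 * real K * blockD N K i m + 40 / real K"
proof -
  let ?g = "\<lambda>x. real K * (wavg N K (Suc i) x - wavg N K i x)"
  let ?V = "\<Sum>x\<in>configs N. m x * (?g x)\<^sup>2"
  let ?\<Theta> = "{Suc i..i+K} \<times> {Suc i-K..i}"
  have "?V \<le> 1/4 * ?V + 2 * (8 * real K * blockD N K i m) + (4 / real K + (4 / real K)\<^sup>2) + 0"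
  proof (rule swap_variance[where \<Theta>="?\<Theta>" and p="\<lambda>_. 1 / (real K)\<^sup>2" and a=fst and b=snd and h="\<lambda>_ _. 1"])
    show "(\<Sum>\<theta>\<in>?\<Theta>. 1 / (real K)\<^sup>2) \<le> 1" using K by (simp add: power2_eq_square)
    show "fst \<theta> \<in> {1..N}" "snd \<theta> \<in> {1..N}" if "\<theta> \<in> ?\<Theta>" for \<theta> using that K by auto
    show "swapD N m (fst \<theta>) (snd \<theta>) \<le> 8 * real K * blockD N K i m" if "\<theta> \<in> ?\<Theta>" for \<theta>
      by (rule swapD_block) (use that K in auto)
    fix x a b assume x: "x \<in> configs N" and ab: "a \<in> {1..N}" "b \<in> {1..N}"
    let ?y = "exchange x a b"
    have y: "?y \<in> configs N" by (intro exchange_configs x ab)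
    have s: "\<bar>(\<Sum>k\<in>I. 1 / real K * ?y k) - (\<Sum>k\<in>I. 1 / real K * x k)\<bar> \<le> real 2 * (1 / real K)"
      if "I \<subseteq> {1..N}" for I
    proof (rule weighted_sum_change[where J="{a,b}"])
      show "finite I" using that finite_subset by blast
      show "\<bar>?y k - x k\<bar> \<le> 1" if "k \<in> I" for k
        by (rule occupation_diff_le[OF x y]) (use that \<open>I \<subseteq> _\<close> in auto)
    qed (auto simp: card_insert_if)
    have e: "?g z = (\<Sum>k\<in>{Suc i..i+K}. 1 / real K * z k) - (\<Sum>k\<in>{Suc i-K..i}. 1 / real K * z k)" for z
      unfolding wavg_diff[OF K] using K
      by (simp add: sum_divide_distrib[symmetric] power2_eq_square diff_divide_distrib right_diff_distrib)
    have "\<bar>?g ?y - ?g x\<bar> \<le> real 2 * (1 / real K) + real 2 * (1 / real K)"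
    proof -
      have "{Suc i..i+K} \<subseteq> {1..N}" "{Suc i-K..i} \<subseteq> {1..N}" using K by auto
      from s[OF this(1)] s[OF this(2)] show ?thesis unfolding e by linarith
    qed
    then show "\<bar>?g ?y - ?g x\<bar> \<le> 4 / real K" by simp
  next
    have z: "?g x - (\<Sum>\<theta>\<in>?\<Theta>. 1 / (real K)\<^sup>2 * (1 * (x (fst \<theta>) - x (snd \<theta>)))) = 0" for x
      unfolding wavg_gradient[OF K] by (simp add: case_prod_beta)
    show "\<bar>\<Sum>x\<in>configs N. m x * (?g x * (?g x - (\<Sum>\<theta>\<in>?\<Theta>. 1 / (real K)\<^sup>2 * (1 * (x (fst \<theta>) - x (snd \<theta>))))))\<bar> \<le> 0"
      unfolding z by simp
  qed (use m blockD_nonneg in auto)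
  moreover have "(4 / real K)\<^sup>2 \<le> 4\<^sup>2 / real K" by (rule inverse_K_square[OF K(1)])
  ultimately have "?V \<le> 4/3 * (16 * real K * blockD N K i m + 20 / real K)" by (simp add: field_simps)
  also have "\<dots> \<le> 2 * (16 * real K * blockD N K i m + 20 / real K)"
    by (intro mult_right_mono add_nonneg_nonneg mult_nonneg_nonneg blockD_nonneg) auto
  finally show ?thesis by simp
qed

text \<open>As the weights sum to \<open>1\<close>, the defect is the average over independent sites
  \<open>k\<close>, \<open>k'\<close> of \<open>x k (x (k+1) - x k')\<close>: the right neighbour of
  \<open>k\<close> is compared with a typical site of the block. The factor \<open>x k\<close> is
  invariant under the exchange of \<open>k + 1\<close> and \<open>k'\<close> only if
  \<open>k' \<noteq> k\<close>; the diagonal goes into the remainder, where the squared weights sum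
  to at most \<open>1/K\<close>.\<close>

lemma wdefect_variance:
  assumes K: "1 \<le> K" "K \<le> i" "i + K \<le> N"
    and m: "\<And>x. x \<in> configs N \<Longrightarrow> m x \<ge> 0" "(\<Sum>x\<in>configs N. m x) = 1"
  shows "(\<Sum>x\<in>configs N. m x * (wdefect N K i x)\<^sup>2) \<le> 32 * real K * blockD N K i m + 146 / real K"
proof -
  have K': "1 \<le> K" "K \<le> i" "i + K \<le> Suc N" using K by auto
  let ?g = "wdefect N K i"
  let ?V = "\<Sum>x\<in>configs N. m x * (?g x)\<^sup>2"
  let ?I = "{1..<N}"
  let ?\<Theta> = "{\<theta> \<in> ?I \<times> ?I. fst \<theta> \<noteq> snd \<theta>}"
  let ?p = "\<lambda>\<theta>. wt K i (fst \<theta>) * wt K i (snd \<theta>)"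
  let ?W = "wt K i"
  \<comment> \<open>The weight at site \<open>N\<close> vanishes, so the average over sites may run
    over the same range \<open>{1..<N}\<close> as the average over neighbouring pairs.\<close>
  have wN: "?W N = 0" using K by (intro wt_zero) auto
  have sW: "(\<Sum>k\<in>?I. ?W k) = 1"
  proof -
    have "{1..N} = insert N ?I" using K by auto
    then have "(\<Sum>k\<in>{1..N}. ?W k) = ?W N + (\<Sum>k\<in>?I. ?W k)" by simp
    then show ?thesis using sum_wt[OF K'] wN by simp
  qed
  have avg: "wavg N K i x = (\<Sum>k\<in>?I. ?W k * x k)" for x
  proof -
    have "{1..N} = insert N ?I" using K by auto
    then have "(\<Sum>k\<in>{1..N}. ?W k * x k) = ?W N * x N + (\<Sum>k\<in>?I. ?W k * x k)" by simp
    then show ?thesis using wN by (simp add: wavg_def)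
  qed
  have in_block: "k \<in> {Suc i-K..<i+K}" if "?W k \<noteq> 0" for k
  proof -
    have "\<not> real K \<le> \<bar>real i - real k\<bar>" using that wt_zero by blast
    then show ?thesis using K by auto
  qed
  have fin: "finite ?\<Theta>" by simp
  have split: "(\<Sum>\<theta>\<in>?I\<times>?I. F \<theta>) = (\<Sum>\<theta>\<in>?\<Theta>. F \<theta>) + (\<Sum>k\<in>?I. F (k, k))" for F :: "nat \<times> nat \<Rightarrow> real"
  proof -
    have "?I \<times> ?I = ?\<Theta> \<union> (\<lambda>k. (k,k)) ` ?I" by auto
    then have "(\<Sum>\<theta>\<in>?I\<times>?I. F \<theta>) = (\<Sum>\<theta>\<in>?\<Theta> \<union> (\<lambda>k. (k,k)) ` ?I. F \<theta>)" by (rule arg_cong)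
    also have "\<dots> = (\<Sum>\<theta>\<in>?\<Theta>. F \<theta>) + (\<Sum>\<theta>\<in>(\<lambda>k. (k,k)) ` ?I. F \<theta>)"
      by (rule sum.union_disjoint) auto
    also have "(\<Sum>\<theta>\<in>(\<lambda>k. (k,k)) ` ?I. F \<theta>) = (\<Sum>k\<in>?I. F (k, k))"
      by (subst sum.reindex) (auto simp: inj_on_def)
    finally show ?thesis .
  qed
  have sp: "(\<Sum>\<theta>\<in>?I\<times>?I. ?p \<theta>) = 1"
    using sum_product[of ?W ?I ?W ?I] by (simp add: sum.cartesian_product case_prod_beta sW[unfolded One_nat_def])
  have g_eq: "?g x = (\<Sum>\<theta>\<in>?\<Theta>. ?p \<theta> * (x (fst \<theta>) * (x (Suc (fst \<theta>)) - x (snd \<theta>))))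
      + (\<Sum>k\<in>?I. (?W k)\<^sup>2 * (x k * (x (Suc k) - x k)))" for x
  proof -
    have a: "wpair N K i x = (\<Sum>k\<in>?I. \<Sum>k'\<in>?I. ?W k * ?W k' * (x k * x (Suc k)))"
    proof -
      have "wpair N K i x = (\<Sum>k\<in>?I. (?W k * (x k * x (Suc k))) * (\<Sum>k'\<in>?I. ?W k'))"
        unfolding sW wpair_def by simp
      then show ?thesis unfolding sum_distrib_left by (simp add: ac_simps)
    qed
    have b: "(wavg N K i x)\<^sup>2 = (\<Sum>k\<in>?I. \<Sum>k'\<in>?I. ?W k * ?W k' * (x k * x k'))"
      unfolding avg power2_eq_square sum_product by (simp add: ac_simps)
    have "?g x = (\<Sum>k\<in>?I. \<Sum>k'\<in>?I. ?W k * ?W k' * (x k * (x (Suc k) - x k')))"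
      unfolding wdefect_def a b sum_subtractf[symmetric] by (intro sum.cong refl) (simp add: algebra_simps)
    also have "\<dots> = (\<Sum>\<theta>\<in>?I\<times>?I. ?p \<theta> * (x (fst \<theta>) * (x (Suc (fst \<theta>)) - x (snd \<theta>))))"
      by (simp add: sum.cartesian_product case_prod_beta)
    finally show ?thesis unfolding split by (simp add: power2_eq_square)
  qed
  have "?V \<le> 1/4 * ?V + 2 * (8 * real K * blockD N K i m) + (8 / real K + (8 / real K)\<^sup>2) + 1 / real K"
  proof (rule swap_variance[where \<Theta>="?\<Theta>" and p="?p" and a="\<lambda>\<theta>. Suc (fst \<theta>)" and b=snd and h="\<lambda>\<theta> x. x (fst \<theta>)", OF fin])
    show "?p \<theta> \<ge> 0" for \<theta> by (simp add: wt_nonneg)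
    have "0 \<le> (\<Sum>k\<in>?I. ?p (k, k))" by (intro sum_nonneg) (simp add: wt_nonneg)
    then show "(\<Sum>\<theta>\<in>?\<Theta>. ?p \<theta>) \<le> 1" using sp split[of ?p] by linarith
    show "Suc (fst \<theta>) \<in> {1..N}" "snd \<theta> \<in> {1..N}" if "\<theta> \<in> ?\<Theta>" for \<theta> using that by auto
    show "exchange x (Suc (fst \<theta>)) (snd \<theta>) (fst \<theta>) = x (fst \<theta>)" if "\<theta> \<in> ?\<Theta>" for \<theta> x using that by auto
    show "\<bar>x (fst \<theta>)\<bar> \<le> 1" if "\<theta> \<in> ?\<Theta>" "x \<in> configs N" for \<theta> x
      using configs_bounds[OF that(2), of "fst \<theta>"] that(1) by auto
    show "swapD N m (Suc (fst \<theta>)) (snd \<theta>) \<le> 8 * real K * blockD N K i m" if "\<theta> \<in> ?\<Theta>" "?p \<theta> \<noteq> 0" for \<theta>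
      by (rule swapD_block) (use in_block[of "fst \<theta>"] in_block[of "snd \<theta>"] that K in auto)
    show "\<bar>?g (exchange x a b) - ?g x\<bar> \<le> 8 / real K" if "x \<in> configs N" "a \<in> {1..N}" "b \<in> {1..N}" for x a b
      by (rule wdefect_exchange_le[OF K' that])
    show "\<bar>\<Sum>x\<in>configs N. m x * (?g x * (?g x - (\<Sum>\<theta>\<in>?\<Theta>. ?p \<theta> * (x (fst \<theta>) * (x (Suc (fst \<theta>)) - x (snd \<theta>))))))\<bar> \<le> 1 / real K"
    proof -
      have r: "\<bar>?g x * (?g x - (\<Sum>\<theta>\<in>?\<Theta>. ?p \<theta> * (x (fst \<theta>) * (x (Suc (fst \<theta>)) - x (snd \<theta>)))))\<bar> \<le> 1 / real K"
        if x: "x \<in> configs N" for x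
      proof -
        have "?g x - (\<Sum>\<theta>\<in>?\<Theta>. ?p \<theta> * (x (fst \<theta>) * (x (Suc (fst \<theta>)) - x (snd \<theta>)))) = (\<Sum>k\<in>?I. (?W k)\<^sup>2 * (x k * (x (Suc k) - x k)))"
          unfolding g_eq by simp
        also have "\<bar>\<dots>\<bar> \<le> (\<Sum>k\<in>?I. 1 / real K * ?W k)"
        proof (rule order_trans[OF sum_abs], rule sum_mono)
          fix k assume k: "k \<in> ?I"
          have "\<bar>x k\<bar> \<le> 1" "\<bar>x (Suc k) - x k\<bar> \<le> 1"
            using configs_bounds[OF x, of k] configs_bounds[OF x, of "Suc k"] k by auto
          then have "\<bar>x k * (x (Suc k) - x k)\<bar> \<le> 1" by (simp add: abs_mult mult_le_one)
          then have "(?W k)\<^sup>2 * \<bar>x k * (x (Suc k) - x k)\<bar> \<le> (?W k)\<^sup>2 * 1" by (intro mult_left_mono) auto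
          also have "\<dots> \<le> 1 / real K * ?W k"
            using mult_right_mono[OF wt_le[OF K(1), of i k] wt_nonneg[of K i k]] by (simp add: power2_eq_square)
          finally show "\<bar>(?W k)\<^sup>2 * (x k * (x (Suc k) - x k))\<bar> \<le> 1 / real K * ?W k" by (simp add: abs_mult)
        qed
        also have "\<dots> = 1 / real K" by (simp only: sum_distrib_left[symmetric] sW)
        finally have "\<bar>?g x\<bar> * \<bar>?g x - (\<Sum>\<theta>\<in>?\<Theta>. ?p \<theta> * (x (fst \<theta>) * (x (Suc (fst \<theta>)) - x (snd \<theta>))))\<bar> \<le> 1 * (1 / real K)"
          by (intro mult_mono wdefect_bounds[OF K' x]) auto
        then show ?thesis by (simp add: abs_mult)
      qed
      have "\<bar>\<Sum>x\<in>configs N. m x * (?g x * (?g x - (\<Sum>\<theta>\<in>?\<Theta>. ?p \<theta> * (x (fst \<theta>) * (x (Suc (fst \<theta>)) - x (snd \<theta>))))))\<bar>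
        \<le> (\<Sum>x\<in>configs N. m x * (1 / real K))"
      proof (rule order_trans[OF sum_abs], rule sum_mono)
        fix x assume x: "x \<in> configs N"
        show "\<bar>m x * (?g x * (?g x - (\<Sum>\<theta>\<in>?\<Theta>. ?p \<theta> * (x (fst \<theta>) * (x (Suc (fst \<theta>)) - x (snd \<theta>))))))\<bar> \<le> m x * (1 / real K)"
          unfolding abs_mult[of "m x"] abs_of_nonneg[OF m(1)[OF x]] by (intro mult_left_mono r x m(1))
      qed
      also have "\<dots> = 1 / real K" by (simp only: sum_distrib_right[symmetric] m mult_1_left)
      finally show ?thesis .
    qed
  qed (use m blockD_nonneg in auto)
  moreover have "(8 / real K)\<^sup>2 \<le> 8\<^sup>2 / real K" by (rule inverse_K_square[OF K(1)])
  ultimately have "?V \<le> 4/3 * (16 * real K * blockD N K i m + 73 / real K)" by (simp add: field_simps)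
  also have "\<dots> \<le> 2 * (16 * real K * blockD N K i m + 73 / real K)"
    by (intro mult_right_mono add_nonneg_nonneg mult_nonneg_nonneg blockD_nonneg) auto
  finally show ?thesis by simp
qed

text \<open>The deviation \<open>u - w\<close> is the weighted mean of \<open>x k - x s\<close>,
  treated by exchanges, plus \<open>x s - w\<close>, treated by flips at \<open>s\<close>. Each of
  the two absorbs a quarter of the second moment, so half of it remains on the left.\<close>

lemma boundary_variance:
  assumes K: "1 \<le> K" "K \<le> i" "i + K \<le> N" and s: "s \<in> {Suc i-K..i+K}" and w: "0 < w" "w < 1"
    and m: "\<And>x. x \<in> configs N \<Longrightarrow> m x \<ge> 0" "(\<Sum>x\<in>configs N. m x) = 1"
  shows "(\<Sum>x\<in>configs N. m x * (wavg N K i x - w)\<^sup>2) \<le> 32 * real K * blockD N K i m + 4 * flipD w N m s + 24 / real K"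
proof -
  have K': "1 \<le> K" "K \<le> i" "i + K \<le> Suc N" using K by auto
  let ?g = "\<lambda>x. wavg N K i x - w"
  let ?V = "\<Sum>x\<in>configs N. m x * (?g x)\<^sup>2"
  let ?R = "2 * flipD w N m s + 1/4 * ?V + (2 / real K + (2 / real K)\<^sup>2)"
  have sN: "s \<in> {1..N}" using s K by auto
  have in_block: "k \<in> {Suc i-K..i+K}" if "wt K i k \<noteq> 0" for k
  proof -
    have "\<not> real K \<le> \<bar>real i - real k\<bar>" using that wt_zero by blast
    then show ?thesis using K by auto
  qed
  have "?V \<le> 1/4 * ?V + 2 * (8 * real K * blockD N K i m) + (2 / real K + (2 / real K)\<^sup>2) + ?R"
  proof (rule swap_variance[where \<Theta>="{1..N}" and p="wt K i" and a="\<lambda>k. k" and b="\<lambda>_. s" and h="\<lambda>_ _. 1"])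
    show "swapD N m k s \<le> 8 * real K * blockD N K i m" if "wt K i k \<noteq> 0" for k
      by (rule swapD_block) (use in_block[OF that] s K in auto)
    show "(\<Sum>k\<in>{1..N}. wt K i k) \<le> 1" using sum_wt[OF K'] by simp
    show "\<bar>?g (exchange x a b) - ?g x\<bar> \<le> 2 / real K" if "x \<in> configs N" "a \<in> {1..N}" "b \<in> {1..N}" for x a b
      using wavg_exchange_le[OF K(1) that] by simp
    have z: "?g x - (\<Sum>k\<in>{1..N}. wt K i k * (1 * (x k - x s))) = x s - w" for x
    proof -
      have "(\<Sum>k\<in>{1..N}. wt K i k * (1 * (x k - x s))) = wavg N K i x - (\<Sum>k\<in>{1..N}. wt K i k) * x s"
        by (simp add: wavg_def right_diff_distrib sum_subtractf sum_distrib_right)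
      then show ?thesis using sum_wt[OF K'] by simp
    qed
    show "\<bar>\<Sum>x\<in>configs N. m x * (?g x * (?g x - (\<Sum>k\<in>{1..N}. wt K i k * (1 * (x k - x s)))))\<bar> \<le> ?R"
      unfolding z using flip_by_parts[OF sN w m, of ?g "2 / real K"] wavg_flip_le[OF K(1) _ sN, of _ i]
      by (simp add: mult.assoc)
  qed (use m sN blockD_nonneg wt_nonneg in auto)
  moreover have "(2 / real K)\<^sup>2 \<le> 2\<^sup>2 / real K" by (rule inverse_K_square[OF K(1)])
  ultimately show ?thesis by (simp add: field_simps)
qed

text \<open>A bond \<open>l\<close> belongs to the block of \<open>i\<close> only if
  \<open>l + 1 - K <= i < l + K\<close>, which leaves fewer than \<open>2K\<close> values of
  \<open>i\<close>.\<close>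

lemma sum_blockD:
  assumes "1 \<le> K"
  shows "(\<Sum>i\<in>{K..N-K}. blockD N K i m) \<le> 2 * real K * (\<Sum>l\<in>{1..<N}. swapD N m l (Suc l))"
proof -
  have "(\<Sum>i\<in>{K..N-K}. blockD N K i m) = (\<Sum>i\<in>{K..N-K}. \<Sum>l\<in>{1..<N}. if l \<in> {Suc i-K..<i+K} then swapD N m l (Suc l) else 0)"
  proof (intro sum.cong refl)
    fix i assume "i \<in> {K..N-K}"
    then have "{1..<N} \<inter> {Suc i-K..<i+K} = {Suc i-K..<i+K}" using assms by auto
    then show "blockD N K i m = (\<Sum>l\<in>{1..<N}. if l \<in> {Suc i-K..<i+K} then swapD N m l (Suc l) else 0)"
      unfolding blockD_def by (subst sum.inter_restrict[symmetric]) auto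
  qed
  also have "\<dots> = (\<Sum>l\<in>{1..<N}. \<Sum>i\<in>{K..N-K}. if l \<in> {Suc i-K..<i+K} then swapD N m l (Suc l) else 0)"
    by (rule sum.swap)
  also have "\<dots> \<le> (\<Sum>l\<in>{1..<N}. 2 * real K * swapD N m l (Suc l))"
  proof (rule sum_mono)
    fix l
    have "(\<Sum>i\<in>{K..N-K}. if l \<in> {Suc i-K..<i+K} then swapD N m l (Suc l) else 0)
      = (\<Sum>i\<in>{i\<in>{K..N-K}. l \<in> {Suc i-K..<i+K}}. swapD N m l (Suc l))"
      by (rule sum.inter_filter[symmetric]) simp
    also have "\<dots> = real (card {i\<in>{K..N-K}. l \<in> {Suc i-K..<i+K}}) * swapD N m l (Suc l)" by simp
    also have "\<dots> \<le> real (2 * K) * swapD N m l (Suc l)"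
    proof (intro mult_right_mono swapD_nonneg, simp only: of_nat_le_iff)
      have "{i\<in>{K..N-K}. l \<in> {Suc i-K..<i+K}} \<subseteq> {Suc l-K..<l+K}" by auto
      then have "card {i\<in>{K..N-K}. l \<in> {Suc i-K..<i+K}} \<le> card {Suc l-K..<l+K}" by (rule card_mono[rotated]) simp
      then show "card {i\<in>{K..N-K}. l \<in> {Suc i-K..<i+K}} \<le> 2 * K" by simp
    qed
    finally show "(\<Sum>i\<in>{K..N-K}. if l \<in> {Suc i-K..<i+K} then swapD N m l (Suc l) else 0) \<le> 2 * real K * swapD N m l (Suc l)" by simp
  qed
  finally show ?thesis by (simp add: sum_distrib_left)
qed

section \<open>The generator and the stationary Bernoulli measures\<close>

text \<open>Moves are numbered by the bonds \<open>0, ..., N\<close> of the chain enlarged by one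
  reservoir site at each end. At the two outer bonds only one site is real, and the exchange becomes
  a flip.\<close>

definition jmp :: "nat \<Rightarrow> nat \<Rightarrow> config \<Rightarrow> config" where
  "jmp N k x = (if k = 0 then flip x 1 else if k = N then flip x N else exchange x k (k + 1))"

text \<open>The Liggett rates at the outer bonds are the exchange rate with a fictitious site
  \<open>0\<close> or \<open>N + 1\<close> whose occupation is replaced by its mean
  \<open>w\<close>.\<close>

definition rate :: "real \<Rightarrow> real \<Rightarrow> nat \<Rightarrow> nat \<Rightarrow> config \<Rightarrow> real" where
  "rate p w N k x =
     (if k = 0 then p * w * (1 - x 1) + (1 - p) * (1 - w) * x 1
      else if k = N then (1 - p) * w * (1 - x N) + p * (1 - w) * x N
      else p * x k * (1 - x (k + 1)) + (1 - p) * x (k + 1) * (1 - x k))"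

lemma bonds_insert: "1 \<le> N \<Longrightarrow> {0..N} = insert 0 (insert N {1..<N})" for N :: nat
  by auto

lemma L_gen_jump_gen:
  assumes "1 \<le> N"
  shows "L_gen p \<rho> \<rho> N t f x = jump_gen {0..N} (rate p (\<rho> t) N) (jmp N) f x"
proof -
  have "(\<Sum>k\<in>{1..<N}. rate p (\<rho> t) N k x * (f (jmp N k x) - f x)) = L_exc p N f x"
    unfolding L_exc_def by (intro sum.cong) (auto simp: rate_def jmp_def)
  moreover have "jump_gen {0..N} (rate p (\<rho> t) N) (jmp N) f x
    = rate p (\<rho> t) N 0 x * (f (jmp N 0 x) - f x) + (rate p (\<rho> t) N N x * (f (jmp N N x) - f x)
      + (\<Sum>k\<in>{1..<N}. rate p (\<rho> t) N k x * (f (jmp N k x) - f x)))"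
    unfolding jump_gen_def bonds_insert[OF assms] using assms by (subst sum.insert, auto)
  ultimately show ?thesis
    using assms by (simp add: L_gen_def L_left_def L_right_def Let_def rate_def jmp_def)
qed

lemma jmp_configs: "1 \<le> N \<Longrightarrow> k \<in> {0..N} \<Longrightarrow> x \<in> configs N \<Longrightarrow> jmp N k x \<in> configs N"
  by (auto simp: jmp_def intro!: flip_configs exchange_configs)

lemma jmp_jmp: "jmp N k (jmp N k x) = x"
  by (auto simp: jmp_def)

lemma rate_nonneg:
  assumes "1 \<le> N" "k \<in> {0..N}" "x \<in> configs N" "0 \<le> p" "p \<le> 1" "0 < w" "w < 1"
  shows "0 \<le> rate p w N k x"
proof -
  have "0 \<le> x i \<and> x i \<le> 1" if "i \<in> {1..N}" for i using configs_bounds[OF assms(3) that] .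
  then show ?thesis using assms unfolding rate_def
    by (auto intro!: add_nonneg_nonneg mult_nonneg_nonneg)
qed

lemma bern_site:
  assumes "s \<in> {1..N}"
  obtains R where "bern w N x = (x s * w + (1 - x s) * (1 - w)) * R"
    "bern w N (flip x s) = ((1 - x s) * w + x s * (1 - w)) * R"
proof -
  let ?R = "\<Prod>k\<in>{1..N}-{s}. x k * w + (1 - x k) * (1 - w)"
  have "(\<Prod>k\<in>{1..N}-{s}. flip x s k * w + (1 - flip x s k) * (1 - w)) = ?R"
    by (intro prod.cong) auto
  then show ?thesis by (intro that[of ?R]) (simp_all add: bern_split[OF assms])
qed

text \<open>The flow out of \<open>x\<close> against the flow into \<open>x\<close>, bond by bond: the bulk terms telescope and the
  two boundary terms compensate the end points.\<close>

lemma bern_flow_difference: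
  assumes N: "1 \<le> N" and k: "k \<in> {0..N}" and x: "x \<in> configs N"
  shows "bern w N (jmp N k x) * rate p w N k (jmp N k x) - bern w N x * rate p w N k x
    = bern w N x * (2 * p - 1) * ((if k = N then w else x (Suc k)) - (if k = 0 then w else x k))"
proof -
  consider "k = 0" | "k \<noteq> 0" "k = N" | "k \<noteq> 0" "k \<noteq> N" by blast
  then show ?thesis
  proof cases
    case 1
    have s: "1 \<in> {1..N}" using N by simp
    obtain R where R: "bern w N x = (x 1 * w + (1 - x 1) * (1 - w)) * R"
      "bern w N (flip x 1) = ((1 - x 1) * w + x 1 * (1 - w)) * R"
      using bern_site[OF s] by blast
    from configs_value[OF x s] show ?thesis
      using 1 N by (auto simp: jmp_def rate_def R[unfolded One_nat_def] algebra_simps)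
  next
    case 2
    have s: "N \<in> {1..N}" using N by simp
    obtain R where R: "bern w N x = (x N * w + (1 - x N) * (1 - w)) * R"
      "bern w N (flip x N) = ((1 - x N) * w + x N * (1 - w)) * R"
      using bern_site[OF s] by blast
    from configs_value[OF x s] show ?thesis
      using 2 by (auto simp: jmp_def rate_def R algebra_simps)
  next
    case 3
    then have "bern w N (jmp N k x) = bern w N x"
      using k by (simp add: jmp_def bern_exchange)
    then show ?thesis using 3 by (simp add: jmp_def rate_def algebra_simps)
  qed
qed

text \<open>The equality of the two reservoir densities enters here: after reindexing by the
  involutions \<open>jmp N k\<close>, the coefficient of \<open>f x\<close> telescopes along the
  enlarged chain, which carries the same value \<open>w\<close> at both ends. The cancellation takes
  place between different bonds; for \<open>p \<noteq> 1/2\<close> the individual bonds are not in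
  balance.\<close>

lemma bern_stationary:
  assumes N: "1 \<le> N"
  shows "(\<Sum>x\<in>configs N. bern w N x * jump_gen {0..N} (rate p w N) (jmp N) f x) = 0"
proof -
  let ?a = "\<lambda>k x. bern w N x * rate p w N k x"
  have "(\<Sum>x\<in>configs N. bern w N x * jump_gen {0..N} (rate p w N) (jmp N) f x)
    = (\<Sum>k\<in>{0..N}. (\<Sum>x\<in>configs N. ?a k x * f (jmp N k x)) - (\<Sum>x\<in>configs N. ?a k x * f x))"
    unfolding jump_gen_def sum_distrib_left sum_subtractf[symmetric]
    by (subst sum.swap) (simp add: algebra_simps)
  also have "\<dots> = (\<Sum>k\<in>{0..N}. (\<Sum>x\<in>configs N. ?a k (jmp N k x) * f x) - (\<Sum>x\<in>configs N. ?a k x * f x))"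
  proof (rule sum.cong[OF refl], rule arg_cong2[where f=minus, OF _ refl])
    fix k assume k: "k \<in> {0..N}"
    have "(\<Sum>x\<in>configs N. ?a k (jmp N k x) * f (jmp N k (jmp N k x))) = (\<Sum>x\<in>configs N. ?a k x * f (jmp N k x))"
      by (rule sum_involution[where f="\<lambda>x. ?a k x * f (jmp N k x)"]) (use jmp_configs[OF N k] jmp_jmp in auto)
    then show "(\<Sum>x\<in>configs N. ?a k x * f (jmp N k x)) = (\<Sum>x\<in>configs N. ?a k (jmp N k x) * f x)"
      by (simp add: jmp_jmp)
  qed
  also have "\<dots> = (\<Sum>k\<in>{0..N}. \<Sum>x\<in>configs N. f x * (bern w N x * (2 * p - 1) * ((if k = N then w else x (Suc k)) - (if k = 0 then w else x k))))"
    unfolding sum_subtractf[symmetric]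
    by (intro sum.cong refl) (subst bern_flow_difference[OF N, symmetric], auto simp: algebra_simps)
  also have "\<dots> = (\<Sum>x\<in>configs N. f x * (bern w N x * (2 * p - 1) * (\<Sum>k\<in>{0..N}. (if k = N then w else x (Suc k)) - (if k = 0 then w else x k))))"
    by (subst sum.swap) (simp add: sum_distrib_left)
  also have "\<dots> = 0"
  proof -
    have z: "(\<Sum>k\<in>{0..N}. (if k = N then w else x (Suc k)) - (if k = 0 then w else x k)) = 0" for x :: config
    proof -
      define g where "g k = (if k = 0 \<or> k = Suc N then w else x k)" for k
      have "(\<Sum>k\<in>{0..N}. (if k = N then w else x (Suc k)) - (if k = 0 then w else x k)) = (\<Sum>k\<in>{0..N}. g (Suc k) - g k)"
        by (intro sum.cong) (auto simp: g_def)
      also have "\<dots> = g (Suc N) - g 0" by (rule sum_Suc_diff) simp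
      finally show ?thesis by (simp add: g_def)
    qed
    show ?thesis unfolding z by simp
  qed
  finally show ?thesis .
qed

text \<open>Against a function invariant under \<open>\<sigma>\<close> only the average of the
  weight over each orbit counts. This removes the asymmetry of the jump rates from the
  dissipation.\<close>

lemma symmetrize:
  fixes \<alpha> d :: "'s \<Rightarrow> real"
  assumes "\<And>x. x \<in> S \<Longrightarrow> \<sigma> x \<in> S" "\<And>x. x \<in> S \<Longrightarrow> \<sigma> (\<sigma> x) = x" "\<And>x. x \<in> S \<Longrightarrow> d (\<sigma> x) = d x"
    and "\<And>x. x \<in> S \<Longrightarrow> (\<alpha> x + \<alpha> (\<sigma> x)) * d x = e x"
  shows "(\<Sum>x\<in>S. \<alpha> x * d x) = (\<Sum>x\<in>S. e x) / 2"
proof -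
  have "(\<Sum>x\<in>S. \<alpha> (\<sigma> x) * d x) = (\<Sum>x\<in>S. \<alpha> (\<sigma> x) * d (\<sigma> x))" using assms by (intro sum.cong) auto
  also have "\<dots> = (\<Sum>x\<in>S. \<alpha> x * d x)"
    by (rule sum_involution[where f="\<lambda>x. \<alpha> x * d x"]) (use assms in auto)
  finally have "2 * (\<Sum>x\<in>S. \<alpha> x * d x) = (\<Sum>x\<in>S. (\<alpha> x + \<alpha> (\<sigma> x)) * d x)"
    by (simp add: distrib_right sum.distrib)
  also have "\<dots> = (\<Sum>x\<in>S. e x)" using assms by (intro sum.cong) auto
  finally show ?thesis by simp
qed

definition totalD :: "real \<Rightarrow> nat \<Rightarrow> (config \<Rightarrow> real) \<Rightarrow> real" where
  "totalD w N m = (\<Sum>l\<in>{1..<N}. swapD N m l (Suc l)) + flipD w N m 1 + flipD w N m N"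

text \<open>Squared increments are invariant under the move, so only symmetrized rates count, and in
  them \<open>p\<close> and \<open>1 - p\<close> add up to \<open>1\<close>. \<open>swapD\<close>
  and \<open>flipD\<close> count every pair of configurations twice at the full symmetrized rate,
  whence the division by \<open>2\<close>.\<close>

lemma totalD_dissipation:
  assumes N: "1 \<le> N" and w: "0 < w" "w < 1"
  shows "(\<Sum>x\<in>configs N. bern w N x * (\<Sum>k\<in>{0..N}. rate p w N k x
      * (sqrt (m (jmp N k x) / bern w N (jmp N k x)) - sqrt (m x / bern w N x))\<^sup>2)) = totalD w N m / 2"
proof -
  let ?d = "\<lambda>k x. (sqrt (m (jmp N k x) / bern w N (jmp N k x)) - sqrt (m x / bern w N x))\<^sup>2"
  let ?e = "\<lambda>k. (\<Sum>x\<in>configs N. (bern w N x * rate p w N k x) * ?d k x)"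
  have sym: "?d k (jmp N k x) = ?d k x" for k x
    by (simp add: jmp_jmp power2_commute)
  have bd: "?e k = flipD w N m s / 2" if k: "k = 0 \<and> s = 1 \<or> k = N \<and> s = N" for k s
    unfolding flipD_def
  proof (rule symmetrize[where \<sigma>="jmp N k"])
    fix x assume x: "x \<in> configs N"
    have kN: "k \<in> {0..N}" and s: "s \<in> {1..N}" using k N by auto
    have j: "jmp N k y = flip y s" for y using k N by (auto simp: jmp_def)
    show "jmp N k x \<in> configs N" by (rule jmp_configs[OF N kN x])
    obtain R where R: "bern w N x = (x s * w + (1 - x s) * (1 - w)) * R"
      "bern w N (flip x s) = ((1 - x s) * w + x s * (1 - w)) * R"
      using bern_site[OF s] by blast
    have "bern w N x * rate p w N k x + bern w N (jmp N k x) * rate p w N k (jmp N k x)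
       = bern w N x * (x s * (1 - w) + (1 - x s) * w)"
      using configs_value[OF x s] k N unfolding j R by (auto simp: rate_def algebra_simps)
    then show "(bern w N x * rate p w N k x + bern w N (jmp N k x) * rate p w N k (jmp N k x)) * ?d k x
      = bern w N x * (x s * (1 - w) + (1 - x s) * w) * (sqrt (m (flip x s) / bern w N (flip x s)) - sqrt (m x / bern w N x))\<^sup>2"
      by (simp add: j)
  qed (use sym jmp_jmp in auto)
  have bulk: "?e k = swapD N m k (Suc k) / 2" if k: "k \<in> {1..<N}" for k
    unfolding swapD_def
  proof (rule symmetrize[where \<sigma>="jmp N k"])
    fix x assume x: "x \<in> configs N"
    have kN: "k \<in> {0..N}" using k by auto
    have j: "jmp N k y = exchange y k (Suc k)" for y using k by (auto simp: jmp_def)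
    have b: "bern w N (exchange x k (Suc k)) = bern w N x" using k by (intro bern_exchange) auto
    show "jmp N k x \<in> configs N" by (rule jmp_configs[OF N kN x])
    have r: "rate p w N k x + rate p w N k (exchange x k (Suc k)) = x k * (1 - x (Suc k)) + x (Suc k) * (1 - x k)"
      using k by (simp add: rate_def algebra_simps)
    \<comment> \<open>For equal occupations the exchange is the identity and the squared increment
      is \<open>0\<close>; for different ones the symmetrized rate is \<open>1\<close>. The rate can
      therefore be dropped from the product.\<close>
    have "exchange x k (Suc k) = x" if "x k = x (Suc k)"
      using that by (auto simp: exchange_def fun_eq_iff)
    moreover have "x k = 0 \<or> x k = 1" "x (Suc k) = 0 \<or> x (Suc k) = 1"
      using configs_value[OF x, of k] configs_value[OF x, of "Suc k"] k by auto
    moreover have "bern w N x * ?d k x = (sqrt (m (exchange x k (Suc k))) - sqrt (m x))\<^sup>2"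
      using bern_pos[OF x w] unfolding j b
      by (simp add: real_sqrt_divide diff_divide_distrib[symmetric] power_divide)
    ultimately have "(x k * (1 - x (Suc k)) + x (Suc k) * (1 - x k)) * (bern w N x * ?d k x) = (sqrt (m (exchange x k (Suc k))) - sqrt (m x))\<^sup>2"
      by auto
    then show "(bern w N x * rate p w N k x + bern w N (jmp N k x) * rate p w N k (jmp N k x)) * ?d k x
      = (sqrt (m (exchange x k (Suc k))) - sqrt (m x))\<^sup>2"
      unfolding r[symmetric] by (simp add: j b algebra_simps)
  qed (use sym jmp_jmp in auto)
  have "(\<Sum>x\<in>configs N. bern w N x * (\<Sum>k\<in>{0..N}. rate p w N k x * ?d k x)) = (\<Sum>k\<in>{0..N}. ?e k)"
    unfolding sum_distrib_left by (subst sum.swap) (simp add: mult.assoc)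
  also have "\<dots> = ?e 0 + (?e N + (\<Sum>k\<in>{1..<N}. ?e k))"
    unfolding bonds_insert[OF N] using N by (subst sum.insert, auto)
  also have "\<dots> = totalD w N m / 2"
  proof -
    have "?e 0 = flipD w N m 1 / 2" "?e N = flipD w N m N / 2" by (rule bd; simp)+
    moreover have "(\<Sum>k\<in>{1..<N}. ?e k) = (\<Sum>k\<in>{1..<N}. swapD N m k (Suc k)) / 2"
      unfolding sum_divide_distrib by (intro sum.cong refl bulk)
    ultimately show ?thesis unfolding totalD_def add_divide_distrib by linarith
  qed
  finally show ?thesis .
qed

lemma ln_bern:
  assumes "x \<in> configs N" "0 < w" "w < 1"
  shows "ln (bern w N x) = (\<Sum>k\<in>{1..N}. ln (x k * w + (1 - x k) * (1 - w)))"
  unfolding bern_def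
  by (rule ln_prod) (use bern_factor_pos[OF assms(1) _ assms(2,3)] in \<open>auto simp: less_le\<close>)

text \<open>The margin \<open>c\<close> bounds every one-site weight from below, so over
  \<open>N\<close> sites \<open>- ln bern\<close> is at most \<open>N/c\<close> and the time
  derivative of \<open>ln bern\<close> at most \<open>N R/c\<close>: these are \<open>H0\<close> and
  \<open>B\<close> of \<open>entropy_dissipation\<close>. The factor \<open>2\<close> is the ratio
  of \<open>totalD\<close> to the dissipation.\<close>

lemma dirichlet_bound:
  fixes \<rho> \<rho>' :: "real \<Rightarrow> real" and \<Lambda> :: real
  assumes mp: "finite_markov_process M (configs N) T (\<lambda>t f \<xi>. \<Lambda> * L_gen p \<rho> \<rho> N t f \<xi>) \<mu> X"
    and N: "1 \<le> N" and p: "0 \<le> p" "p \<le> 1" and \<Lambda>: "\<Lambda> \<ge> 0"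
    and d\<rho>: "\<And>t. t \<in> {0..T} \<Longrightarrow> (\<rho> has_real_derivative \<rho>' t) (at t within {0..T})"
    and c: "0 < c" "\<And>t. t \<in> {0..T} \<Longrightarrow> c \<le> \<rho> t" "\<And>t. t \<in> {0..T} \<Longrightarrow> \<rho> t \<le> 1 - c"
    and R: "\<And>t. t \<in> {0..T} \<Longrightarrow> \<bar>\<rho>' t\<bar> \<le> R"
    and m: "\<And>t x. m t x = (finite_markov_process.law M X t x + bern (\<rho> t) N x) / 2"
  shows "continuous_on {0..T} (\<lambda>t. totalD (\<rho> t) N (m t))"
    and "\<Lambda> * integral {0..T} (\<lambda>t. totalD (\<rho> t) N (m t)) \<le> 2 * real N * (1 / c + 3 * R / c * T)"
proof -
  interpret finite_markov_process M "configs N" T "\<lambda>t f \<xi>. \<Lambda> * L_gen p \<rho> \<rho> N t f \<xi>" \<mu> X by (rule mp)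
  have \<rho>01: "0 < \<rho> t" "\<rho> t < 1" if "t \<in> {0..T}" for t using c(1) c(2,3)[OF that] by linarith+
  have contlaw: "continuous_on {0..T} (\<lambda>t. law t x)" if "x \<in> configs N" for x
    by (rule DERIV_continuous_on[OF law_forward[OF _ that]])
  have contrho: "continuous_on {0..T} \<rho>" by (rule DERIV_continuous_on[OF d\<rho>])
  have contbern: "continuous_on {0..T} (\<lambda>t. bern (\<rho> t) N x)" for x
    unfolding bern_def
    by (intro continuous_on_prod continuous_on_add continuous_on_mult continuous_on_diff continuous_on_const contrho)
  have contm: "continuous_on {0..T} (\<lambda>t. m t x)" if "x \<in> configs N" for x
    unfolding m by (intro continuous_on_divide continuous_on_add continuous_on_const contlaw contbern that) auto
  have bern0: "bern (\<rho> t) N x \<noteq> 0" if "t \<in> {0..T}" "x \<in> configs N" for t x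
    using bern_pos[OF that(2) \<rho>01[OF that(1)]] by simp
  show cont: "continuous_on {0..T} (\<lambda>t. totalD (\<rho> t) N (m t))"
    unfolding totalD_def swapD_def flipD_def
    by (intro continuous_on_add continuous_on_sum continuous_on_power continuous_on_diff continuous_on_real_sqrt
        continuous_on_mult continuous_on_divide continuous_on_const ballI bern0 contm contrho contbern flip_configs exchange_configs)
       (use N in auto)
  define b where "b t x = (\<Sum>k\<in>{1..N}. (x k * \<rho>' t - (1 - x k) * \<rho>' t) / (x k * \<rho> t + (1 - x k) * (1 - \<rho> t)))" for t and x :: config
  define lnu where "lnu t x = (\<Sum>k\<in>{1..N}. ln (x k * \<rho> t + (1 - x k) * (1 - \<rho> t)))" for t and x :: config
  have elnu: "exp (lnu t x) = bern (\<rho> t) N x" if "t \<in> {0..T}" "x \<in> configs N" for t x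
    unfolding lnu_def ln_bern[OF that(2) \<rho>01[OF that(1)], symmetric]
    by (rule exp_ln[OF bern_pos[OF that(2) \<rho>01[OF that(1)]]])
  have facc: "c \<le> x k * \<rho> t + (1 - x k) * (1 - \<rho> t)" if "t \<in> {0..T}" "x \<in> configs N" "k \<in> {1..N}" for t x k
    using configs_value[OF that(2,3)] c(2,3)[OF that(1)] by auto
  define f where "f t x = (law t x + exp (lnu t x)) / (2 * exp (lnu t x))" for t x
  have fm: "f t x = m t x / bern (\<rho> t) N x" if "t \<in> {0..T}" "x \<in> configs N" for t x
    unfolding f_def m elnu[OF that] by simp
  define dis where "dis t = (\<Sum>x\<in>configs N. exp (lnu t x) * (\<Sum>k\<in>{0..N}. rate p (\<rho> t) N k x * (sqrt (f t (jmp N k x)) - sqrt (f t x))\<^sup>2))" for t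
  have dis: "dis t = totalD (\<rho> t) N (m t) / 2" if t: "t \<in> {0..T}" for t
    unfolding totalD_dissipation[OF N \<rho>01[OF t], of p "m t", symmetric] dis_def
    by (intro sum.cong refl arg_cong2[where f="(*)"])
       (use elnu[OF t] fm[OF t] jmp_configs[OF N] in auto)
  have "\<Lambda> * integral {0..T} dis \<le> real N * (1 / c) + 3 * (real N * (R / c)) * T"
  proof (rule entropy_dissipation[where S="configs N" and I="{0..N}" and \<tau>="jmp N" and r="\<lambda>t. rate p (\<rho> t) N"
        and \<mu>=law and lnu=lnu and b=b and f=f])
    show "rate p (\<rho> t) N k x \<ge> 0" if "t \<in> {0..T}" "k \<in> {0..N}" "x \<in> configs N" for t k x
      by (rule rate_nonneg[OF N that(2,3) p \<rho>01[OF that(1)]])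
    show "((\<lambda>t. law t y) has_real_derivative
        (\<Sum>x\<in>configs N. law t x * (\<Lambda> * jump_gen {0..N} (rate p (\<rho> t) N) (jmp N) (\<lambda>z. if z = y then 1 else 0) x))) (at t within {0..T})"
      if "t \<in> {0..T}" "y \<in> configs N" for t y
      using law_forward[OF that] by (simp add: L_gen_jump_gen[OF N])
    show "((\<lambda>t. lnu t x) has_real_derivative b t x) (at t within {0..T})" if "t \<in> {0..T}" "x \<in> configs N" for t x
      unfolding lnu_def b_def
    proof (rule DERIV_sum)
      fix k assume k: "k \<in> {1..N}"
      have pos: "0 < x k * \<rho> t + (1 - x k) * (1 - \<rho> t)" using facc[OF that k] c(1) by linarith
      show "((\<lambda>t. ln (x k * \<rho> t + (1 - x k) * (1 - \<rho> t))) has_real_derivative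
         (x k * \<rho>' t - (1 - x k) * \<rho>' t) / (x k * \<rho> t + (1 - x k) * (1 - \<rho> t))) (at t within {0..T})"
        using pos by (auto intro!: derivative_eq_intros d\<rho>[OF that(1)])
    qed
    show "\<bar>b t x\<bar> \<le> real N * (R / c)" if "t \<in> {0..T}" "x \<in> configs N" for t x
    proof -
      have "\<bar>b t x\<bar> \<le> (\<Sum>k\<in>{1..N}. R / c)" unfolding b_def
      proof (rule order_trans[OF sum_abs], rule sum_mono)
        fix k assume k: "k \<in> {1..N}"
        have "\<bar>x k * \<rho>' t - (1 - x k) * \<rho>' t\<bar> \<le> R"
          using configs_value[OF that(2) k] R[OF that(1)] by auto
        then show "\<bar>(x k * \<rho>' t - (1 - x k) * \<rho>' t) / (x k * \<rho> t + (1 - x k) * (1 - \<rho> t))\<bar> \<le> R / c"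
          using facc[OF that k] c(1) by (simp add: abs_divide frac_le)
      qed
      then show ?thesis by simp
    qed
    show "(\<Sum>x\<in>configs N. exp (lnu t x)) = 1" if "t \<in> {0..T}" for t
      using sum_bern[of "\<rho> t" N] elnu[OF that] by simp
    show "(\<Sum>x\<in>configs N. exp (lnu t x) * jump_gen {0..N} (rate p (\<rho> t) N) (jmp N) f x) = 0" if "t \<in> {0..T}" for t f
      using bern_stationary[OF N, of "\<rho> t" p f] elnu[OF that] by simp
    show "- lnu 0 x \<le> real N * (1 / c)" if "x \<in> configs N" for x
    proof -
      have z: "0 \<in> {0..T}" using T_pos by simp
      have "- lnu 0 x = (\<Sum>k\<in>{1..N}. - ln (x k * \<rho> 0 + (1 - x k) * (1 - \<rho> 0)))" by (simp add: lnu_def sum_negf)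
      also have "\<dots> \<le> (\<Sum>k\<in>{1..N}. 1 / c)"
      proof (rule sum_mono)
        fix k assume k: "k \<in> {1..N}"
        let ?y = "x k * \<rho> 0 + (1 - x k) * (1 - \<rho> 0)"
        have y: "c \<le> ?y" by (rule facc[OF z that k])
        then have "ln (1 / ?y) \<le> 1 / ?y - 1" using c(1) by (intro ln_le_minus_one) auto
        moreover have "1 / ?y \<le> 1 / c" using y c(1) by (intro frac_le) auto
        moreover have "ln (1 / ?y) = - ln ?y" using y c(1) by (simp add: ln_div)
        ultimately show "- ln ?y \<le> 1 / c" by linarith
      qed
      finally show ?thesis by simp
    qed
    show "continuous_on {0..T} dis"
      using continuous_on_divide[OF cont, of "\<lambda>_. 2"] dis by (subst continuous_on_cong[OF refl dis]) auto
  qed (use finite_states jmp_configs[OF N] T_pos \<Lambda> law_nonneg law_sum in \<open>auto simp: f_def dis_def\<close>)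
  also have "integral {0..T} dis = integral {0..T} (\<lambda>t. totalD (\<rho> t) N (m t) / 2)"
    by (rule integral_cong) (rule dis)
  also have "\<dots> = integral {0..T} (\<lambda>t. totalD (\<rho> t) N (m t)) / 2" by simp
  finally show "\<Lambda> * integral {0..T} (\<lambda>t. totalD (\<rho> t) N (m t)) \<le> 2 * real N * (1 / c + 3 * R / c * T)"
    by (simp add: algebra_simps)
qed

section \<open>The microscopic entropy balance\<close>

lemma wavg_exchange_Suc:
  assumes "l \<in> {1..<N}"
  shows "wavg N K i (exchange \<eta> l (Suc l)) - wavg N K i \<eta> = (wt K i (Suc l) - wt K i l) * (\<eta> l - \<eta> (Suc l))"
proof -
  have "wavg N K i (exchange \<eta> l (Suc l)) - wavg N K i \<eta> = (\<Sum>k\<in>{1..N}. wt K i k * (exchange \<eta> l (Suc l) k - \<eta> k))"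
    by (simp add: wavg_def sum_subtractf right_diff_distrib)
  also have "\<dots> = (\<Sum>k\<in>{l, Suc l}. wt K i k * (exchange \<eta> l (Suc l) k - \<eta> k))"
    by (rule sum.mono_neutral_right) (use assms in auto)
  also have "\<dots> = (wt K i (Suc l) - wt K i l) * (\<eta> l - \<eta> (Suc l))"
    by (simp add: algebra_simps)
  finally show ?thesis .
qed

definition bond_current :: "real \<Rightarrow> config \<Rightarrow> nat \<Rightarrow> real" where
  "bond_current p \<eta> l = p * \<eta> l * (1 - \<eta> (Suc l)) - (1 - p) * \<eta> (Suc l) * (1 - \<eta> l)"

definition wcurrent :: "real \<Rightarrow> nat \<Rightarrow> nat \<Rightarrow> nat \<Rightarrow> config \<Rightarrow> real" where
  "wcurrent p N K i \<eta> = (\<Sum>l\<in>{1..<N}. wt K i l * bond_current p \<eta> l)"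

lemma wavg_exchange_Suc_le:
  assumes "l \<in> {1..<N}" "\<eta> \<in> configs N"
  shows "\<bar>wavg N K i (exchange \<eta> l (Suc l)) - wavg N K i \<eta>\<bar> \<le> 1 / (real K)\<^sup>2"
proof -
  have "\<bar>\<eta> l - \<eta> (Suc l)\<bar> \<le> 1"
    using configs_bounds[OF assms(2), of l] configs_bounds[OF assms(2), of "Suc l"] assms(1) by auto
  then have "\<bar>wt K i (Suc l) - wt K i l\<bar> * \<bar>\<eta> l - \<eta> (Suc l)\<bar> \<le> 1 / (real K)\<^sup>2 * 1"
    by (intro mult_mono wt_lipschitz) auto
  then show ?thesis unfolding wavg_exchange_Suc[OF assms(1)] abs_mult by simp
qed

text \<open>At most \<open>2K\<close> bonds affect the block, and each exchange moves the average by
  at most \<open>1/K^2\<close>. Measuring the increment of \<open>h\<close> against that of the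
  average covers two uses: Lipschitz functions of the average, and Taylor remainders, for which
  \<open>b\<close> is itself of order \<open>1/K^2\<close>.\<close>

lemma L_exc_local_le:
  assumes K: "1 \<le> K" and \<eta>: "\<eta> \<in> configs N" and p: "0 \<le> p" "p \<le> 1" and b: "b \<ge> 0"
    and h: "\<And>l. l \<in> {1..<N} \<Longrightarrow> \<bar>h (exchange \<eta> l (Suc l)) - h \<eta>\<bar>
      \<le> b * \<bar>wavg N K i (exchange \<eta> l (Suc l)) - wavg N K i \<eta>\<bar>"
  shows "\<bar>L_exc p N h \<eta>\<bar> \<le> 2 * b / real K"
proof -
  define c where "c l = p * \<eta> l * (1 - \<eta> (l + 1)) + (1 - p) * \<eta> (l + 1) * (1 - \<eta> l)" for l
  have "\<bar>L_exc p N h \<eta>\<bar> \<le> (\<Sum>l\<in>{1..<N}. \<bar>c l * (h (exchange \<eta> l (Suc l)) - h \<eta>)\<bar>)"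
    unfolding L_exc_def c_def by (simp add: sum_abs)
  also have "\<dots> \<le> (\<Sum>l\<in>{1..<N}. if l \<in> {i-K..<i+K} then b * (1 / (real K)\<^sup>2) else 0)"
  proof (rule sum_mono)
    fix l assume l: "l \<in> {1..<N}"
    let ?d = "wavg N K i (exchange \<eta> l (Suc l)) - wavg N K i \<eta>"
    have "\<bar>c l\<bar> \<le> 1"
      using configs_value[OF \<eta>, of l] configs_value[OF \<eta>, of "Suc l"] l p by (auto simp: c_def)
    then have 1: "\<bar>c l * (h (exchange \<eta> l (Suc l)) - h \<eta>)\<bar> \<le> 1 * (b * \<bar>?d\<bar>)"
      unfolding abs_mult by (intro mult_mono h l) auto
    have 2: "b * \<bar>?d\<bar> \<le> b * (1 / (real K)\<^sup>2)" by (intro mult_left_mono wavg_exchange_Suc_le l \<eta> b)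
    show "\<bar>c l * (h (exchange \<eta> l (Suc l)) - h \<eta>)\<bar> \<le> (if l \<in> {i-K..<i+K} then b * (1 / (real K)\<^sup>2) else 0)"
    proof (cases "l \<in> {i-K..<i+K}")
      case True
      then show ?thesis using 1 2 by simp
    next
      case False
      then have "Suc l + K \<le> i \<or> i + K \<le> l" by auto
      then have "real (Suc l + K) \<le> real i \<or> real (i + K) \<le> real l" by (simp only: of_nat_le_iff)
      then have "real K \<le> \<bar>real i - real (Suc l)\<bar>" "real K \<le> \<bar>real i - real l\<bar>"
        unfolding of_nat_add of_nat_Suc by linarith+
      then have "wt K i (Suc l) = 0" "wt K i l = 0" by (simp_all only: wt_zero)
      then have "?d = 0" unfolding wavg_exchange_Suc[OF l] by simp
      then show ?thesis using 1 unfolding if_not_P[OF False] by (simp only: abs_zero mult_zero_right mult_1)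
    qed
  qed
  also have "\<dots> = real (card ({1..<N} \<inter> {i-K..<i+K})) * (b * (1 / (real K)\<^sup>2))"
    by (subst sum.inter_restrict[symmetric]) auto
  also have "\<dots> \<le> real (2 * K) * (b * (1 / (real K)\<^sup>2))"
  proof -
    have "card ({1..<N} \<inter> {i-K..<i+K}) \<le> card {i-K..<i+K}" by (rule card_mono) auto
    also have "\<dots> \<le> 2 * K" by simp
    finally have "real (card ({1..<N} \<inter> {i-K..<i+K})) \<le> real (2 * K)" by (simp only: of_nat_le_iff)
    then show ?thesis using b by (intro mult_right_mono) auto
  qed
  also have "\<dots> = 2 * b / real K" using K by (simp add: power2_eq_square)
  finally show ?thesis .
qed

text \<open>An exchange at bond \<open>l\<close> changes the average by
  \<open>wt K i (Suc l) - wt K i l\<close> times an occupation difference, and this difference times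
  the rate is the bond current. Since \<open>wt K i (Suc l) = wt K (i - 1) l\<close>, a discrete
  divergence of averaged currents results.\<close>

lemma L_exc_block_avg:
  assumes K: "1 \<le> K" "K < i" and \<eta>: "\<eta> \<in> configs N"
  shows "L_exc p N (wavg N K i) \<eta> = wcurrent p N K (i - 1) \<eta> - wcurrent p N K i \<eta>"
  unfolding L_exc_def wcurrent_def sum_subtractf[symmetric]
proof (intro sum.cong refl)
  fix l assume l: "l \<in> {1..<N}"
  define c where "c = p * \<eta> l * (1 - \<eta> (l + 1)) + (1 - p) * \<eta> (l + 1) * (1 - \<eta> l)"
  have "c * (\<eta> l - \<eta> (Suc l)) = bond_current p \<eta> l"
    using configs_value[OF \<eta>, of l] configs_value[OF \<eta>, of "Suc l"] l by (auto simp: c_def bond_current_def)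
  moreover have "wt K i (Suc l) = wt K (i - 1) l" using wt_Suc_Suc[of K "i - 1" l] K by simp
  moreover have "c * ((wt K i (Suc l) - wt K i l) * (\<eta> l - \<eta> (Suc l)))
     = (wt K i (Suc l) - wt K i l) * (c * (\<eta> l - \<eta> (Suc l)))" by (simp only: ac_simps)
  ultimately have "c * (wavg N K i (exchange \<eta> l (Suc l)) - wavg N K i \<eta>)
     = wt K (i - 1) l * bond_current p \<eta> l - wt K i l * bond_current p \<eta> l"
    unfolding wavg_exchange_Suc[OF l] by (simp add: left_diff_distrib)
  then show "(p * \<eta> l * (1 - \<eta> (l + 1)) + (1 - p) * \<eta> (l + 1) * (1 - \<eta> l)) * (wavg N K i (exchange \<eta> l (l + 1)) - wavg N K i \<eta>)
     = wt K (i - 1) l * bond_current p \<eta> l - wt K i l * bond_current p \<eta> l"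
    by (simp add: c_def)
qed

lemma wavg_unit_interval:
  assumes K: "1 \<le> K" "K \<le> i" "i + K \<le> N" and \<eta>: "\<eta> \<in> configs N"
  shows "wavg N K i \<eta> \<in> {0..1}" "l \<in> {1..<N} \<Longrightarrow> wavg N K i (exchange \<eta> l (Suc l)) \<in> {0..1}"
  using wavg_bounds[OF K(1) _ _ \<eta>, of i] wavg_bounds[OF K(1) _ _ exchange_configs[OF \<eta>, of l "Suc l"], of i] K by auto

lemma L_exc_wavg_le:
  fixes F :: "real \<Rightarrow> real"
  assumes K: "1 \<le> K" "K \<le> i" "i + K \<le> N" and \<eta>: "\<eta> \<in> configs N" and p: "0 \<le> p" "p \<le> 1"
    and lip: "\<And>u v. u \<in> {0..1} \<Longrightarrow> v \<in> {0..1} \<Longrightarrow> \<bar>F v - F u\<bar> \<le> C * \<bar>v - u\<bar>" and C: "C \<ge> 0"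
  shows "\<bar>L_exc p N (\<lambda>\<xi>. F (wavg N K i \<xi>)) \<eta>\<bar> \<le> 2 * C / real K"
  by (rule L_exc_local_le[where i=i, OF K(1) \<eta> p C]) (rule lip[OF wavg_unit_interval[OF K \<eta>]])

text \<open>After subtraction of the linear part at \<open>?u\<close>, the increment is at most
  \<open>C (v - u)^2\<close>, hence at most \<open>C/K^2\<close> times \<open>|v - u|\<close>, which
  gains two powers of \<open>K\<close> over \<open>L_exc_wavg_le\<close>. Over at most
  \<open>N\<close> cells the total error is of order \<open>N/K^3\<close>.\<close>

lemma L_exc_wavg:
  fixes F F' :: "real \<Rightarrow> real"
  assumes K: "1 \<le> K" "K < i" "i + K \<le> N" and \<eta>: "\<eta> \<in> configs N" and p: "0 \<le> p" "p \<le> 1"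
    and taylor: "\<And>u v. u \<in> {0..1} \<Longrightarrow> v \<in> {0..1} \<Longrightarrow> \<bar>F v - F u - F' u * (v - u)\<bar> \<le> C * (v - u)\<^sup>2"
    and C: "C \<ge> 0"
  shows "\<bar>L_exc p N (\<lambda>\<xi>. F (wavg N K i \<xi>)) \<eta> - F' (wavg N K i \<eta>) * (wcurrent p N K (i - 1) \<eta> - wcurrent p N K i \<eta>)\<bar>
    \<le> 2 * C / (real K)^3"
proof -
  let ?u = "wavg N K i \<eta>"
  let ?h = "\<lambda>\<xi>. F (wavg N K i \<xi>) - F' ?u * wavg N K i \<xi>"
  have "L_exc p N ?h \<eta> = L_exc p N (\<lambda>\<xi>. F (wavg N K i \<xi>)) \<eta> - F' ?u * L_exc p N (wavg N K i) \<eta>"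
    unfolding L_exc_def sum_distrib_left sum_subtractf[symmetric] by (intro sum.cong refl) (simp add: algebra_simps)
  moreover have "\<bar>L_exc p N ?h \<eta>\<bar> \<le> 2 * (C / (real K)\<^sup>2) / real K"
  proof (rule L_exc_local_le[where i=i, OF K(1) \<eta> p])
    fix l assume l: "l \<in> {1..<N}"
    let ?v = "wavg N K i (exchange \<eta> l (Suc l))"
    note u01 = wavg_unit_interval[OF K(1) less_imp_le[OF K(2)] K(3) \<eta>]
    have "\<bar>?h (exchange \<eta> l (Suc l)) - ?h \<eta>\<bar> = \<bar>F ?v - F ?u - F' ?u * (?v - ?u)\<bar>"
      by (simp add: algebra_simps)
    also have "\<dots> \<le> C * (?v - ?u)\<^sup>2" by (rule taylor[OF u01(1) u01(2)[OF l]])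
    also have "\<dots> = C * \<bar>?v - ?u\<bar> * \<bar>?v - ?u\<bar>" by (simp add: power2_eq_square mult.assoc)
    also have "\<dots> \<le> C * (1 / (real K)\<^sup>2) * \<bar>?v - ?u\<bar>"
      by (intro mult_right_mono mult_left_mono wavg_exchange_Suc_le l \<eta> C) simp
    finally show "\<bar>?h (exchange \<eta> l (Suc l)) - ?h \<eta>\<bar> \<le> C / (real K)\<^sup>2 * \<bar>?v - ?u\<bar>" by simp
  qed (use C in simp)
  ultimately show ?thesis
    unfolding L_exc_block_avg[OF K(1,2) \<eta>] by (simp add: power2_eq_square power3_eq_cube)
qed

text \<open>Occupations at \<open>l + 1\<close> weighted at \<open>l\<close> form the average
  centred at \<open>i + 1\<close>, which produces the gradient. Subtracting the flux at
  \<open>wavg N K i\<close> then leaves only \<open>wdefect\<close> and a gradient, the two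
  quantities with second-moment bounds.\<close>

lemma wcurrent_eq:
  assumes K: "1 \<le> K" "K \<le> i" "i + K \<le> N"
  shows "wcurrent p N K i \<eta> = (2 * p - 1) * (wavg N K i \<eta> - wpair N K i \<eta>) + (1 - p) * (wavg N K i \<eta> - wavg N K (Suc i) \<eta>)"
proof -
  have 1: "(\<Sum>l\<in>{1..<N}. wt K i l * \<eta> l) = wavg N K i \<eta>"
  proof -
    have "{1..N} = insert N {1..<N}" using K by auto
    moreover have "wt K i N = 0" using K by (intro wt_zero) auto
    ultimately show ?thesis by (simp add: wavg_def)
  qed
  have 2: "(\<Sum>l\<in>{1..<N}. wt K i l * \<eta> (Suc l)) = wavg N K (Suc i) \<eta>"
  proof -
    have "{1..N} = insert 1 {Suc 1..<Suc N}" using K by auto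
    moreover have "wt K (Suc i) 1 = 0" using K by (intro wt_zero) auto
    moreover have "(\<Sum>l\<in>{1..<N}. wt K i l * \<eta> (Suc l)) = (\<Sum>k\<in>{Suc 1..<Suc N}. wt K (Suc i) k * \<eta> k)"
      by (subst sum.shift_bounds_Suc_ivl) (simp add: wt_Suc_Suc)
    ultimately show ?thesis by (simp add: wavg_def)
  qed
  have "wcurrent p N K i \<eta> = (\<Sum>l\<in>{1..<N}. p * (wt K i l * \<eta> l) - (1 - p) * (wt K i l * \<eta> (Suc l)) - (2 * p - 1) * (wt K i l * (\<eta> l * \<eta> (Suc l))))"
    unfolding wcurrent_def bond_current_def by (intro sum.cong refl) (simp add: algebra_simps)
  also have "\<dots> = p * wavg N K i \<eta> - (1 - p) * wavg N K (Suc i) \<eta> - (2 * p - 1) * wpair N K i \<eta>"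
    by (simp only: sum_subtractf sum_distrib_left[symmetric] 1 2 wpair_def)
  finally show ?thesis by (simp add: algebra_simps)
qed

lemma summation_by_parts:
  fixes a b :: "nat \<Rightarrow> real"
  assumes "m \<le> Suc n" "1 \<le> m"
  shows "(\<Sum>i\<in>{m..n}. a i * (b (i - 1) - b i)) = a m * b (m - 1) - a (Suc n) * b n + (\<Sum>i\<in>{m..n}. (a (Suc i) - a i) * b i)"
  using assms
proof (induction n)
  case 0
  then show ?case by (cases "m = 1") auto
next
  case (Suc n)
  show ?case
  proof (cases "m = Suc (Suc n)")
    case False
    then show ?thesis using Suc by (simp add: algebra_simps)
  qed simp
qed

lemma chi_integral:
  fixes \<psi> \<psi>' :: "real \<Rightarrow> real"
  assumes N: "1 \<le> N" and i: "1 \<le> i" "i < N"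
    and d: "\<And>x. x \<in> {0..1} \<Longrightarrow> (\<psi> has_real_derivative \<psi>' x) (at x within {0..1})"
    and c: "continuous_on {0..1} \<psi>'"
  shows "integrable lborel (\<lambda>x. indicator {0..1} x * (chi N i x * \<psi>' x))"
    and "(\<integral>x. indicator {0..1} x * (chi N i x * \<psi>' x) \<partial>lborel) = \<psi> ((real i + 1/2) / real N) - \<psi> ((real i - 1/2) / real N)"
proof -
  let ?a = "(real i - 1/2) / real N" and ?b = "(real i + 1/2) / real N"
  have ab: "0 \<le> ?a" "?a \<le> ?b" "?b \<le> 1" using i N by (auto simp: field_simps)
  have sub: "{?a..?b} \<subseteq> {0..1}" using ab by auto
  have cab: "continuous_on {?a..?b} \<psi>'" using continuous_on_subset[OF c sub] .
  have si: "set_integrable lborel {?a..?b} \<psi>'" by (rule borel_integrable_atLeastAtMost'[OF cab])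
  have e: "real i / real N - 1 / (2 * real N) = ?a" "real i / real N + 1 / (2 * real N) = ?b"
    by (simp_all add: diff_divide_distrib add_divide_distrib)
  \<comment> \<open>The cell is half-open, hence the exception at its right end; for
    \<open>1 <= i < N\<close> it lies within \<open>{0..1}\<close>, so the intersection in
    \<open>chi\<close> has no effect.\<close>
  have eq: "indicator {0..1} x * (chi N i x * \<psi>' x) = indicator {?a..?b} x *\<^sub>R \<psi>' x" if "x \<noteq> ?b" for x
    unfolding chi_def e using that ab by (auto simp: indicator_def)
  have meas: "(\<lambda>x. indicator {0..1} x * (chi N i x * \<psi>' x)) \<in> borel_measurable lborel"
  proof -
    have "(\<lambda>x. chi N i x * (indicator {0..1} x *\<^sub>R \<psi>' x)) \<in> borel_measurable lborel"
      using borel_integrable_atLeastAtMost'[OF c] unfolding set_integrable_def chi_def by measurable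
    then show ?thesis by (simp add: ac_simps)
  qed
  have ae: "AE x in lborel. indicator {0..1} x * (chi N i x * \<psi>' x) = indicator {?a..?b} x *\<^sub>R \<psi>' x"
    using AE_lborel_singleton[of ?b] by eventually_elim (rule eq)
  have m2: "(\<lambda>x. indicator {?a..?b} x *\<^sub>R \<psi>' x) \<in> borel_measurable lborel"
    using si by (auto simp: set_integrable_def)
  show "integrable lborel (\<lambda>x. indicator {0..1} x * (chi N i x * \<psi>' x))"
    by (subst integrable_cong_AE[OF meas m2 ae]) (use si in \<open>simp add: set_integrable_def\<close>)
  have "(\<integral>x. indicator {0..1} x * (chi N i x * \<psi>' x) \<partial>lborel) = (LINT x:{?a..?b}|lborel. \<psi>' x)"
    unfolding set_lebesgue_integral_def by (rule integral_cong_AE[OF meas m2 ae])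
  also have "\<dots> = integral {?a..?b} \<psi>'"
    by (rule set_borel_integral_eq_integral(2)[OF si])
  also have "\<dots> = \<psi> ?b - \<psi> ?a"
    by (intro integral_unique fundamental_theorem_of_calculus ab)
       (use d sub in \<open>auto simp: has_real_derivative_iff_has_vector_derivative[symmetric] intro!: DERIV_subset[OF _ sub]\<close>)
  finally show "(\<integral>x. indicator {0..1} x * (chi N i x * \<psi>' x) \<partial>lborel) = \<psi> ?b - \<psi> ?a" .
qed

lemma chi_disjoint:
  assumes "1 \<le> N" "chi N i x \<noteq> 0" "chi N j x \<noteq> 0"
  shows "i = j"
proof -
  have 1: "real i / real N - 1 / (2 * real N) \<le> x" "x < real i / real N + 1 / (2 * real N)"
    using assms(2) by (auto simp: chi_def indicator_def split: if_splits)
  have 2: "real j / real N - 1 / (2 * real N) \<le> x" "x < real j / real N + 1 / (2 * real N)"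
    using assms(3) by (auto simp: chi_def indicator_def split: if_splits)
  have "(real i - real j) / real N < 1 / real N" "(real j - real i) / real N < 1 / real N"
  proof -
    have "1 / real N = 1 / (2 * real N) + 1 / (2 * real N)" using assms(1) by simp
    then show "(real i - real j) / real N < 1 / real N" "(real j - real i) / real N < 1 / real N"
      using 1 2 unfolding diff_divide_distrib by linarith+
  qed
  then have "real i - real j < 1" "real j - real i < 1"
    using assms(1) by (simp_all add: divide_less_cancel)
  then show ?thesis by linarith
qed

text \<open>The cells are disjoint, so at most one \<open>chi N i x\<close> is nonzero. Where none
  is, near the two ends of the interval, \<open>rho_hat\<close> has the default value
  \<open>0\<close>; this is why \<open>Q 0\<close> serves as the base value.\<close>

lemma rho_hat_compose:
  fixes Q :: "real \<Rightarrow> real"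
  assumes N: "1 \<le> N" and K: "1 \<le> K"
  shows "Q (rho_hat N K \<eta> x) = Q 0 + (\<Sum>i\<in>{K+1..N-K}. chi N i x * (Q (wavg N K i \<eta>) - Q 0))"
proof -
  have ba: "block_avg K \<eta> i = wavg N K i \<eta>" if "i \<in> {K+1..N-K}" for i
    using that K by (intro block_avg_eq_wavg) auto
  show ?thesis
  proof (cases "\<exists>i\<in>{K+1..N-K}. chi N i x \<noteq> 0")
    case True
    then obtain i where i: "i \<in> {K+1..N-K}" "chi N i x \<noteq> 0" by auto
    have one: "chi N i x = 1" using i(2) by (auto simp: chi_def indicator_def)
    have z: "chi N j x = 0" if "j \<noteq> i" for j using chi_disjoint[OF N i(2)] that by metis
    have s: "(\<Sum>j\<in>{K+1..N-K}. chi N j x * h j) = h i" for h :: "nat \<Rightarrow> real"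
    proof -
      have "(\<Sum>j\<in>{K+1..N-K}. chi N j x * h j) = (\<Sum>j\<in>{i}. chi N j x * h j)"
        by (rule sum.mono_neutral_right) (use i z in auto)
      then show ?thesis using one by simp
    qed
    show ?thesis unfolding rho_hat_def s ba[OF i(1)] by simp
  next
    case False
    then have "(\<Sum>i\<in>{K+1..N-K}. chi N i x * h i) = 0" for h :: "nat \<Rightarrow> real" by (intro sum.neutral) auto
    then show ?thesis unfolding rho_hat_def by simp
  qed
qed

lemma rho_hat_bounds:
  assumes N: "1 \<le> N" and K: "1 \<le> K" and \<eta>: "\<eta> \<in> configs N"
  shows "rho_hat N K \<eta> x \<in> {0..1}"
proof (cases "\<exists>i\<in>{K+1..N-K}. chi N i x \<noteq> 0")
  case True
  then obtain i where i: "i \<in> {K+1..N-K}" "chi N i x \<noteq> 0" by auto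
  have one: "chi N i x = 1" using i(2) by (auto simp: chi_def indicator_def)
  have z: "chi N j x = 0" if "j \<noteq> i" for j using chi_disjoint[OF N i(2)] that by metis
  have "rho_hat N K \<eta> x = (\<Sum>j\<in>{i}. chi N j x * block_avg K \<eta> j)"
    unfolding rho_hat_def by (rule sum.mono_neutral_right) (use i z in auto)
  also have "\<dots> = wavg N K i \<eta>" using one block_avg_eq_wavg[OF K, of i N \<eta>] i by auto
  finally show ?thesis using wavg_bounds[OF K _ _ \<eta>, of i] i by auto
next
  case False
  then have "rho_hat N K \<eta> x = 0" unfolding rho_hat_def by (intro sum.neutral) auto
  then show ?thesis by simp
qed

text \<open>On each cell the integral of \<open>\<psi>'\<close> is an increment of
  \<open>\<psi>\<close>. The error comes from the two margins without cells, of width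
  \<open>(K + 1/2)/N\<close> on the left and \<open>(K - 1/2)/N\<close> on the right, where the
  integrand is \<open>Q 0\<close> times \<open>\<psi>'\<close>.\<close>

lemma flux_integral:
  fixes \<psi> \<psi>' Q :: "real \<Rightarrow> real"
  assumes N: "1 \<le> N" and K: "1 \<le> K" "2 * K < N"
    and d: "\<And>x. x \<in> {0..1} \<Longrightarrow> (\<psi> has_real_derivative \<psi>' x) (at x within {0..1})"
    and c: "continuous_on {0..1} \<psi>'" and b: "\<And>x. x \<in> {0..1} \<Longrightarrow> \<bar>\<psi>' x\<bar> \<le> C"
    and Q: "\<bar>Q 0\<bar> \<le> C"
  shows "\<bar>(\<integral>x. indicator {0..1} x * (Q (rho_hat N K \<eta> x) * \<psi>' x) \<partial>lborel)
     - (\<Sum>i\<in>{K+1..N-K}. (\<psi> ((real i + 1/2) / real N) - \<psi> ((real i - 1/2) / real N)) * Q (wavg N K i \<eta>))\<bar> \<le> 2 * C\<^sup>2 * (real K / real N)"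
proof -
  let ?s = "\<lambda>i. \<psi> ((real i - 1/2) / real N)"
  have sS: "\<psi> ((real i + 1/2) / real N) = ?s (Suc i)" for i by (simp add: add_divide_distrib diff_divide_distrib add.commute)
  have si: "integrable lborel (\<lambda>x. indicator {0..1} x * \<psi>' x)"
    using borel_integrable_atLeastAtMost'[OF c] by (simp add: set_integrable_def)
  note ci = chi_integral[OF N _ _ d c]
  have cint: "integrable lborel (\<lambda>x. indicator {0..1} x * (chi N i x * \<psi>' x))"
    "(\<integral>x. indicator {0..1} x * (chi N i x * \<psi>' x) \<partial>lborel) = ?s (Suc i) - ?s i" if "i \<in> {K+1..N-K}" for i
    using ci[of i] that K unfolding sS by auto
  have i01: "(\<integral>x. indicator {0..1} x * \<psi>' x \<partial>lborel) = \<psi> 1 - \<psi> 0"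
  proof -
    have "(\<integral>x. indicator {0..1} x * \<psi>' x \<partial>lborel) = integral {0..1} \<psi>'"
      using set_borel_integral_eq_integral(2)[OF borel_integrable_atLeastAtMost'[OF c]] by (simp add: set_lebesgue_integral_def)
    also have "\<dots> = \<psi> 1 - \<psi> 0"
      by (intro integral_unique fundamental_theorem_of_calculus)
         (use d in \<open>auto simp: has_real_derivative_iff_has_vector_derivative[symmetric]\<close>)
    finally show ?thesis .
  qed
  have "(\<integral>x. indicator {0..1} x * (Q (rho_hat N K \<eta> x) * \<psi>' x) \<partial>lborel)
    = (\<integral>x. Q 0 * (indicator {0..1} x * \<psi>' x) + (\<Sum>i\<in>{K+1..N-K}. (Q (wavg N K i \<eta>) - Q 0) * (indicator {0..1} x * (chi N i x * \<psi>' x))) \<partial>lborel)"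
    unfolding rho_hat_compose[OF N K(1)]
    by (intro Bochner_Integration.integral_cong refl)
       (simp add: distrib_right distrib_left sum_distrib_left sum_distrib_right ac_simps)
  also have "\<dots> = Q 0 * (\<psi> 1 - \<psi> 0) + (\<Sum>i\<in>{K+1..N-K}. (Q (wavg N K i \<eta>) - Q 0) * (?s (Suc i) - ?s i))"
    by (subst Bochner_Integration.integral_add)
       (use si cint in \<open>auto simp: i01\<close>)
  also have "\<dots> = (\<Sum>i\<in>{K+1..N-K}. (?s (Suc i) - ?s i) * Q (wavg N K i \<eta>))
      + Q 0 * (\<psi> 1 - \<psi> 0 - (\<Sum>i\<in>{K+1..N-K}. ?s (Suc i) - ?s i))"
    by (simp add: algebra_simps sum.distrib sum_subtractf sum_distrib_left)
  also have "(\<Sum>i\<in>{K+1..N-K}. ?s (Suc i) - ?s i) = ?s (Suc (N-K)) - ?s (K+1)"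
    by (rule sum_Suc_diff) (use K in auto)
  finally have e: "(\<integral>x. indicator {0..1} x * (Q (rho_hat N K \<eta> x) * \<psi>' x) \<partial>lborel)
     - (\<Sum>i\<in>{K+1..N-K}. (?s (Suc i) - ?s i) * Q (wavg N K i \<eta>)) = Q 0 * ((\<psi> 1 - ?s (Suc (N-K))) + (?s (K+1) - \<psi> 0))"
    by (simp add: algebra_simps)
  have lip: "\<bar>\<psi> y - \<psi> x\<bar> \<le> C * \<bar>y - x\<bar>" if "x \<in> {0..1}" "y \<in> {0..1}" for x y
    using field_differentiable_bound[of "{0..1}" \<psi> \<psi>' C y x] d b that by auto
  have C0: "C \<ge> 0" using b[of 0] by auto
  have m1: "(real (Suc (N-K)) - 1/2) / real N \<in> {0..1}" "(real (K+1) - 1/2) / real N \<in> {0..1}"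
    using K N by (auto simp: field_simps)
  have "\<bar>\<psi> 1 - ?s (Suc (N-K))\<bar> \<le> C * \<bar>1 - (real (Suc (N-K)) - 1/2) / real N\<bar>"
    by (intro lip m1) auto
  also have "1 - (real (Suc (N-K)) - 1/2) / real N = (real K - 1/2) / real N"
    using K N by (simp add: of_nat_diff field_simps)
  finally have 1: "\<bar>\<psi> 1 - ?s (Suc (N-K))\<bar> \<le> C * ((real K - 1/2) / real N)" using K by simp
  have "\<bar>?s (K+1) - \<psi> 0\<bar> \<le> C * \<bar>(real (K+1) - 1/2) / real N - 0\<bar>"
    by (intro lip m1) auto
  then have 2: "\<bar>?s (K+1) - \<psi> 0\<bar> \<le> C * ((real K + 1/2) / real N)" by (simp add: add.commute)
  have "\<bar>(\<psi> 1 - ?s (Suc (N-K))) + (?s (K+1) - \<psi> 0)\<bar> \<le> C * ((real K - 1/2) / real N) + C * ((real K + 1/2) / real N)"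
    using 1 2 by linarith
  also have "\<dots> = C * (2 * (real K / real N))"
    by (simp add: add_divide_distrib diff_divide_distrib algebra_simps)
  finally have "\<bar>Q 0 * ((\<psi> 1 - ?s (Suc (N-K))) + (?s (K+1) - \<psi> 0))\<bar> \<le> C * (C * (2 * (real K / real N)))"
    unfolding abs_mult using Q C0 by (intro mult_mono) auto
  then show ?thesis unfolding sS e by (simp add: power2_eq_square ac_simps)
qed

text \<open>The factor \<open>1/K\<close> is that of a single increment: the product of an increment
  and a defect is \<open>1/K\<close> times a product of the two scaled quantities. The range starts
  at \<open>K\<close>, one below the cells of \<open>rho_hat\<close>, because differences with the
  preceding cell occur.\<close>

definition fluctuation :: "nat \<Rightarrow> nat \<Rightarrow> config \<Rightarrow> real" where
  "fluctuation N K \<eta> = (\<Sum>i\<in>{K..N-K}. (wdefect N K i \<eta>)\<^sup>2 + (real K * (wavg N K (Suc i) \<eta> - wavg N K i \<eta>))\<^sup>2) / real K"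

lemma fluctuation_nonneg: "fluctuation N K \<eta> \<ge> 0"
  by (simp add: fluctuation_def sum_nonneg)

text \<open>\<open>K/N\<close> stems from the margins of \<open>rho_hat\<close> and from the
  variation of the test function, \<open>N/K^3\<close> from linearizing the entropy in the
  generator, and \<open>1/K\<close> together with the last two terms from the ends of the summations
  by parts.\<close>

definition flux_error :: "nat \<Rightarrow> nat \<Rightarrow> real \<Rightarrow> config \<Rightarrow> real" where
  "flux_error N K w \<eta> = real K / real N + 1 / real K + real N / (real K)^3 + fluctuation N K \<eta>
     + \<bar>wavg N K K \<eta> - w\<bar> + \<bar>wavg N K (N - K) \<eta> - w\<bar>"

text \<open>The weights \<open>K\<close> and \<open>1/K\<close> in these bounds are those of the Young inequality: with them every
  error term is absorbed by the fluctuation functional.\<close>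

lemma young_cell:
  fixes d e g :: real
  assumes K: "1 \<le> K" and N: "0 < N" and g: "\<bar>g\<bar> \<le> \<bar>e\<bar> + \<bar>d\<bar>"
  shows "d\<^sup>2 \<le> (e\<^sup>2 + (K * d)\<^sup>2) / K"
    and "\<bar>d\<bar> * \<bar>g\<bar> \<le> 2 * ((e\<^sup>2 + (K * d)\<^sup>2) / K)"
    and "\<bar>g\<bar> / N \<le> (e\<^sup>2 + (K * d)\<^sup>2) / K + K / N\<^sup>2"
proof -
  define E where "E = (e\<^sup>2 + (K * d)\<^sup>2) / K"
  have E: "K * E = e\<^sup>2 + (K * d)\<^sup>2" using K by (simp add: E_def)
  have "K * d\<^sup>2 \<le> K * (K * d\<^sup>2)"
    using K mult_right_mono[of 1 K "d\<^sup>2"] by (intro mult_left_mono) auto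
  also have "\<dots> \<le> K * E" unfolding E by (simp add: power2_eq_square ac_simps)
  finally have 1: "d\<^sup>2 \<le> E" using K by simp
  then show "d\<^sup>2 \<le> (e\<^sup>2 + (K * d)\<^sup>2) / K" by (simp add: E_def)
  have "K * (2 * (\<bar>d\<bar> * \<bar>e\<bar>)) \<le> K * E"
    unfolding E using zero_le_power2[of "\<bar>e\<bar> - K * \<bar>d\<bar>"] by (simp add: power2_diff power_mult_distrib ac_simps)
  then have 2: "2 * (\<bar>d\<bar> * \<bar>e\<bar>) \<le> E" using K by simp
  have "\<bar>d\<bar> * \<bar>g\<bar> \<le> \<bar>d\<bar> * (\<bar>e\<bar> + \<bar>d\<bar>)" by (intro mult_left_mono g) auto
  also have "\<dots> = \<bar>d\<bar> * \<bar>e\<bar> + d\<^sup>2" by (simp add: distrib_left power2_eq_square)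
  also have "\<dots> \<le> 2 * E" using 1 2 by (smt (verit) zero_le_mult_iff abs_ge_zero)
  finally show "\<bar>d\<bar> * \<bar>g\<bar> \<le> 2 * ((e\<^sup>2 + (K * d)\<^sup>2) / K)" by (simp add: E_def)
  have "g\<^sup>2 \<le> (\<bar>e\<bar> + \<bar>d\<bar>)\<^sup>2" using power_mono[OF g, of 2] by simp
  also have "\<dots> \<le> 2 * (e\<^sup>2 + d\<^sup>2)"
    using zero_le_power2[of "\<bar>e\<bar> - \<bar>d\<bar>"] by (simp add: power2_sum power2_diff)
  also have "d\<^sup>2 \<le> K * (K * d\<^sup>2)"
    using K mult_mono[of 1 K 1 K] by (simp add: mult.assoc[symmetric] mult_le_cancel_right1 mult_right_mono)
  then have "2 * (e\<^sup>2 + d\<^sup>2) \<le> 2 * (K * E)" unfolding E by (simp add: power2_eq_square ac_simps)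
  finally have "(1 / K) * g\<^sup>2 \<le> (1 / K) * (2 * (K * E))" using K by (intro mult_left_mono) auto
  then have 3: "(1 / K) * g\<^sup>2 \<le> 2 * E" using K by simp
  have "0 \<le> (1 / K) * (\<bar>g\<bar> - K / N)\<^sup>2" using K by simp
  also have "\<dots> = (1 / K) * g\<^sup>2 - 2 * (\<bar>g\<bar> / N) + K / N\<^sup>2"
    using K N by (simp add: power2_eq_square field_simps)
  finally have 4: "0 \<le> (1 / K) * g\<^sup>2 - 2 * (\<bar>g\<bar> / N) + K / N\<^sup>2" .
  have "y \<le> E + z / 2" if "0 \<le> x - 2 * y + z" "x \<le> 2 * E" for x y z :: real using that by simp
  from this[OF 4 3] have "\<bar>g\<bar> / N \<le> E + (K / N\<^sup>2) / 2" .
  moreover have "y / 2 \<le> y" if "0 \<le> y" for y :: real using that by simp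
  from this[of "K / N\<^sup>2"] have "(K / N\<^sup>2) / 2 \<le> K / N\<^sup>2" using K by simp
  ultimately show "\<bar>g\<bar> / N \<le> (e\<^sup>2 + (K * d)\<^sup>2) / K + K / N\<^sup>2" unfolding E_def[symmetric] by linarith
qed

text \<open>With \<open>a i = s i F'(u i)\<close>, linearization turns the generator sum into one of
  \<open>a i\<close> against differences of the averaged current, which is split into
  \<open>fl (u i)\<close> and a deviation \<open>g i\<close>. The flux part becomes differences of
  \<open>Q\<close>, because \<open>Q' = J' F'\<close>, and a summation by parts moves the difference
  to the test function. For the deviation a summation by parts brings in the increments of
  \<open>a\<close>, and Young absorbs the products in the fluctuations. All end terms contain
  \<open>F'\<close> or \<open>Q\<close>, which vanish at \<open>w\<close>, so they cost only the
  deviation of an end block from \<open>w\<close> and \<open>1/K\<close>.\<close>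

lemma flux_error_bound:
  fixes F F' Q \<psi> \<psi>' :: "real \<Rightarrow> real"
  assumes K: "1 \<le> K" "2 * K < N" and \<eta>: "\<eta> \<in> configs N" and p: "0 \<le> p" "p \<le> 1" and C: "C \<ge> 0"
    and d: "\<And>x. x \<in> {0..1} \<Longrightarrow> (\<psi> has_real_derivative \<psi>' x) (at x within {0..1})"
    and c: "continuous_on {0..1} \<psi>'" and \<psi>': "\<And>x. x \<in> {0..1} \<Longrightarrow> \<bar>\<psi>' x\<bar> \<le> C"
    and \<psi>: "\<And>x. x \<in> {0..1} \<Longrightarrow> \<bar>\<psi> x\<bar> \<le> C"
    and F'b: "\<And>u. u \<in> {0..1} \<Longrightarrow> \<bar>F' u\<bar> \<le> C"
    and F'w: "\<And>u. u \<in> {0..1} \<Longrightarrow> \<bar>F' u\<bar> \<le> C * \<bar>u - w\<bar>"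
    and F'l: "\<And>u v. u \<in> {0..1} \<Longrightarrow> v \<in> {0..1} \<Longrightarrow> \<bar>F' v - F' u\<bar> \<le> C * \<bar>v - u\<bar>"
    and Ft: "\<And>u v. u \<in> {0..1} \<Longrightarrow> v \<in> {0..1} \<Longrightarrow> \<bar>F v - F u - F' u * (v - u)\<bar> \<le> C * (v - u)\<^sup>2"
    and Qb: "\<And>u. u \<in> {0..1} \<Longrightarrow> \<bar>Q u\<bar> \<le> C"
    and Qw: "\<And>u. u \<in> {0..1} \<Longrightarrow> \<bar>Q u\<bar> \<le> C * \<bar>u - w\<bar>"
    and Qt: "\<And>u v. u \<in> {0..1} \<Longrightarrow> v \<in> {0..1} \<Longrightarrow>
      \<bar>Q v - Q u - (2 * p - 1) * (1 - 2 * u) * F' u * (v - u)\<bar> \<le> C * (v - u)\<^sup>2"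
  shows "\<bar>(\<integral>x. indicator {0..1} x * (Q (rho_hat N K \<eta> x) * \<psi>' x) \<partial>lborel)
     - (\<Sum>i\<in>{K+1..N-K}. \<psi> ((real i - 1/2) / real N) * L_exc p N (\<lambda>\<xi>. F (wavg N K i \<xi>)) \<eta>)\<bar>
     \<le> 6 * C\<^sup>2 * flux_error N K w \<eta>"
proof -
  define u where "u i = wavg N K i \<eta>" for i
  define s where "s i = \<psi> ((real i - 1/2) / real N)" for i :: nat
  define e where "e i = wdefect N K i \<eta>" for i
  define \<delta> where "\<delta> i = u (Suc i) - u i" for i
  define fl where "fl v = (2 * p - 1) * v * (1 - v)" for v :: real
  define Jh where "Jh i = wcurrent p N K i \<eta>" for i
  define g where "g i = Jh i - fl (u i)" for i
  define E where "E i = ((e i)\<^sup>2 + (real K * \<delta> i)\<^sup>2) / real K" for i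
  define S where "S = fluctuation N K \<eta>"
  let ?m = "K + 1" and ?n = "N - K"
  have N: "1 \<le> N" using K by simp
  have S: "S = (\<Sum>i\<in>{K..?n}. E i)"
    by (simp add: S_def fluctuation_def E_def e_def \<delta>_def u_def sum_divide_distrib)
  have E0: "E i \<ge> 0" for i by (simp add: E_def)
  have S0: "S \<ge> 0" unfolding S_def by (rule fluctuation_nonneg)
  have u01: "u i \<in> {0..1}" if "i \<in> {K..Suc ?n}" for i
    using wavg_bounds[OF K(1) _ _ \<eta>, of i] that K by (auto simp: u_def)
  have sb: "\<bar>s i\<bar> \<le> C" if "i \<in> {K..Suc ?n}" for i
    unfolding s_def by (rule \<psi>) (use that K in \<open>auto simp: field_simps\<close>)
  have sl: "\<bar>s (Suc i) - s i\<bar> \<le> C / real N" if "i \<in> {K..?n}" for i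
  proof -
    have "\<bar>s (Suc i) - s i\<bar> \<le> C * \<bar>(real (Suc i) - 1/2) / real N - (real i - 1/2) / real N\<bar>"
      unfolding s_def
      using field_differentiable_bound[of "{0..1}" \<psi> \<psi>' C "(real (Suc i) - 1/2) / real N" "(real i - 1/2) / real N"] d \<psi>' that K
      by (auto simp: field_simps)
    also have "(real (Suc i) - 1/2) / real N - (real i - 1/2) / real N = 1 / real N"
      by (simp add: diff_divide_distrib[symmetric])
    finally show ?thesis by simp
  qed
  have Kd: "\<bar>\<delta> i\<bar> \<le> 1 / real K" if "i \<in> {K..?n}" for i
  proof -
    have "K \<le> i" "i + K \<le> N" using that K by auto
    from wavg_gradient_le[OF K(1) this \<eta>] have "real K * \<bar>\<delta> i\<bar> \<le> 1"
      by (simp add: \<delta>_def u_def abs_mult)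
    then show ?thesis using K by (simp add: pos_le_divide_eq mult.commute)
  qed
  have d1: "\<bar>\<delta> i\<bar> \<le> 1" if "i \<in> {K..?n}" for i
    using Kd[OF that] K by (auto intro: order_trans)
  have ge: "\<bar>g i\<bar> \<le> \<bar>e i\<bar> + \<bar>\<delta> i\<bar>" if "i \<in> {K..?n}" for i
  proof -
    have iK: "K \<le> i" "i + K \<le> N" using that K by auto
    have "g i = - ((2 * p - 1) * e i) - (1 - p) * \<delta> i"
      using wcurrent_eq[OF K(1) iK, of p \<eta>]
      by (simp add: g_def Jh_def fl_def e_def wdefect_def \<delta>_def u_def algebra_simps power2_eq_square)
    moreover have "\<bar>(2 * p - 1) * e i\<bar> \<le> 1 * \<bar>e i\<bar>" unfolding abs_mult by (intro mult_right_mono) (use p in auto)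
    moreover have "\<bar>(1 - p) * \<delta> i\<bar> \<le> 1 * \<bar>\<delta> i\<bar>" unfolding abs_mult by (intro mult_right_mono) (use p in auto)
    ultimately show ?thesis by linarith
  qed
  have e1: "\<bar>e i\<bar> \<le> 1" if "i \<in> {K..?n}" for i
    unfolding e_def by (rule wdefect_bounds[OF K(1) _ _ \<eta>]) (use that K in auto)
  have g2: "\<bar>g i\<bar> \<le> 2" if "i \<in> {K..?n}" for i
    using ge[OF that] e1[OF that] d1[OF that] by linarith
  have Y: "(\<delta> i)\<^sup>2 \<le> E i" "\<bar>\<delta> i\<bar> * \<bar>g i\<bar> \<le> 2 * E i" "\<bar>g i\<bar> / real N \<le> E i + real K / (real N)\<^sup>2" if "i \<in> {K..?n}" for i
    using young_cell[of "real K" "real N" "g i" "e i" "\<delta> i"] ge[OF that] K by (auto simp: E_def)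
  have sub: "i \<in> {K..?n} \<and> i \<in> {K..Suc ?n} \<and> Suc i \<in> {K..Suc ?n} \<and> i - 1 \<in> {K..?n} \<and> i - 1 \<in> {K..Suc ?n}" if "i \<in> {?m..?n}" for i
    using that by auto
  let ?U = "\<Sum>i\<in>{?m..?n}. s i * L_exc p N (\<lambda>\<xi>. F (wavg N K i \<xi>)) \<eta>"
  define a where "a i = s i * F' (u i)" for i
  define U1 where "U1 = (\<Sum>i\<in>{?m..?n}. a i * (Jh (i - 1) - Jh i))"
  have stepA: "\<bar>?U - U1\<bar> \<le> 2 * C\<^sup>2 * (real N / (real K)^3)"
  proof -
    have "?U - U1 = (\<Sum>i\<in>{?m..?n}. s i * (L_exc p N (\<lambda>\<xi>. F (wavg N K i \<xi>)) \<eta> - F' (u i) * (Jh (i - 1) - Jh i)))"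
      unfolding U1_def a_def sum_subtractf[symmetric] by (intro sum.cong refl) (simp add: algebra_simps)
    then have "\<bar>?U - U1\<bar> \<le> (\<Sum>i\<in>{?m..?n}. \<bar>s i * (L_exc p N (\<lambda>\<xi>. F (wavg N K i \<xi>)) \<eta> - F' (u i) * (Jh (i - 1) - Jh i))\<bar>)"
      by (simp only: sum_abs)
    also have "\<dots> \<le> (\<Sum>i\<in>{?m..?n}. C * (2 * C / (real K)^3))"
    proof (rule sum_mono)
      fix i assume i: "i \<in> {?m..?n}"
      show "\<bar>s i * (L_exc p N (\<lambda>\<xi>. F (wavg N K i \<xi>)) \<eta> - F' (u i) * (Jh (i - 1) - Jh i))\<bar> \<le> C * (2 * C / (real K)^3)"
        unfolding abs_mult Jh_def u_def
        by (intro mult_mono sb L_exc_wavg[OF K(1) _ _ \<eta> p Ft C]) (use i sub[OF i] K C in auto)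
    qed
    also have "\<dots> = real (card {?m..?n}) * (C * (2 * C / (real K)^3))" by simp
    also have "\<dots> \<le> real N * (C * (2 * C / (real K)^3))"
      by (intro mult_right_mono) (use C K in auto)
    finally show ?thesis by (simp add: power2_eq_square ac_simps)
  qed
  define T1 where "T1 = (\<Sum>i\<in>{?m..?n}. a i * (fl (u (i - 1)) - fl (u i)))"
  define T2 where "T2 = (\<Sum>i\<in>{?m..?n}. a i * (g (i - 1) - g i))"
  have U12: "U1 = T1 + T2"
    unfolding U1_def T1_def T2_def sum.distrib[symmetric] by (intro sum.cong refl) (simp add: g_def algebra_simps)
  have m: "?m \<le> Suc ?n" "1 \<le> ?m" using K by auto
  have sE: "(\<Sum>i\<in>{?m..?n}. E i) \<le> S" unfolding S by (rule sum_mono2) (use E0 in auto)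
  have sE1: "(\<Sum>i\<in>{?m..?n}. E (i - 1)) \<le> S"
  proof -
    have "(\<Sum>i\<in>{?m..?n}. E (i - 1)) = (\<Sum>i\<in>{K..?n - 1}. E i)"
      by (rule sum.reindex_bij_witness[of _ Suc "\<lambda>i. i - 1"]) (use K in auto)
    also have "\<dots> \<le> S" unfolding S by (rule sum_mono2) (use E0 in auto)
    finally show ?thesis .
  qed
  have uw: "\<bar>u (Suc i) - w\<bar> \<le> \<bar>u i - w\<bar> + 1 / real K" if "i \<in> {K..?n}" for i
    using Kd[OF that] by (simp add: \<delta>_def)
  \<comment> \<open>The vanishing of \<open>F'\<close> at \<open>w\<close> bounds the coefficient by
    the distance of the block average to \<open>w\<close>. Passing from \<open>Suc i\<close> to
    \<open>i\<close> costs one increment, at most \<open>1/K\<close>, since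
    \<open>flux_error\<close> measures the blocks \<open>K\<close> and \<open>N - K\<close>.\<close>
  have ab: "\<bar>a (Suc i)\<bar> \<le> C\<^sup>2 * (\<bar>u i - w\<bar> + 1 / real K)" if "i \<in> {K..?n}" for i
  proof -
    have "\<bar>a (Suc i)\<bar> \<le> C * (C * \<bar>u (Suc i) - w\<bar>)"
      unfolding a_def abs_mult by (intro mult_mono sb F'w u01) (use that C in auto)
    also have "\<dots> \<le> C * (C * (\<bar>u i - w\<bar> + 1 / real K))"
      by (intro mult_left_mono uw that C)
    finally show ?thesis by (simp add: power2_eq_square)
  qed
  have stepT2: "\<bar>T2\<bar> \<le> C\<^sup>2 * (2 * \<bar>u K - w\<bar> + 2 * \<bar>u ?n - w\<bar> + 4 / real K + 3 * S + real K / real N)"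
  proof -
    have Kin: "K \<in> {K..?n}" "?n \<in> {K..?n}" using K by auto
    have "T2 = a ?m * g (?m - 1) - a (Suc ?n) * g ?n + (\<Sum>i\<in>{?m..?n}. (a (Suc i) - a i) * g i)"
      unfolding T2_def by (rule summation_by_parts[OF m])
    moreover have "\<bar>a ?m * g (?m - 1)\<bar> \<le> C\<^sup>2 * (\<bar>u K - w\<bar> + 1 / real K) * 2"
      unfolding abs_mult using ab[OF Kin(1)] g2[OF Kin(1)] by (intro mult_mono) auto
    moreover have "\<bar>a (Suc ?n) * g ?n\<bar> \<le> C\<^sup>2 * (\<bar>u ?n - w\<bar> + 1 / real K) * 2"
      unfolding abs_mult using ab[OF Kin(2)] g2[OF Kin(2)] by (intro mult_mono) auto
    moreover have "\<bar>\<Sum>i\<in>{?m..?n}. (a (Suc i) - a i) * g i\<bar> \<le> C\<^sup>2 * (3 * S + real K / real N)"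
    proof -
      have "\<bar>\<Sum>i\<in>{?m..?n}. (a (Suc i) - a i) * g i\<bar> \<le> (\<Sum>i\<in>{?m..?n}. C\<^sup>2 * (3 * E i + real K / (real N)\<^sup>2))"
      proof (rule order_trans[OF sum_abs], rule sum_mono)
        fix i assume i: "i \<in> {?m..?n}"
        note i' = sub[OF i]
        \<comment> \<open>\<open>a\<close> varies through the test function by \<open>O(1/N)\<close>
          and through the block average by \<open>\<delta> i\<close>; \<open>Y\<close> treats the
          product of \<open>g i\<close> with each of the two.\<close>
        have "a (Suc i) - a i = (s (Suc i) - s i) * F' (u (Suc i)) + s i * (F' (u (Suc i)) - F' (u i))"
          by (simp add: a_def algebra_simps)
        moreover have "\<bar>(s (Suc i) - s i) * F' (u (Suc i))\<bar> \<le> C / real N * C"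
          unfolding abs_mult by (intro mult_mono sl F'b u01) (use i' C in auto)
        moreover have "\<bar>s i * (F' (u (Suc i)) - F' (u i))\<bar> \<le> C * (C * \<bar>\<delta> i\<bar>)"
          unfolding abs_mult \<delta>_def by (intro mult_mono sb F'l u01) (use i' C in auto)
        ultimately have "\<bar>a (Suc i) - a i\<bar> \<le> C\<^sup>2 * (1 / real N + \<bar>\<delta> i\<bar>)"
          by (simp add: power2_eq_square distrib_left mult.assoc)
        then have "\<bar>(a (Suc i) - a i) * g i\<bar> \<le> C\<^sup>2 * (1 / real N + \<bar>\<delta> i\<bar>) * \<bar>g i\<bar>"
          unfolding abs_mult by (intro mult_right_mono) auto
        also have "\<dots> = C\<^sup>2 * (\<bar>g i\<bar> / real N + \<bar>\<delta> i\<bar> * \<bar>g i\<bar>)" by (simp add: algebra_simps)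
        also have "\<dots> \<le> C\<^sup>2 * (3 * E i + real K / (real N)\<^sup>2)"
          by (intro mult_left_mono) (use Y(2,3)[of i] i' in auto)
        finally show "\<bar>(a (Suc i) - a i) * g i\<bar> \<le> C\<^sup>2 * (3 * E i + real K / (real N)\<^sup>2)" .
      qed
      also have "\<dots> = C\<^sup>2 * (3 * (\<Sum>i\<in>{?m..?n}. E i) + real (card {?m..?n}) * (real K / (real N)\<^sup>2))"
        by (simp add: sum_distrib_left[symmetric] sum.distrib)
      also have "\<dots> \<le> C\<^sup>2 * (3 * S + real N * (real K / (real N)\<^sup>2))"
        by (intro mult_left_mono add_mono mult_right_mono sE) auto
      also have "real N * (real K / (real N)\<^sup>2) = real K / real N" using N by (simp add: power2_eq_square)
      finally show ?thesis .
    qed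
    moreover have "\<bar>x - y + z\<bar> \<le> b1 + b2 + b3" if "\<bar>x\<bar> \<le> b1" "\<bar>y\<bar> \<le> b2" "\<bar>z\<bar> \<le> b3" for x y z b1 b2 b3 :: real
      using that by linarith
    ultimately have "\<bar>T2\<bar> \<le> C\<^sup>2 * (\<bar>u K - w\<bar> + 1 / real K) * 2 + C\<^sup>2 * (\<bar>u ?n - w\<bar> + 1 / real K) * 2 + C\<^sup>2 * (3 * S + real K / real N)"
      by (simp only:)
    also have "\<dots> = C\<^sup>2 * (2 * \<bar>u K - w\<bar> + 2 * \<bar>u ?n - w\<bar> + 4 / real K + 3 * S + real K / real N)"
      by (simp add: algebra_simps)
    finally show ?thesis .
  qed
  define T3 where "T3 = (\<Sum>i\<in>{?m..?n}. s i * (Q (u (i - 1)) - Q (u i)))"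
  have stepT13: "\<bar>T1 - T3\<bar> \<le> 2 * C\<^sup>2 * S"
  proof -
    have "T1 - T3 = (\<Sum>i\<in>{?m..?n}. s i * (F' (u i) * (fl (u (i - 1)) - fl (u i)) - (Q (u (i - 1)) - Q (u i))))"
      unfolding T1_def T3_def a_def sum_subtractf[symmetric] by (intro sum.cong refl) (simp add: algebra_simps)
    then have "\<bar>T1 - T3\<bar> \<le> (\<Sum>i\<in>{?m..?n}. \<bar>s i * (F' (u i) * (fl (u (i - 1)) - fl (u i)) - (Q (u (i - 1)) - Q (u i)))\<bar>)"
      by (simp only: sum_abs)
    also have "\<dots> \<le> (\<Sum>i\<in>{?m..?n}. 2 * C\<^sup>2 * E (i - 1))"
    proof (rule sum_mono)
      fix i assume i: "i \<in> {?m..?n}"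
      note i' = sub[OF i]
      let ?x = "u i" and ?y = "u (i - 1)"
      have dd: "(?y - ?x)\<^sup>2 = (\<delta> (i - 1))\<^sup>2" using i by (simp add: \<delta>_def power2_commute)
      \<comment> \<open>The flux is quadratic, so its expansion at \<open>?x\<close> ends with the
        exact term \<open>-(2p-1)\<close> times the squared increment; the first-order term cancels
        that of \<open>Q\<close> by the entropy-flux relation.\<close>
      have "F' ?x * (fl ?y - fl ?x) - (Q ?y - Q ?x)
        = - (Q ?y - Q ?x - (2 * p - 1) * (1 - 2 * ?x) * F' ?x * (?y - ?x)) - (2 * p - 1) * F' ?x * (?y - ?x)\<^sup>2"
        by (simp add: fl_def algebra_simps power2_eq_square)
      moreover have "\<bar>Q ?y - Q ?x - (2 * p - 1) * (1 - 2 * ?x) * F' ?x * (?y - ?x)\<bar> \<le> C * (?y - ?x)\<^sup>2"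
        by (rule Qt) (use u01 i' in auto)
      moreover have "\<bar>(2 * p - 1) * F' ?x * (?y - ?x)\<^sup>2\<bar> \<le> 1 * C * (?y - ?x)\<^sup>2"
        unfolding abs_mult abs_power2 by (intro mult_right_mono mult_mono F'b u01) (use p C i' in auto)
      ultimately have "\<bar>F' ?x * (fl ?y - fl ?x) - (Q ?y - Q ?x)\<bar> \<le> 2 * C * (?y - ?x)\<^sup>2" by linarith
      also have "\<dots> \<le> 2 * C * E (i - 1)" unfolding dd
        by (intro mult_left_mono Y(1)) (use C i' in auto)
      finally have "\<bar>s i\<bar> * \<bar>F' ?x * (fl ?y - fl ?x) - (Q ?y - Q ?x)\<bar> \<le> C * (2 * C * E (i - 1))"
        by (intro mult_mono sb) (use C i' in auto)
      then show "\<bar>s i * (F' ?x * (fl ?y - fl ?x) - (Q ?y - Q ?x))\<bar> \<le> 2 * C\<^sup>2 * E (i - 1)"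
        by (simp add: abs_mult power2_eq_square ac_simps)
    qed
    also have "\<dots> = 2 * C\<^sup>2 * (\<Sum>i\<in>{?m..?n}. E (i - 1))" by (simp add: sum_distrib_left)
    also have "\<dots> \<le> 2 * C\<^sup>2 * S" by (intro mult_left_mono sE1) auto
    finally show ?thesis .
  qed
  define T4 where "T4 = (\<Sum>i\<in>{?m..?n}. (s (Suc i) - s i) * Q (u i))"
  have stepT34: "\<bar>T3 - T4\<bar> \<le> C\<^sup>2 * (\<bar>u K - w\<bar> + \<bar>u ?n - w\<bar>)"
  proof -
    have "T3 - T4 = s ?m * Q (u K) - s (Suc ?n) * Q (u ?n)"
      unfolding T3_def T4_def summation_by_parts[OF m, of s "\<lambda>i. Q (u i)"] by simp
    moreover have "\<bar>s ?m * Q (u K)\<bar> \<le> C * (C * \<bar>u K - w\<bar>)"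
      unfolding abs_mult by (intro mult_mono sb Qw u01) (use C K in auto)
    moreover have "\<bar>s (Suc ?n) * Q (u ?n)\<bar> \<le> C * (C * \<bar>u ?n - w\<bar>)"
      unfolding abs_mult by (intro mult_mono sb Qw u01) (use C K in auto)
    moreover have "\<bar>x - y\<bar> \<le> b1 + b2" if "\<bar>x\<bar> \<le> b1" "\<bar>y\<bar> \<le> b2" for x y b1 b2 :: real
      using that by linarith
    ultimately have "\<bar>T3 - T4\<bar> \<le> C * (C * \<bar>u K - w\<bar>) + C * (C * \<bar>u ?n - w\<bar>)" by (simp only:)
    then show ?thesis by (simp add: power2_eq_square algebra_simps)
  qed
  let ?I = "\<integral>x. indicator {0..1} x * (Q (rho_hat N K \<eta> x) * \<psi>' x) \<partial>lborel"
  have stepI: "\<bar>?I - T4\<bar> \<le> 2 * C\<^sup>2 * (real K / real N)"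
  proof -
    have "T4 = (\<Sum>i\<in>{?m..?n}. (\<psi> ((real i + 1/2) / real N) - \<psi> ((real i - 1/2) / real N)) * Q (wavg N K i \<eta>))"
      unfolding T4_def s_def u_def
      by (intro sum.cong refl) (simp add: add_divide_distrib diff_divide_distrib add.commute)
    then show ?thesis using flux_integral[where N=N and K=K and \<psi>=\<psi> and \<psi>'=\<psi>' and C=C and Q=Q and \<eta>=\<eta>, OF N K d c \<psi>' Qb] by simp
  qed
  have "\<bar>?I - ?U\<bar> \<le> 2 * C\<^sup>2 * (real K / real N) + C\<^sup>2 * (\<bar>u K - w\<bar> + \<bar>u ?n - w\<bar>) + 2 * C\<^sup>2 * S
     + C\<^sup>2 * (2 * \<bar>u K - w\<bar> + 2 * \<bar>u ?n - w\<bar> + 4 / real K + 3 * S + real K / real N) + 2 * C\<^sup>2 * (real N / (real K)^3)"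
  proof -
    have "\<bar>x - y\<bar> \<le> b1 + b2 + b3 + b4 + b5"
      if "\<bar>x - t4\<bar> \<le> b1" "\<bar>t3 - t4\<bar> \<le> b2" "\<bar>t1 - t3\<bar> \<le> b3" "\<bar>t2\<bar> \<le> b4" "\<bar>y - (t1 + t2)\<bar> \<le> b5"
      for x y t1 t2 t3 t4 b1 b2 b3 b4 b5 :: real
      using that by linarith
    from this[OF stepI stepT34 stepT13 stepT2 stepA[unfolded U12]] show ?thesis .
  qed
  also have "\<dots> = C\<^sup>2 * (3 * (real K / real N) + 4 * (1 / real K) + 2 * (real N / (real K)^3) + 5 * S + 3 * \<bar>u K - w\<bar> + 3 * \<bar>u ?n - w\<bar>)"
    by (simp add: algebra_simps)
  also have "\<dots> \<le> C\<^sup>2 * (6 * flux_error N K w \<eta>)"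
  proof (intro mult_left_mono)
    have "3 * x + 4 * y + 2 * z + 5 * S + 3 * A + 3 * B \<le> 6 * (x + y + z + S + A + B)"
      if "0 \<le> x" "0 \<le> y" "0 \<le> z" "0 \<le> A" "0 \<le> B" for x y z A B :: real
      using that S0 by simp
    note gen = this
    show "3 * (real K / real N) + 4 * (1 / real K) + 2 * (real N / (real K)^3) + 5 * S + 3 * \<bar>u K - w\<bar> + 3 * \<bar>u ?n - w\<bar> \<le> 6 * flux_error N K w \<eta>"
      unfolding flux_error_def S_def[symmetric] u_def[symmetric] by (rule gen) auto
  qed auto
  finally show ?thesis by (simp add: s_def)
qed

section \<open>Regularity of the entropy pair and of the test function\<close>

text \<open>\<open>pd1\<close> and \<open>pd2\<close> come from a derivative relative to
  \<open>S\<close>, so the chain rule is stated for curves inside \<open>S\<close>. The curves used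
  are coordinate lines, possibly reparametrized by \<open>\<rho>\<close> in the second
  variable.\<close>

lemma has_real_derivative_along_curve:
  fixes f :: "real \<times> real \<Rightarrow> real"
  assumes f: "f differentiable_on S"
    and x: "(x has_real_derivative a) (at t within I)" and y: "(y has_real_derivative b) (at t within I)"
    and S: "\<And>s. s \<in> I \<Longrightarrow> (x s, y s) \<in> S" and t: "t \<in> I"
  shows "((\<lambda>s. f (x s, y s)) has_real_derivative a * pd1 S f (x t, y t) + b * pd2 S f (x t, y t)) (at t within I)"
proof -
  let ?D = "frechet_derivative f (at (x t, y t) within S)"
  have D: "(f has_derivative frechet_derivative f (at z within S)) (at z within S)" if "z \<in> S" for z
    using f that by (simp add: differentiable_on_def frechet_derivative_works)
  have g: "((\<lambda>s. (x s, y s)) has_derivative (\<lambda>h. (a * h, b * h))) (at t within I)"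
    by (intro has_derivative_Pair) (use x y in \<open>auto simp: has_field_derivative_def\<close>)
  have "((\<lambda>s. f (x s, y s)) has_derivative (\<lambda>h. ?D (a * h, b * h))) (at t within I)"
    by (rule has_derivative_in_compose2[OF _ _ t g, where t=S])
       (use D S in auto)
  moreover have "?D (a * h, b * h) = (a * pd1 S f (x t, y t) + b * pd2 S f (x t, y t)) * h" for h
  proof -
    have l: "linear ?D" using D[OF S[OF t]] by (rule has_derivative_linear)
    have "(a * h, b * h) = (a * h) *\<^sub>R (1, 0) + (b * h) *\<^sub>R (0, 1 :: real)" by simp
    then have "?D (a * h, b * h) = (a * h) *\<^sub>R ?D (1, 0) + (b * h) *\<^sub>R ?D (0, 1)"
      by (simp only: linear_add[OF l] linear_cmul[OF l])
    then show ?thesis by (simp add: pd1_def pd2_def algebra_simps)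
  qed
  ultimately show ?thesis by (simp add: has_field_derivative_def)
qed

lemma taylor_lipschitz:
  fixes f f' :: "real \<Rightarrow> real"
  assumes d: "\<And>x. x \<in> {0..1} \<Longrightarrow> (f has_real_derivative f' x) (at x within {0..1})"
    and l: "\<And>x y. x \<in> {0..1} \<Longrightarrow> y \<in> {0..1} \<Longrightarrow> \<bar>f' y - f' x\<bar> \<le> B * \<bar>y - x\<bar>"
    and uv: "u \<in> {0..1}" "v \<in> {0..1}" and B: "B \<ge> 0"
  shows "\<bar>f v - f u - f' u * (v - u)\<bar> \<le> B * (v - u)\<^sup>2"
proof -
  let ?S = "closed_segment u v"
  have S: "?S \<subseteq> {0..1}" using uv by (intro closed_segment_subset) auto
  have "norm ((f v - f' u * v) - (f u - f' u * u)) \<le> (B * \<bar>v - u\<bar>) * norm (v - u)"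
  proof (rule field_differentiable_bound[where S="?S" and f'="\<lambda>z. f' z - f' u"])
    fix z assume z: "z \<in> ?S"
    have "(f has_real_derivative f' z) (at z within ?S)" using d S z by (blast intro: DERIV_subset)
    then show "((\<lambda>z. f z - f' u * z) has_real_derivative f' z - f' u) (at z within ?S)"
      by (auto intro!: derivative_eq_intros)
    have "\<bar>z - u\<bar> \<le> \<bar>v - u\<bar>" using z by (auto simp: closed_segment_eq_real_ivl split: if_splits)
    then have "B * \<bar>z - u\<bar> \<le> B * \<bar>v - u\<bar>" using B by (rule mult_left_mono)
    then show "norm (f' z - f' u) \<le> B * \<bar>v - u\<bar>" using l[OF uv(1), of z] z S by auto
  qed auto
  moreover have "(f v - f' u * v) - (f u - f' u * u) = f v - f u - f' u * (v - u)" by (simp add: algebra_simps)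
  moreover have "(B * \<bar>v - u\<bar>) * norm (v - u) = B * (v - u)\<^sup>2" by (simp add: power2_eq_square mult.assoc)
  ultimately show ?thesis by (simp only: real_norm_def)
qed

lemma continuous_on_compact_bound:
  fixes f :: "'a::topological_space \<Rightarrow> real"
  assumes "continuous_on S f" "compact K" "K \<subseteq> S"
  shows "\<exists>B\<ge>0. \<forall>z\<in>K. \<bar>f z\<bar> \<le> B"
proof -
  have "compact (f ` K)" using assms by (intro compact_continuous_image continuous_on_subset[OF assms(1)])
  then have "bounded (f ` K)" by (rule compact_imp_bounded)
  then obtain B where "\<forall>y\<in>f ` K. norm y \<le> B" unfolding bounded_iff by auto
  then have "\<forall>z\<in>K. \<bar>f z\<bar> \<le> max B 0" by (simp add: le_max_iff_disj)
  then show ?thesis by (intro exI[of _ "max B 0"]) simp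
qed

lemma C1_on_continuous: "C1_on S f \<Longrightarrow> continuous_on S f"
  by (simp add: C1_on_def differentiable_imp_continuous_on)

lemma deriv_flux: "deriv (flux p) u = (2 * p - 1) * (1 - 2 * u)"
proof -
  have "(flux p has_real_derivative (2 * p - 1) * (1 - 2 * u)) (at u)"
    unfolding flux_def[abs_def] by (auto intro!: derivative_eq_intros simp: algebra_simps)
  then show ?thesis by (rule DERIV_imp_deriv)
qed

text \<open>\<open>w\<close> is confined to \<open>{0..1}\<close>, where the density takes its
  values, since \<open>ent_dom\<close> is unbounded in \<open>w\<close> and bounds come from
  compactness. A single constant that may be enlarged can later be shared with the test
  function.\<close>

definition Lax_bound :: "real \<Rightarrow> (real \<times> real \<Rightarrow> real) \<Rightarrow> (real \<times> real \<Rightarrow> real) \<Rightarrow> real \<Rightarrow> bool" where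
  "Lax_bound p F Q C \<longleftrightarrow> 0 \<le> C \<and> (\<forall>u\<in>{0..1}. \<forall>w\<in>{0..1}.
     \<bar>F (u, w)\<bar> \<le> C \<and> \<bar>pd2 ent_dom F (u, w)\<bar> \<le> C \<and> \<bar>pd1 ent_dom F (u, w)\<bar> \<le> C \<and> \<bar>Q (u, w)\<bar> \<le> C
     \<and> \<bar>pd1 ent_dom F (u, w)\<bar> \<le> C * \<bar>u - w\<bar> \<and> \<bar>Q (u, w)\<bar> \<le> C * \<bar>u - w\<bar>
     \<and> (\<forall>v\<in>{0..1}. \<bar>pd1 ent_dom F (v, w) - pd1 ent_dom F (u, w)\<bar> \<le> C * \<bar>v - u\<bar>
       \<and> \<bar>F (v, w) - F (u, w) - pd1 ent_dom F (u, w) * (v - u)\<bar> \<le> C * (v - u)\<^sup>2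
       \<and> \<bar>Q (v, w) - Q (u, w) - (2 * p - 1) * (1 - 2 * u) * pd1 ent_dom F (u, w) * (v - u)\<bar> \<le> C * (v - u)\<^sup>2))"

text \<open>Compactness bounds the second \<open>u\<close>-derivatives, and these give the Lipschitz
  and Taylor estimates. The bounds by \<open>|u - w|\<close> combine a Lipschitz estimate with the
  vanishing at \<open>u = w\<close>; in the Taylor estimate of \<open>Q\<close> the derivative is
  rewritten by the entropy-flux relation.\<close>

lemma boundary_Lax_pair_bounds:
  assumes "boundary_Lax_pair p F Q"
  shows "\<exists>C. Lax_bound p F Q C"
proof -
  define K where "K = ({0..1} \<times> {0..1} :: (real \<times> real) set)"
  have K: "compact K" "K \<subseteq> ent_dom" by (auto simp: K_def ent_dom_def compact_Times)
  have K_iff: "(u, w) \<in> K" if "u \<in> {0..1}" "w \<in> {0..1}" for u w using that by (simp add: K_def)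
  note A = assms[unfolded boundary_Lax_pair_def C2_on_def deriv_flux]
  have F: "C1_on ent_dom F" "C1_on ent_dom (pd1 ent_dom F)" and Q: "C1_on ent_dom Q" "C1_on ent_dom (pd1 ent_dom Q)"
    using A[THEN conjunct1] A[THEN conjunct2, THEN conjunct1] by simp_all
  have "\<forall>u\<in>{0..1}. \<forall>w. (2 * p - 1) * (1 - 2 * u) * pd1 ent_dom F (u, w) = pd1 ent_dom Q (u, w)"
    using A by (elim conjE)
  note FQ_all = this
  have FQ: "(2 * p - 1) * (1 - 2 * u) * pd1 ent_dom F (u, w) = pd1 ent_dom Q (u, w)" if "u \<in> {0..1}" for u w
  proof -
    from FQ_all that have "\<forall>w. (2 * p - 1) * (1 - 2 * u) * pd1 ent_dom F (u, w) = pd1 ent_dom Q (u, w)"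
      by (rule bspec)
    then show ?thesis by (rule spec)
  qed
  have "\<forall>w\<in>{0..1}. F (w, w) = 0 \<and> Q (w, w) = 0 \<and> pd1 ent_dom F (w, w) = 0"
    using A by (elim conjE)
  then have diag: "F (w, w) = 0 \<and> Q (w, w) = 0 \<and> pd1 ent_dom F (w, w) = 0" if "w \<in> {0..1}" for w
    using that by (rule bspec)
  have cont: "continuous_on ent_dom f" "continuous_on ent_dom (pd1 ent_dom f)" "continuous_on ent_dom (pd2 ent_dom f)"
    if "C1_on ent_dom f" for f
    using that[unfolded C1_on_def] C1_on_continuous[OF that] by simp_all
  obtain B1 where B1: "B1 \<ge> 0" "\<And>z. z \<in> K \<Longrightarrow> \<bar>F z\<bar> \<le> B1" using continuous_on_compact_bound[OF cont(1)[OF F(1)] K] by blast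
  obtain B2 where B2: "B2 \<ge> 0" "\<And>z. z \<in> K \<Longrightarrow> \<bar>pd2 ent_dom F z\<bar> \<le> B2" using continuous_on_compact_bound[OF cont(3)[OF F(1)] K] by blast
  obtain B3 where B3: "B3 \<ge> 0" "\<And>z. z \<in> K \<Longrightarrow> \<bar>pd1 ent_dom F z\<bar> \<le> B3" using continuous_on_compact_bound[OF cont(2)[OF F(1)] K] by blast
  obtain B4 where B4: "B4 \<ge> 0" "\<And>z. z \<in> K \<Longrightarrow> \<bar>pd1 ent_dom (pd1 ent_dom F) z\<bar> \<le> B4" using continuous_on_compact_bound[OF cont(2)[OF F(2)] K] by blast
  obtain B5 where B5: "B5 \<ge> 0" "\<And>z. z \<in> K \<Longrightarrow> \<bar>Q z\<bar> \<le> B5" using continuous_on_compact_bound[OF cont(1)[OF Q(1)] K] by blast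
  obtain B6 where B6: "B6 \<ge> 0" "\<And>z. z \<in> K \<Longrightarrow> \<bar>pd1 ent_dom Q z\<bar> \<le> B6" using continuous_on_compact_bound[OF cont(2)[OF Q(1)] K] by blast
  obtain B7 where B7: "B7 \<ge> 0" "\<And>z. z \<in> K \<Longrightarrow> \<bar>pd1 ent_dom (pd1 ent_dom Q) z\<bar> \<le> B7" using continuous_on_compact_bound[OF cont(2)[OF Q(2)] K] by blast
  define C where "C = B1 + B2 + B3 + B4 + B5 + B6 + B7"
  have C: "B1 \<le> C" "B2 \<le> C" "B3 \<le> C" "B4 \<le> C" "B5 \<le> C" "B6 \<le> C" "B7 \<le> C" "C \<ge> 0"
    using B1(1) B2(1) B3(1) B4(1) B5(1) B6(1) B7(1) by (auto simp: C_def)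
  have d: "((\<lambda>u. f (u, w)) has_real_derivative pd1 ent_dom f (u, w)) (at u within {0..1})"
    if "C1_on ent_dom f" "u \<in> {0..1}" for f u w
  proof -
    have "f differentiable_on ent_dom" using that(1) by (simp add: C1_on_def)
    from has_real_derivative_along_curve[OF this DERIV_ident DERIV_const _ that(2), of w] show ?thesis
      by (simp add: ent_dom_def)
  qed
  have lip: "\<bar>f (v, w) - f (u, w)\<bar> \<le> B * \<bar>v - u\<bar>"
    if "C1_on ent_dom f" "\<And>z. z \<in> K \<Longrightarrow> \<bar>pd1 ent_dom f z\<bar> \<le> B" "u \<in> {0..1}" "v \<in> {0..1}" "w \<in> {0..1}" for f u v w B
  proof -
    have "norm (f (v, w) - f (u, w)) \<le> B * norm (v - u)"
    proof (rule field_differentiable_bound[where f="\<lambda>u. f (u, w)" and S="{0..1}"])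
      show "((\<lambda>u. f (u, w)) has_real_derivative pd1 ent_dom f (z, w)) (at z within {0..1})" if "z \<in> {0..1}" for z
        by (rule d[OF \<open>C1_on ent_dom f\<close> that])
      show "norm (pd1 ent_dom f (z, w)) \<le> B" if "z \<in> {0..1}" for z
        unfolding real_norm_def by (rule \<open>\<And>z. z \<in> K \<Longrightarrow> \<bar>pd1 ent_dom f z\<bar> \<le> B\<close>) (rule K_iff[OF that \<open>w \<in> {0..1}\<close>])
    qed (use that in simp_all)
    then show ?thesis by (simp only: real_norm_def)
  qed
  have up: "x \<le> C * y" if "x \<le> B * y" "B \<le> C" "y \<ge> 0" for x y B :: real
    using that mult_right_mono[of B C y] by linarith
  have b: "\<bar>F (u, w)\<bar> \<le> C" "\<bar>pd2 ent_dom F (u, w)\<bar> \<le> C" "\<bar>pd1 ent_dom F (u, w)\<bar> \<le> C" "\<bar>Q (u, w)\<bar> \<le> C"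
    if "u \<in> {0..1}" "w \<in> {0..1}" for u w
  proof -
    note uw = K_iff[OF that]
    show "\<bar>F (u, w)\<bar> \<le> C" by (rule order_trans[OF B1(2)[OF uw] C(1)])
    show "\<bar>pd2 ent_dom F (u, w)\<bar> \<le> C" by (rule order_trans[OF B2(2)[OF uw] C(2)])
    show "\<bar>pd1 ent_dom F (u, w)\<bar> \<le> C" by (rule order_trans[OF B3(2)[OF uw] C(3)])
    show "\<bar>Q (u, w)\<bar> \<le> C" by (rule order_trans[OF B5(2)[OF uw] C(5)])
  qed
  have w1: "\<bar>pd1 ent_dom F (u, w)\<bar> \<le> C * \<bar>u - w\<bar>" if "u \<in> {0..1}" "w \<in> {0..1}" for u w
  proof -
    have z: "pd1 ent_dom F (w, w) = 0" using diag[OF that(2)] by (elim conjE)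
    show ?thesis using up[OF lip[OF F(2) B4(2) that(2,1,2)] C(4)] unfolding z by simp
  qed
  have w2: "\<bar>Q (u, w)\<bar> \<le> C * \<bar>u - w\<bar>" if "u \<in> {0..1}" "w \<in> {0..1}" for u w
  proof -
    have z: "Q (w, w) = 0" using diag[OF that(2)] by (elim conjE)
    show ?thesis using up[OF lip[OF Q(1) B6(2) that(2,1,2)] C(6)] unfolding z by simp
  qed
  have l1: "\<bar>pd1 ent_dom F (v, w) - pd1 ent_dom F (u, w)\<bar> \<le> C * \<bar>v - u\<bar>"
    if "u \<in> {0..1}" "v \<in> {0..1}" "w \<in> {0..1}" for u v w
    by (rule up[OF lip[OF F(2) B4(2) that] C(4)]) simp_all
  have t1: "\<bar>F (v, w) - F (u, w) - pd1 ent_dom F (u, w) * (v - u)\<bar> \<le> C * (v - u)\<^sup>2"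
    if "u \<in> {0..1}" "v \<in> {0..1}" "w \<in> {0..1}" for u v w
  proof -
    have "\<bar>F (v, w) - F (u, w) - pd1 ent_dom F (u, w) * (v - u)\<bar> \<le> B4 * (v - u)\<^sup>2"
    proof (rule taylor_lipschitz[where f="\<lambda>u. F (u, w)" and f'="\<lambda>u. pd1 ent_dom F (u, w)"])
      show "((\<lambda>u. F (u, w)) has_real_derivative pd1 ent_dom F (x, w)) (at x within {0..1})" if "x \<in> {0..1}" for x
        by (rule d[OF F(1) that])
      show "\<bar>pd1 ent_dom F (y, w) - pd1 ent_dom F (x, w)\<bar> \<le> B4 * \<bar>y - x\<bar>" if "x \<in> {0..1}" "y \<in> {0..1}" for x y
        by (rule lip[OF F(2) B4(2) that \<open>w \<in> {0..1}\<close>])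
    qed (use that B4(1) in simp_all)
    then show ?thesis by (rule up[OF _ C(4)]) simp
  qed
  have t2: "\<bar>Q (v, w) - Q (u, w) - (2 * p - 1) * (1 - 2 * u) * pd1 ent_dom F (u, w) * (v - u)\<bar> \<le> C * (v - u)\<^sup>2"
    if "u \<in> {0..1}" "v \<in> {0..1}" "w \<in> {0..1}" for u v w
  proof -
    have "\<bar>Q (v, w) - Q (u, w) - pd1 ent_dom Q (u, w) * (v - u)\<bar> \<le> B7 * (v - u)\<^sup>2"
    proof (rule taylor_lipschitz[where f="\<lambda>u. Q (u, w)" and f'="\<lambda>u. pd1 ent_dom Q (u, w)"])
      show "((\<lambda>u. Q (u, w)) has_real_derivative pd1 ent_dom Q (x, w)) (at x within {0..1})" if "x \<in> {0..1}" for x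
        by (rule d[OF Q(1) that])
      show "\<bar>pd1 ent_dom Q (y, w) - pd1 ent_dom Q (x, w)\<bar> \<le> B7 * \<bar>y - x\<bar>" if "x \<in> {0..1}" "y \<in> {0..1}" for x y
        by (rule lip[OF Q(2) B7(2) that \<open>w \<in> {0..1}\<close>])
    qed (use that B7(1) in simp_all)
    then show ?thesis unfolding FQ[OF that(1)] by (rule up[OF _ C(7)]) simp
  qed
  have "Lax_bound p F Q C"
    unfolding Lax_bound_def
  proof (intro conjI ballI)
    show "0 \<le> C" by (rule C(8))
    fix u w :: real assume uw: "u \<in> {0..1}" "w \<in> {0..1}"
    show "\<bar>F (u, w)\<bar> \<le> C" "\<bar>pd2 ent_dom F (u, w)\<bar> \<le> C" "\<bar>pd1 ent_dom F (u, w)\<bar> \<le> C" "\<bar>Q (u, w)\<bar> \<le> C"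
      by (rule b[OF uw])+
    show "\<bar>pd1 ent_dom F (u, w)\<bar> \<le> C * \<bar>u - w\<bar>" by (rule w1[OF uw])
    show "\<bar>Q (u, w)\<bar> \<le> C * \<bar>u - w\<bar>" by (rule w2[OF uw])
    fix v :: real assume v: "v \<in> {0..1}"
    show "\<bar>pd1 ent_dom F (v, w) - pd1 ent_dom F (u, w)\<bar> \<le> C * \<bar>v - u\<bar>" by (rule l1[OF uw(1) v uw(2)])
    show "\<bar>F (v, w) - F (u, w) - pd1 ent_dom F (u, w) * (v - u)\<bar> \<le> C * (v - u)\<^sup>2" by (rule t1[OF uw(1) v uw(2)])
    show "\<bar>Q (v, w) - Q (u, w) - (2 * p - 1) * (1 - 2 * u) * pd1 ent_dom F (u, w) * (v - u)\<bar> \<le> C * (v - u)\<^sup>2"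
      by (rule t2[OF uw(1) v uw(2)])
  qed
  then show ?thesis ..
qed

lemma entropy_has_real_derivative:
  assumes "boundary_Lax_pair p F Q" "(\<rho> has_real_derivative r) (at t within I)" "t \<in> I" "u \<in> {0..1}"
  shows "((\<lambda>t. F (u, \<rho> t)) has_real_derivative r * pd2 ent_dom F (u, \<rho> t)) (at t within I)"
proof -
  have "C2_on ent_dom F" using assms(1) unfolding boundary_Lax_pair_def by (elim conjE)
  then have F: "F differentiable_on ent_dom" by (simp add: C2_on_def C1_on_def)
  have "((\<lambda>t. F (u, \<rho> t)) has_real_derivative 0 * pd1 ent_dom F (u, \<rho> t) + r * pd2 ent_dom F (u, \<rho> t)) (at t within I)"
    by (rule has_real_derivative_along_curve[OF F DERIV_const assms(2) _ assms(3)])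
       (use assms(4) in \<open>simp add: ent_dom_def\<close>)
  then show ?thesis by simp
qed

text \<open>Compactness keeps \<open>\<rho>\<close> at a positive distance \<open>c\<close> from
  \<open>0\<close> and \<open>1\<close>, on which the bounds for the logarithm of the Bernoulli
  weights and its time derivative rest.\<close>

lemma C1_interval_bounds:
  assumes T: "T > 0" and \<rho>: "C1_interval 0 T \<rho>" and pos: "\<And>t. t \<in> {0..T} \<Longrightarrow> \<rho> t \<in> {0<..<1}"
  obtains c R where "0 < c" "\<And>t. t \<in> {0..T} \<Longrightarrow> c \<le> \<rho> t" "\<And>t. t \<in> {0..T} \<Longrightarrow> \<rho> t \<le> 1 - c" "R \<ge> 0"
    "\<And>t. t \<in> {0..T} \<Longrightarrow> \<bar>vector_derivative \<rho> (at t within {0..T})\<bar> \<le> R"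
    "\<And>t. t \<in> {0..T} \<Longrightarrow> (\<rho> has_real_derivative vector_derivative \<rho> (at t within {0..T})) (at t within {0..T})"
proof -
  have diff: "\<rho> differentiable_on {0..T}" and cd: "continuous_on {0..T} (\<lambda>t. vector_derivative \<rho> (at t within {0..T}))"
    using \<rho> by (auto simp: C1_interval_def)
  have cr: "continuous_on {0..T} \<rho>" by (rule differentiable_imp_continuous_on[OF diff])
  have d: "(\<rho> has_real_derivative vector_derivative \<rho> (at t within {0..T})) (at t within {0..T})" if "t \<in> {0..T}" for t
    using diff that by (simp add: differentiable_on_def has_real_derivative_iff_has_vector_derivative vector_derivative_works)
  have ne: "{0..T} \<noteq> {}" using T by auto
  obtain t1 where t1: "t1 \<in> {0..T}" "\<And>t. t \<in> {0..T} \<Longrightarrow> \<rho> t1 \<le> \<rho> t"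
    using continuous_attains_inf[OF compact_Icc ne cr] by auto
  obtain t2 where t2: "t2 \<in> {0..T}" "\<And>t. t \<in> {0..T} \<Longrightarrow> \<rho> t \<le> \<rho> t2"
    using continuous_attains_sup[OF compact_Icc ne cr] by auto
  obtain R where R: "R \<ge> 0" "\<And>t. t \<in> {0..T} \<Longrightarrow> \<bar>vector_derivative \<rho> (at t within {0..T})\<bar> \<le> R"
    using continuous_on_compact_bound[OF cd compact_Icc order_refl] by blast
  have c: "0 < min (\<rho> t1) (1 - \<rho> t2)" using pos[OF t1(1)] pos[OF t2(1)] by auto
  have "min (\<rho> t1) (1 - \<rho> t2) \<le> \<rho> t" if "t \<in> {0..T}" for t using t1(2)[OF that] by simp
  moreover have "\<rho> t \<le> 1 - min (\<rho> t1) (1 - \<rho> t2)" if "t \<in> {0..T}" for t using t2(2)[OF that] by linarith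
  ultimately show thesis by (rule that[OF c _ _ R d])
qed

lemma C1_on_space_time:
  assumes T: "T > 0" and \<psi>: "C1_on (space_time T) \<psi>"
  obtains C where "C \<ge> 0" "\<And>x t. x \<in> {0..1} \<Longrightarrow> t \<in> {0..T} \<Longrightarrow> \<bar>\<psi> (x, t)\<bar> \<le> C"
    "\<And>x t. x \<in> {0..1} \<Longrightarrow> t \<in> {0..T} \<Longrightarrow> \<bar>pd1 (space_time T) \<psi> (x, t)\<bar> \<le> C"
    "\<And>x t. x \<in> {0..1} \<Longrightarrow> t \<in> {0..T} \<Longrightarrow> \<bar>pd2 (space_time T) \<psi> (x, t)\<bar> \<le> C"
    "\<And>x t. x \<in> {0..1} \<Longrightarrow> t \<in> {0..T} \<Longrightarrow> ((\<lambda>x. \<psi> (x, t)) has_real_derivative pd1 (space_time T) \<psi> (x, t)) (at x within {0..1})"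
    "\<And>x t. x \<in> {0..1} \<Longrightarrow> t \<in> {0..T} \<Longrightarrow> ((\<lambda>t. \<psi> (x, t)) has_real_derivative pd2 (space_time T) \<psi> (x, t)) (at t within {0..T})"
    "\<And>t. t \<in> {0..T} \<Longrightarrow> continuous_on {0..1} (\<lambda>x. pd1 (space_time T) \<psi> (x, t))"
proof -
  let ?S = "space_time T"
  have S: "compact ?S" by (auto simp: space_time_def compact_Times)
  have c: "continuous_on ?S \<psi>" "continuous_on ?S (pd1 ?S \<psi>)" "continuous_on ?S (pd2 ?S \<psi>)"
    using \<psi> C1_on_continuous[OF \<psi>] by (auto simp: C1_on_def)
  obtain B1 where B1: "B1 \<ge> 0" "\<And>z. z \<in> ?S \<Longrightarrow> \<bar>\<psi> z\<bar> \<le> B1" using continuous_on_compact_bound[OF c(1) S order_refl] by blast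
  obtain B2 where B2: "B2 \<ge> 0" "\<And>z. z \<in> ?S \<Longrightarrow> \<bar>pd1 ?S \<psi> z\<bar> \<le> B2" using continuous_on_compact_bound[OF c(2) S order_refl] by blast
  obtain B3 where B3: "B3 \<ge> 0" "\<And>z. z \<in> ?S \<Longrightarrow> \<bar>pd2 ?S \<psi> z\<bar> \<le> B3" using continuous_on_compact_bound[OF c(3) S order_refl] by blast
  define C where "C = B1 + B2 + B3"
  have le: "B1 \<le> C" "B2 \<le> C" "B3 \<le> C" "0 \<le> C" using B1(1) B2(1) B3(1) by (simp_all add: C_def)
  have S_iff: "(x, t) \<in> ?S" if "x \<in> {0..1}" "t \<in> {0..T}" for x t
    using that by (simp add: space_time_def)
  have diff: "\<psi> differentiable_on ?S" using \<psi> by (simp add: C1_on_def)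
  have b: "\<bar>\<psi> (x, t)\<bar> \<le> C" "\<bar>pd1 ?S \<psi> (x, t)\<bar> \<le> C" "\<bar>pd2 ?S \<psi> (x, t)\<bar> \<le> C"
    if "x \<in> {0..1}" "t \<in> {0..T}" for x t
    using order_trans[OF B1(2)[OF S_iff[OF that]] le(1)] order_trans[OF B2(2)[OF S_iff[OF that]] le(2)]
      order_trans[OF B3(2)[OF S_iff[OF that]] le(3)] by auto
  have d1: "((\<lambda>x. \<psi> (x, t)) has_real_derivative pd1 ?S \<psi> (x, t)) (at x within {0..1})"
    if "x \<in> {0..1}" "t \<in> {0..T}" for x t
    using has_real_derivative_along_curve[OF diff DERIV_ident DERIV_const, of "{0..1}" t x] S_iff that by simp
  have d2: "((\<lambda>t. \<psi> (x, t)) has_real_derivative pd2 ?S \<psi> (x, t)) (at t within {0..T})"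
    if "x \<in> {0..1}" "t \<in> {0..T}" for x t
    using has_real_derivative_along_curve[OF diff DERIV_const DERIV_ident, of "{0..T}" x t] S_iff that by simp
  have cx: "continuous_on {0..1} (\<lambda>x. pd1 ?S \<psi> (x, t))" if "t \<in> {0..T}" for t
  proof (rule continuous_on_compose2[OF c(2)])
    show "continuous_on {0..1} (\<lambda>x. (x, t))" by (intro continuous_on_Pair continuous_on_id continuous_on_const)
    show "(\<lambda>x. (x, t)) ` {0..1} \<subseteq> ?S" using S_iff that by blast
  qed
  show thesis by (rule that[OF le(4) b(1) b(2) b(3) d1 d2 cx])
qed

section \<open>Expected entropy production\<close>

lemma totalD_parts:
  assumes "0 < w" "w < 1" "1 \<le> N"
  shows "(\<Sum>l\<in>{1..<N}. swapD N m l (Suc l)) \<le> totalD w N m" "0 \<le> totalD w N m"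
    "\<And>s. s = 1 \<or> s = N \<Longrightarrow> (\<Sum>l\<in>{1..<N}. swapD N m l (Suc l)) + flipD w N m s \<le> totalD w N m"
proof -
  let ?D = "\<Sum>l\<in>{1..<N}. swapD N m l (Suc l)"
  have f: "flipD w N m 1 \<ge> 0" "flipD w N m N \<ge> 0"
    by (rule flipD_nonneg[OF assms(1,2)]; use assms(3) in simp)+
  have D: "0 \<le> ?D" by (intro sum_nonneg swapD_nonneg)
  show "?D \<le> totalD w N m" "0 \<le> totalD w N m" unfolding totalD_def using f D by linarith+
  show "?D + flipD w N m s \<le> totalD w N m" if "s = 1 \<or> s = N" for s
    using that unfolding totalD_def
  proof
    assume "s = 1"
    then show "?D + flipD w N m s \<le> ?D + flipD w N m 1 + flipD w N m N" using f(2) by simp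
  next
    assume "s = N"
    then show "?D + flipD w N m s \<le> ?D + flipD w N m 1 + flipD w N m N" using f(1) by simp
  qed
qed

text \<open>The two variance bounds add up to \<open>64 K\<close> times \<open>blockD\<close> plus
  \<open>186/K\<close> per block. Summation over the blocks multiplies the Dirichlet form by at most
  \<open>2K\<close>, and the prefactor \<open>1/K\<close> of \<open>fluctuation\<close> reduces this
  to \<open>128 K\<close>; the at most \<open>N\<close> remainders become
  \<open>186 N/K^2\<close>.\<close>

lemma fluctuation_average:
  assumes K: "1 \<le> K" "2 * K < N" and w: "0 < w" "w < 1"
    and m: "\<And>x. x \<in> configs N \<Longrightarrow> m x \<ge> 0" "(\<Sum>x\<in>configs N. m x) = 1"
  shows "(\<Sum>x\<in>configs N. m x * fluctuation N K x) \<le> 128 * real K * totalD w N m + 186 * (real N / (real K)\<^sup>2)"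
proof -
  have N: "1 \<le> N" using K by simp
  let ?D = "\<Sum>l\<in>{1..<N}. swapD N m l (Suc l)"
  let ?c = "\<lambda>i x. real K * (wavg N K (Suc i) x - wavg N K i x)"
  have "(\<Sum>x\<in>configs N. m x * fluctuation N K x)
     = (\<Sum>x\<in>configs N. \<Sum>i\<in>{K..N-K}. m x * (wdefect N K i x)\<^sup>2 + m x * (?c i x)\<^sup>2) / real K"
    unfolding fluctuation_def by (simp only: sum_divide_distrib sum_distrib_left distrib_left add_divide_distrib times_divide_eq_right)
  also have "\<dots> = (\<Sum>i\<in>{K..N-K}. \<Sum>x\<in>configs N. m x * (wdefect N K i x)\<^sup>2 + m x * (?c i x)\<^sup>2) / real K"
    by (rule arg_cong[OF sum.swap])
  also have "\<dots> = (\<Sum>i\<in>{K..N-K}. (\<Sum>x\<in>configs N. m x * (wdefect N K i x)\<^sup>2) + (\<Sum>x\<in>configs N. m x * (?c i x)\<^sup>2)) / real K"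
    by (simp only: sum.distrib)
  also have "\<dots> \<le> (\<Sum>i\<in>{K..N-K}. 64 * real K * blockD N K i m + 186 / real K) / real K"
  proof (intro divide_right_mono sum_mono)
    fix i assume "i \<in> {K..N-K}"
    then have i: "K \<le> i" "i + K \<le> N" using K by auto
    show "(\<Sum>x\<in>configs N. m x * (wdefect N K i x)\<^sup>2) + (\<Sum>x\<in>configs N. m x * (?c i x)\<^sup>2) \<le> 64 * real K * blockD N K i m + 186 / real K"
      using wdefect_variance[OF K(1) i m] gradient_variance[OF K(1) i m] by (simp add: add_divide_distrib[symmetric])
  qed simp
  also have "\<dots> = (64 * real K * (\<Sum>i\<in>{K..N-K}. blockD N K i m) + real (card {K..N-K}) * (186 / real K)) / real K"
    by (simp add: sum.distrib sum_distrib_left)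
  also have "\<dots> \<le> (64 * real K * (2 * real K * ?D) + real N * (186 / real K)) / real K"
    by (intro divide_right_mono add_mono mult_left_mono mult_right_mono sum_blockD K(1)) (use K in auto)
  also have "\<dots> = 128 * real K * ?D + 186 * (real N / (real K)\<^sup>2)"
    using K by (simp add: add_divide_distrib power2_eq_square)
  also have "\<dots> \<le> 128 * real K * totalD w N m + 186 * (real N / (real K)\<^sup>2)"
    by (intro add_mono mult_left_mono totalD_parts(1) w N) auto
  finally show ?thesis .
qed

text \<open>The two extreme blocks contain a boundary site, \<open>1\<close> or \<open>N\<close>,
  where the flip part of \<open>totalD\<close> is available. Its coefficient \<open>4\<close> is
  enlarged to a multiple of \<open>K\<close> so that one constant serves exchanges and
  flips.\<close>

lemma boundary_average:
  assumes K: "1 \<le> K" "2 * K < N" and w: "0 < w" "w < 1" and i: "i = K \<or> i = N - K"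
    and m: "\<And>x. x \<in> configs N \<Longrightarrow> m x \<ge> 0" "(\<Sum>x\<in>configs N. m x) = 1"
  shows "(\<Sum>x\<in>configs N. m x * (wavg N K i x - w)\<^sup>2) \<le> 36 * real K * totalD w N m + 24 / real K"
proof -
  have N: "1 \<le> N" using K by simp
  define s where "s = (if i = K then 1 else N)"
  have s: "s = 1 \<or> s = N" "s \<in> {Suc i-K..i+K}" and iK: "K \<le> i" "i + K \<le> N"
    using i K by (auto simp: s_def)
  let ?D = "\<Sum>l\<in>{1..<N}. swapD N m l (Suc l)"
  have bD: "blockD N K i m \<le> ?D"
    unfolding blockD_def by (rule sum_mono2) (use iK swapD_nonneg in auto)
  have f0: "0 \<le> flipD w N m s" by (rule flipD_nonneg[OF w]) (use s N in auto)
  have "(\<Sum>x\<in>configs N. m x * (wavg N K i x - w)\<^sup>2) \<le> 32 * real K * blockD N K i m + 4 * flipD w N m s + 24 / real K"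
    by (rule boundary_variance[OF K(1) iK s(2) w m])
  also have "\<dots> \<le> 36 * real K * ?D + 36 * real K * flipD w N m s + 24 / real K"
  proof (intro add_mono order_refl)
    show "32 * real K * blockD N K i m \<le> 36 * real K * ?D"
      by (intro mult_mono bD blockD_nonneg) auto
    show "4 * flipD w N m s \<le> 36 * real K * flipD w N m s"
      by (intro mult_right_mono f0) (use K in auto)
  qed
  also have "\<dots> = 36 * real K * (?D + flipD w N m s) + 24 / real K" by (simp add: distrib_left)
  also have "\<dots> \<le> 36 * real K * totalD w N m + 24 / real K"
    by (intro add_mono mult_left_mono totalD_parts(3) w N s(1)) auto
  finally show ?thesis .
qed

lemma flux_error_nonneg: "flux_error N K w x \<ge> 0"
  unfolding flux_error_def by (intro add_nonneg_nonneg fluctuation_nonneg) auto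

text \<open>A substitute for Cauchy-Schwarz: the bound is linear in the second moment, so it can be
  averaged over configurations and integrated in time without square roots.\<close>

lemma abs_le_square: "0 < \<delta> \<Longrightarrow> \<bar>v\<bar> \<le> \<delta> + v\<^sup>2 / \<delta>" for v \<delta> :: real
proof -
  assume d: "0 < \<delta>"
  have "0 \<le> (\<bar>v\<bar> - \<delta>)\<^sup>2 + \<bar>v\<bar> * \<delta>" using d by simp
  then have "\<bar>v\<bar> * \<delta> \<le> \<delta>\<^sup>2 + v\<^sup>2" by (simp add: power2_diff ac_simps)
  then have "\<bar>v\<bar> \<le> (\<delta>\<^sup>2 + v\<^sup>2) / \<delta>" using d by (simp add: pos_le_divide_eq)
  then show ?thesis using d by (simp add: add_divide_distrib power2_eq_square)
qed

text \<open>Both \<open>1/K\<close> and \<open>N/K^3\<close> are at most \<open>N/K^2\<close>, so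
  three quantities suffice. Only the deviations of the two end blocks from \<open>w\<close> occur
  linearly; each is converted into a second moment at the price of one
  \<open>\<delta>\<close>.\<close>

lemma flux_error_average:
  assumes K: "1 \<le> K" "2 * K < N" and w: "0 < w" "w < 1" and \<delta>: "0 < \<delta>" "\<delta> \<le> 1"
    and m: "\<And>x. x \<in> configs N \<Longrightarrow> m x \<ge> 0" "(\<Sum>x\<in>configs N. m x) = 1"
  shows "(\<Sum>x\<in>configs N. m x * flux_error N K w x)
    \<le> 2 * \<delta> + 240 / \<delta> * (real K / real N + real N / (real K)\<^sup>2 + real K * totalD w N m)"
proof -
  have N: "1 \<le> N" using K by simp
  let ?a = "real K / real N" and ?b = "real N / (real K)\<^sup>2" and ?d = "real K * totalD w N m"
  have a0: "0 \<le> ?a" and b0: "0 \<le> ?b" and d0: "0 \<le> ?d" using totalD_parts(2)[OF w N] by auto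
  have k1: "1 / real K \<le> ?b"
  proof -
    have "real K / (real K)\<^sup>2 \<le> ?b" using K by (intro divide_right_mono) auto
    then show ?thesis using K by (simp add: power2_eq_square)
  qed
  have k3: "real N / (real K)^3 \<le> ?b"
    using K by (intro divide_left_mono power_increasing) auto
  have bd: "(\<Sum>x\<in>configs N. m x * \<bar>wavg N K i x - w\<bar>) \<le> \<delta> + (36 * ?d + 24 * ?b) / \<delta>"
    if "i = K \<or> i = N - K" for i
  proof -
    have "(\<Sum>x\<in>configs N. m x * \<bar>wavg N K i x - w\<bar>) \<le> (\<Sum>x\<in>configs N. m x * (\<delta> + (wavg N K i x - w)\<^sup>2 / \<delta>))"
      by (intro sum_mono mult_left_mono abs_le_square \<delta> m)
    also have "\<dots> = (\<Sum>x\<in>configs N. m x) * \<delta> + (\<Sum>x\<in>configs N. m x * (wavg N K i x - w)\<^sup>2) / \<delta>"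
      by (simp add: distrib_left sum.distrib sum_distrib_right sum_divide_distrib)
    also have "\<dots> \<le> \<delta> + (36 * ?d + 24 * ?b) / \<delta>"
      unfolding m(2) mult_1
      using boundary_average[OF K w that m] k1 \<delta> by (intro add_mono divide_right_mono order_refl) auto
    finally show ?thesis .
  qed
  have "(\<Sum>x\<in>configs N. m x * flux_error N K w x)
     = (\<Sum>x\<in>configs N. m x) * (?a + 1 / real K + real N / (real K)^3) + (\<Sum>x\<in>configs N. m x * fluctuation N K x)
       + (\<Sum>x\<in>configs N. m x * \<bar>wavg N K K x - w\<bar>) + (\<Sum>x\<in>configs N. m x * \<bar>wavg N K (N - K) x - w\<bar>)"
    unfolding flux_error_def sum_distrib_right sum.distrib[symmetric]
    by (intro sum.cong refl) (simp only: distrib_left)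
  also have "\<dots> \<le> (?a + ?b + ?b) + (128 * ?d + 186 * ?b)
     + (\<delta> + (36 * ?d + 24 * ?b) / \<delta>) + (\<delta> + (36 * ?d + 24 * ?b) / \<delta>)"
    unfolding m(2) mult_1
    using fluctuation_average[OF K w m] k1 k3 by (intro add_mono bd) (simp_all add: mult.assoc)
  also have "\<dots> = 2 * \<delta> + (?a + 188 * ?b + 128 * ?d) + (72 * ?d + 48 * ?b) / \<delta>"
    by (simp add: add_divide_distrib)
  \<comment> \<open>For \<open>\<delta> <= 1\<close> the terms free of \<open>\<delta>\<close> may
    be divided by it; this keeps a single error expression with one constant.\<close>
  also have "\<dots> \<le> 2 * \<delta> + (?a + 188 * ?b + 128 * ?d) / \<delta> + (72 * ?d + 48 * ?b) / \<delta>"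
  proof -
    have "y \<le> y / \<delta>" if "0 \<le> y" for y using that \<delta> by (simp add: pos_le_divide_eq mult_left_le)
    from this[of "?a + 188 * ?b + 128 * ?d"] show ?thesis using a0 b0 d0 by simp
  qed
  also have "\<dots> = 2 * \<delta> + (?a + 236 * ?b + 200 * ?d) / \<delta>"
    by (simp add: add_divide_distrib)
  also have "\<dots> \<le> 2 * \<delta> + (240 * (?a + ?b + ?d)) / \<delta>"
  proof (intro add_mono divide_right_mono order_refl)
    have "x + 236 * y + 200 * z \<le> 240 * (x + y + z)" if "0 \<le> x" "0 \<le> y" "0 \<le> z" for x y z :: real
      using that by simp
    from this[OF a0 b0 d0] show "?a + 236 * ?b + 200 * ?d \<le> 240 * (?a + ?b + ?d)" .
  qed (use \<delta> in simp)
  finally show ?thesis by simp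
qed

lemma wavg_flip_boundary:
  assumes "K < i" "i + K \<le> N" "s = 1 \<or> s = N"
  shows "wavg N K i (flip x s) = wavg N K i x"
  unfolding wavg_def
proof (intro sum.cong refl)
  fix k assume "k \<in> {1..N}"
  have "wt K i s = 0" by (rule wt_zero) (use assms in auto)
  then show "wt K i k * flip x s k = wt K i k * x k" by (cases "k = s") auto
qed

text \<open>Blocks with \<open>K < i\<close> and \<open>i + K <= N\<close> give weight
  \<open>0\<close> to the sites \<open>1\<close> and \<open>N\<close>, so the boundary generators do
  not act on such functions. The reservoirs are felt through the Dirichlet form, which ties the two
  end blocks to the boundary density.\<close>

lemma L_gen_block_sum:
  assumes I: "\<And>i. i \<in> I \<Longrightarrow> K < i \<and> i + K \<le> N"
  shows "L_gen p \<rho>l \<rho>r N t (\<lambda>\<xi>. \<Sum>i\<in>I. s i * F (wavg N K i \<xi>)) \<eta> = (\<Sum>i\<in>I. s i * L_exc p N (\<lambda>\<xi>. F (wavg N K i \<xi>)) \<eta>)"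
proof -
  have f: "(\<Sum>i\<in>I. s i * F (wavg N K i (flip \<eta> k))) = (\<Sum>i\<in>I. s i * F (wavg N K i \<eta>))" if "k = 1 \<or> k = N" for k
    by (intro sum.cong refl) (use wavg_flip_boundary I that in metis)
  have "L_exc p N (\<lambda>\<xi>. \<Sum>i\<in>I. s i * F (wavg N K i \<xi>)) \<eta> = (\<Sum>i\<in>I. s i * L_exc p N (\<lambda>\<xi>. F (wavg N K i \<xi>)) \<eta>)"
    unfolding L_exc_def sum_subtractf[symmetric] right_diff_distrib[symmetric] sum_distrib_left
    by (subst sum.swap) (intro sum.cong refl, simp only: mult.left_commute)
  then show ?thesis by (simp add: L_gen_def L_left_def L_right_def f Let_def)
qed

lemma Lax_boundD:
  assumes "Lax_bound p F Q C"
  shows "0 \<le> C"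
    and "u \<in> {0..1} \<Longrightarrow> w \<in> {0..1} \<Longrightarrow> \<bar>F (u, w)\<bar> \<le> C"
    and "u \<in> {0..1} \<Longrightarrow> w \<in> {0..1} \<Longrightarrow> \<bar>pd2 ent_dom F (u, w)\<bar> \<le> C"
    and "u \<in> {0..1} \<Longrightarrow> w \<in> {0..1} \<Longrightarrow> \<bar>pd1 ent_dom F (u, w)\<bar> \<le> C"
    and "u \<in> {0..1} \<Longrightarrow> w \<in> {0..1} \<Longrightarrow> \<bar>Q (u, w)\<bar> \<le> C"
    and "u \<in> {0..1} \<Longrightarrow> w \<in> {0..1} \<Longrightarrow> \<bar>pd1 ent_dom F (u, w)\<bar> \<le> C * \<bar>u - w\<bar>"
    and "u \<in> {0..1} \<Longrightarrow> w \<in> {0..1} \<Longrightarrow> \<bar>Q (u, w)\<bar> \<le> C * \<bar>u - w\<bar>"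
    and "u \<in> {0..1} \<Longrightarrow> v \<in> {0..1} \<Longrightarrow> w \<in> {0..1} \<Longrightarrow>
      \<bar>pd1 ent_dom F (v, w) - pd1 ent_dom F (u, w)\<bar> \<le> C * \<bar>v - u\<bar>"
    and "u \<in> {0..1} \<Longrightarrow> v \<in> {0..1} \<Longrightarrow> w \<in> {0..1} \<Longrightarrow>
      \<bar>F (v, w) - F (u, w) - pd1 ent_dom F (u, w) * (v - u)\<bar> \<le> C * (v - u)\<^sup>2"
    and "u \<in> {0..1} \<Longrightarrow> v \<in> {0..1} \<Longrightarrow> w \<in> {0..1} \<Longrightarrow>
      \<bar>Q (v, w) - Q (u, w) - (2 * p - 1) * (1 - 2 * u) * pd1 ent_dom F (u, w) * (v - u)\<bar> \<le> C * (v - u)\<^sup>2"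
  using assms unfolding Lax_bound_def by (simp, simp del: atLeastAtMost_iff, simp del: atLeastAtMost_iff,
    simp del: atLeastAtMost_iff, simp del: atLeastAtMost_iff, simp del: atLeastAtMost_iff, simp del: atLeastAtMost_iff,
    simp del: atLeastAtMost_iff, simp del: atLeastAtMost_iff, simp del: atLeastAtMost_iff)

text \<open>No integrability of \<open>g\<close> is assumed: a non-integrable function has integral
  \<open>0\<close> by convention, and the bound holds all the same. This spares a proof of joint
  measurability in space and time along a path.\<close>

lemma abs_integral_le_measure:
  fixes g :: "'a \<Rightarrow> real"
  assumes S: "S \<in> sets M" "emeasure M S < \<infinity>" and g: "\<And>z. z \<in> S \<Longrightarrow> \<bar>g z\<bar> \<le> C" and C: "C \<ge> 0"
  shows "\<bar>LINT z:S|M. g z\<bar> \<le> C * measure M S"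
proof -
  have int: "integrable M (\<lambda>z. C * indicator S z)"
    by (intro integrable_mult_right integrable_real_indicator S)
  have "\<bar>LINT z:S|M. g z\<bar> \<le> (\<integral>z. \<bar>indicator S z *\<^sub>R g z\<bar> \<partial>M)"
    unfolding set_lebesgue_integral_def by (rule integral_abs_bound)
  also have "\<dots> \<le> (\<integral>z. C * indicator S z \<partial>M)"
    by (rule integral_mono'[OF int]) (use g C in \<open>auto simp: indicator_def\<close>)
  also have "\<dots> = C * measure M S" using S by simp
  finally show ?thesis .
qed

lemma space_time_lborel:
  assumes "T > 0"
  shows "space_time T \<in> sets lborel" "emeasure lborel (space_time T) < \<infinity>" "measure lborel (space_time T) = T"
proof -
  have e: "emeasure lborel (space_time T) = ennreal T"
  proof -
    have "emeasure lborel (space_time T) = emeasure (lborel \<Otimes>\<^sub>M lborel) ({0..1::real} \<times> {0..T})"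
      by (simp only: space_time_def lborel_prod)
    also have "\<dots> = emeasure lborel {0..1::real} * emeasure lborel {0..T}"
      by (rule lborel.emeasure_pair_measure_Times) auto
    finally show ?thesis using assms by simp
  qed
  show "space_time T \<in> sets lborel"
    unfolding space_time_def sets_lborel by (intro borel_closed closed_Times closed_atLeastAtMost)
  show "emeasure lborel (space_time T) < \<infinity>" unfolding e by simp
  show "measure lborel (space_time T) = T" using assms e by (simp add: measure_def)
qed

lemma (in finite_markov_process) time_integral_continuous:
  assumes "continuous_on {0..T} h"
  shows "integrable time h" "(\<integral>t. h t \<partial>time) = integral {0..T} (h :: real \<Rightarrow> real)"
proof -
  have "set_integrable lborel {0..T} h" by (rule borel_integrable_atLeastAtMost'[OF assms])
  then show "integrable time h"
    by (subst integrable_restrict_space) (auto simp: set_integrable_def)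
  have "(\<integral>t. h t \<partial>time) = (LINT t:{0..T}|lborel. h t)"
    by (subst integral_restrict_space) (auto simp: set_lebesgue_integral_def)
  also have "\<dots> = integral {0..T} h"
    by (rule set_borel_integral_eq_integral(2)[OF borel_integrable_atLeastAtMost'[OF assms]])
  finally show "(\<integral>t. h t \<partial>time) = integral {0..T} h" .
qed

lemma (in finite_markov_process) continuous_time_measurable:
  assumes "continuous_on {0..T} h"
  shows "(h :: real \<Rightarrow> real) \<in> borel_measurable time"
  using time_integral_continuous(1)[OF assms] by (rule borel_measurable_integrable)

text \<open>If the space-time integral does not exist it is \<open>0\<close> by convention, and the bound is trivial;
  otherwise Fubini's theorem applies.\<close>

lemma iterated_space_time_integral:
  fixes f :: "real \<Rightarrow> real \<Rightarrow> real" and U e :: "real \<Rightarrow> real" and T :: real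
  defines "\<tau> \<equiv> restrict_space lborel {0..T}"
  assumes U: "integrable \<tau> U" and e: "integrable \<tau> e" and e0: "\<And>t. t \<in> {0..T} \<Longrightarrow> 0 \<le> e t"
    and near: "\<And>t. t \<in> {0..T} \<Longrightarrow> \<bar>(\<integral>x. indicator {0..1} x * f x t \<partial>lborel) - U t\<bar> \<le> e t"
  shows "\<bar>LINT z:space_time T|lborel. (case z of (x, t) \<Rightarrow> f x t)\<bar> \<le> \<bar>\<integral>t. U t \<partial>\<tau>\<bar> + (\<integral>t. e t \<partial>\<tau>)"
proof -
  let ?h = "\<lambda>x t. indicator {0..T} t * (indicator {0..1} x * f x t)"
  have sp: "space \<tau> = {0..T}" by (simp add: \<tau>_def space_restrict_space)
  have eint: "0 \<le> (\<integral>t. e t \<partial>\<tau>)" by (rule Bochner_Integration.integral_nonneg) (use e0 sp in simp)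
  have I: "(LINT z:space_time T|lborel. (case z of (x, t) \<Rightarrow> f x t)) = integral\<^sup>L (lborel \<Otimes>\<^sub>M lborel) (\<lambda>(x, t). ?h x t)"
    unfolding set_lebesgue_integral_def lborel_prod
    by (intro Bochner_Integration.integral_cong refl) (auto simp: space_time_def indicator_def)
  show ?thesis
  proof (cases "integrable (lborel \<Otimes>\<^sub>M lborel) (\<lambda>(x, t). ?h x t)")
    case False
    then show ?thesis unfolding I by (simp add: not_integrable_integral_eq eint)
  next
    case True
    define q where "q t = (\<integral>x. indicator {0..1} x * f x t \<partial>lborel)" for t
    have qe: "(\<integral>x. ?h x t \<partial>lborel) = indicator {0..T} t *\<^sub>R q t" for t
      by (simp add: q_def)
    have "integral\<^sup>L (lborel \<Otimes>\<^sub>M lborel) (\<lambda>(x, t). ?h x t) = (\<integral>t. indicator {0..T} t *\<^sub>R q t \<partial>lborel)"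
      using lborel_pair.integral_snd[OF True] by (simp only: qe)
    also have "\<dots> = (\<integral>t. q t \<partial>\<tau>)"
      unfolding \<tau>_def by (subst integral_restrict_space) auto
    finally have Iq: "(LINT z:space_time T|lborel. (case z of (x, t) \<Rightarrow> f x t)) = (\<integral>t. q t \<partial>\<tau>)"
      unfolding I .
    have "integrable lborel (\<lambda>t. indicator {0..T} t *\<^sub>R q t)"
      using lborel_pair.integrable_snd[OF True] by (simp only: qe)
    then have qint: "integrable \<tau> q"
      unfolding \<tau>_def by (subst integrable_restrict_space) auto
    have "(\<integral>t. q t \<partial>\<tau>) = (\<integral>t. U t \<partial>\<tau>) + (\<integral>t. q t - U t \<partial>\<tau>)"
      using qint U by simp
    moreover have "\<bar>\<integral>t. q t - U t \<partial>\<tau>\<bar> \<le> (\<integral>t. \<bar>q t - U t\<bar> \<partial>\<tau>)" by (rule integral_abs_bound)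
    moreover have "(\<integral>t. \<bar>q t - U t\<bar> \<partial>\<tau>) \<le> (\<integral>t. e t \<partial>\<tau>)"
      by (rule integral_mono) (use qint U e near[folded q_def] sp in auto)
    ultimately show ?thesis unfolding Iq by linarith
  qed
qed

text \<open>The three summands bound, in this order, the terms with prefactor \<open>N^-a\<close>,
  the time integral of \<open>U\<close>, and the flux error under the law of the process. The bound
  is explicit for fixed \<open>N\<close> and \<open>\<delta>\<close>, and one constant
  \<open>C\<close> serves the entropy pair and the test function.\<close>

lemma expected_entropy_production:
  fixes \<rho> \<rho>' :: "real \<Rightarrow> real" and F Q \<psi> :: "real \<times> real \<Rightarrow> real" and a p T :: real
  defines "\<Lambda> \<equiv> \<lambda>N. real N powr (1 + a)"
  assumes mp: "markov_process M (configs N) T (\<lambda>t f \<xi>. \<Lambda> N * L_gen p \<rho> \<rho> N t f \<xi>) \<mu> X"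
    and T: "T > 0" and p: "0 \<le> p" "p \<le> 1"
    and K: "1 \<le> K" "2 * K < N"
    and d\<rho>: "\<And>t. t \<in> {0..T} \<Longrightarrow> (\<rho> has_real_derivative \<rho>' t) (at t within {0..T})"
    and \<rho>': "\<And>t. t \<in> {0..T} \<Longrightarrow> vector_derivative \<rho> (at t within {0..T}) = \<rho>' t"
    and c: "0 < c" "\<And>t. t \<in> {0..T} \<Longrightarrow> c \<le> \<rho> t" "\<And>t. t \<in> {0..T} \<Longrightarrow> \<rho> t \<le> 1 - c"
    and R: "\<And>t. t \<in> {0..T} \<Longrightarrow> \<bar>\<rho>' t\<bar> \<le> R"
    and Lax: "boundary_Lax_pair p F Q" "Lax_bound p F Q C"
    and \<psi>b: "\<And>x t. x \<in> {0..1} \<Longrightarrow> t \<in> {0..T} \<Longrightarrow> \<bar>\<psi> (x, t)\<bar> \<le> C"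
      "\<And>x t. x \<in> {0..1} \<Longrightarrow> t \<in> {0..T} \<Longrightarrow> \<bar>pd1 (space_time T) \<psi> (x, t)\<bar> \<le> C"
      "\<And>x t. x \<in> {0..1} \<Longrightarrow> t \<in> {0..T} \<Longrightarrow> \<bar>pd2 (space_time T) \<psi> (x, t)\<bar> \<le> C"
    and \<psi>x: "\<And>x t. x \<in> {0..1} \<Longrightarrow> t \<in> {0..T} \<Longrightarrow> ((\<lambda>x. \<psi> (x, t)) has_real_derivative pd1 (space_time T) \<psi> (x, t)) (at x within {0..1})"
    and \<psi>t: "\<And>x t. x \<in> {0..1} \<Longrightarrow> t \<in> {0..T} \<Longrightarrow> ((\<lambda>t. \<psi> (x, t)) has_real_derivative pd2 (space_time T) \<psi> (x, t)) (at t within {0..T})"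
    and \<psi>c: "\<And>t. t \<in> {0..T} \<Longrightarrow> continuous_on {0..1} (\<lambda>x. pd1 (space_time T) \<psi> (x, t))"
    and \<delta>: "0 < \<delta>" "\<delta> \<le> 1"
  shows "prob_space.expectation M (\<lambda>\<omega>. \<bar>entropy_production a T N K F Q \<psi> \<rho> (\<lambda>t. X t \<omega>)\<bar>)
    \<le> C\<^sup>2 * (1 + R) * T * (real N powr - a) + (\<delta> + 4 * T * C^4 * (2 + T * (1 + R)) * (real N powr (1 - a) / real K) / \<delta>)
      + 12 * C\<^sup>2 * (2 * \<delta> * T + 240 / \<delta> * (T * (real K / real N + real N / (real K)\<^sup>2)
         + 2 * (1 / c + 3 * R / c * T) * (real K * real N powr - a)))"
proof -
  have N: "1 \<le> N" and N0: "0 < real N" using K by simp_all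
  have \<Lambda>0: "\<Lambda> N > 0" using N by (simp add: \<Lambda>_def)
  interpret finite_markov_process M "configs N" T "\<lambda>t f \<xi>. \<Lambda> N * L_gen p \<rho> \<rho> N t f \<xi>" \<mu> X
  proof
    show "(\<Sum>y\<in>configs N. f y * (\<Lambda> N * L_gen p \<rho> \<rho> N t (\<lambda>z. if z = y then 1 else 0) x)) = \<Lambda> N * L_gen p \<rho> \<rho> N t f x"
      if "x \<in> configs N" for t f x
    proof -
      have "(\<Sum>y\<in>configs N. f y * (\<Lambda> N * L_gen p \<rho> \<rho> N t (\<lambda>z. if z = y then 1 else 0) x))
        = \<Lambda> N * (\<Sum>y\<in>configs N. f y * jump_gen {0..N} (rate p (\<rho> t) N) (jmp N) (\<lambda>z. if z = y then 1 else 0) x)"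
        unfolding L_gen_jump_gen[OF N] sum_distrib_left by (intro sum.cong refl) (simp only: mult.left_commute)
      also have "\<dots> = \<Lambda> N * L_gen p \<rho> \<rho> N t f x"
        unfolding L_gen_jump_gen[OF N]
        by (subst jump_gen_decompose[OF finite_configs _ that]) (use jmp_configs[OF N _ that] in simp_all)
      finally show ?thesis .
    qed
  qed (use mp T finite_configs in simp_all)
  note C = Lax_boundD(1)[OF Lax(2)]
  note Lb = Lax_boundD(2-7)[OF Lax(2)]
  note Lv = Lax_boundD(8-10)[OF Lax(2)]
  have \<rho>01: "0 < \<rho> t" "\<rho> t < 1" "\<rho> t \<in> {0..1}" if "t \<in> {0..T}" for t
    using c(1) c(2,3)[OF that] by auto
  have R0: "0 \<le> R" using R[of 0] T by auto
  have cont\<rho>: "continuous_on {0..T} \<rho>" by (rule DERIV_continuous_on[OF d\<rho>])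
  let ?I = "{K+1..N-K}"
  define y where "y i = (real i - 1/2) / real N" for i :: nat
  have y01: "y i \<in> {0..1}" if "i \<in> ?I" for i
    using that K by (auto simp: y_def field_simps)
  have u01: "wavg N K i x \<in> {0..1}" if "i \<in> ?I" "x \<in> configs N" for i x
    using wavg_bounds[OF K(1) _ _ that(2), of i] that(1) by auto
  have dF: "((\<lambda>t. F (u, \<rho> t)) has_real_derivative \<rho>' t * pd2 ent_dom F (u, \<rho> t)) (at t within {0..T})"
    if "t \<in> {0..T}" "u \<in> {0..1}" for t u
    by (rule entropy_has_real_derivative[OF Lax(1) d\<rho>[OF that(1)] that])
  \<comment> \<open>The test function is evaluated at the left end points \<open>y i\<close> of the
    cells; consecutive values then differ by the integral of its space derivative over one cell, as
    the comparison with the flux integral requires.\<close>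
  define \<Phi> where "\<Phi> t \<eta> = (\<Sum>i\<in>?I. \<psi> (y i, t) * F (wavg N K i \<eta>, \<rho> t))" for t \<eta>
  define \<Phi>' where "\<Phi>' t \<eta> = (\<Sum>i\<in>?I. pd2 (space_time T) \<psi> (y i, t) * F (wavg N K i \<eta>, \<rho> t)
      + \<rho>' t * pd2 ent_dom F (wavg N K i \<eta>, \<rho> t) * \<psi> (y i, t))" for t \<eta>
  define U where "U t \<eta> = (\<Sum>i\<in>?I. \<psi> (y i, t) * L_exc p N (\<lambda>\<xi>. F (wavg N K i \<xi>, \<rho> t)) \<eta>)" for t \<eta>
  define fe where "fe t \<eta> = 6 * C\<^sup>2 * flux_error N K (\<rho> t) \<eta>" for t \<eta>
  have cont\<psi>: "continuous_on {0..T} (\<lambda>t. \<psi> (y i, t))" if "i \<in> ?I" for i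
    by (rule DERIV_continuous_on[OF \<psi>t[OF y01[OF that]]])
  have contF: "continuous_on {0..T} (\<lambda>t. F (u, \<rho> t))" if "u \<in> {0..1}" for u
    by (rule DERIV_continuous_on[OF dF[OF _ that]])
  have Ucont: "continuous_on {0..T} (\<lambda>t. U t \<eta>)" if \<eta>: "\<eta> \<in> configs N" for \<eta>
  proof -
    have ex: "exchange \<eta> l (l + 1) \<in> configs N" if "l \<in> {1..<N}" for l
      by (rule exchange_configs[OF \<eta>]) (use that in auto)
    show ?thesis unfolding U_def L_exc_def
      by (intro continuous_on_sum continuous_on_mult continuous_on_diff continuous_on_const cont\<psi> contF u01 ex \<eta>)
  qed
  have IK: "K < i \<and> i + K \<le> N" if "i \<in> ?I" for i using that K by auto
  have cardI: "real (card ?I) \<le> real N" by simp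
  have sumI: "\<bar>\<Sum>i\<in>?I. h i\<bar> \<le> real N * b" if "\<And>i. i \<in> ?I \<Longrightarrow> \<bar>h i\<bar> \<le> b" "0 \<le> b" for h b
  proof -
    have "\<bar>\<Sum>i\<in>?I. h i\<bar> \<le> (\<Sum>i\<in>?I. b)" by (rule order_trans[OF sum_abs sum_mono]) (use that in auto)
    also have "\<dots> = real (card ?I) * b" by simp
    also have "\<dots> \<le> real N * b" by (rule mult_right_mono[OF cardI that(2)])
    finally show ?thesis .
  qed
  have LU: "\<Lambda> N * L_gen p \<rho> \<rho> N t (\<Phi> t) \<eta> = \<Lambda> N * U t \<eta>" for t \<eta>
    unfolding \<Phi>_def[abs_def] U_def
    by (subst L_gen_block_sum[where F="\<lambda>u. F (u, \<rho> t)" and s="\<lambda>i. \<psi> (y i, t)", OF IK]) simp_all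
  have Ub: "\<bar>U t \<eta>\<bar> \<le> real N * (C * (2 * C / real K))" if t: "t \<in> {0..T}" and \<eta>: "\<eta> \<in> configs N" for t \<eta>
    unfolding U_def
  proof (rule sumI)
    fix i assume i: "i \<in> ?I"
    have lip: "\<bar>F (v, \<rho> t) - F (u, \<rho> t)\<bar> \<le> C * \<bar>v - u\<bar>" if "u \<in> {0..1}" "v \<in> {0..1}" for u v
    proof -
      have d: "((\<lambda>u. F (u, \<rho> t)) has_real_derivative pd1 ent_dom F (z, \<rho> t)) (at z within {0..1})" if z: "z \<in> {0..1}" for z
      proof -
        have "C2_on ent_dom F" using Lax(1) unfolding boundary_Lax_pair_def by (elim conjE)
        then have "F differentiable_on ent_dom" by (simp add: C2_on_def C1_on_def)
        from has_real_derivative_along_curve[OF this DERIV_ident DERIV_const _ z, of "\<rho> t"]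
        show ?thesis by (simp add: ent_dom_def)
      qed
      have "norm (F (v, \<rho> t) - F (u, \<rho> t)) \<le> C * norm (v - u)"
        by (rule field_differentiable_bound[where f="\<lambda>u. F (u, \<rho> t)" and S="{0..1}", OF _ d])
           (use that Lb(3)[OF _ \<rho>01(3)[OF t]] in simp_all)
      then show ?thesis by (simp only: real_norm_def)
    qed
    have "\<bar>L_exc p N (\<lambda>\<xi>. F (wavg N K i \<xi>, \<rho> t)) \<eta>\<bar> \<le> 2 * C / real K"
      by (rule L_exc_wavg_le[where F="\<lambda>u. F (u, \<rho> t)", OF K(1) _ _ \<eta> p lip C]) (use IK[OF i] in auto)
    then show "\<bar>\<psi> (y i, t) * L_exc p N (\<lambda>\<xi>. F (wavg N K i \<xi>, \<rho> t)) \<eta>\<bar> \<le> C * (2 * C / real K)"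
      unfolding abs_mult by (intro mult_mono \<psi>b(1) y01 i t) (use C in auto)
  qed (use C in simp)
  have d\<Phi>: "((\<lambda>t. \<Phi> t \<eta>) has_real_derivative \<Phi>' t \<eta>) (at t within {0..T})" if t: "t \<in> {0..T}" and \<eta>: "\<eta> \<in> configs N" for t \<eta>
    unfolding \<Phi>_def \<Phi>'_def by (intro DERIV_sum DERIV_mult \<psi>t dF y01 u01 t \<eta>)
  have \<Phi>b: "\<bar>\<Phi> t \<eta>\<bar> \<le> real N * (C * C)" if t: "t \<in> {0..T}" and \<eta>: "\<eta> \<in> configs N" for t \<eta>
    unfolding \<Phi>_def
  proof (rule sumI)
    fix i assume i: "i \<in> ?I"
    show "\<bar>\<psi> (y i, t) * F (wavg N K i \<eta>, \<rho> t)\<bar> \<le> C * C"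
      unfolding abs_mult by (intro mult_mono \<psi>b(1) Lb(1) y01 i t u01 \<eta> \<rho>01(3) C abs_ge_zero)
  qed (use C in simp)
  have \<Phi>'b: "\<bar>\<Phi>' t \<eta>\<bar> \<le> real N * (C * C * (1 + R))" if t: "t \<in> {0..T}" and \<eta>: "\<eta> \<in> configs N" for t \<eta>
    unfolding \<Phi>'_def
  proof (rule sumI)
    fix i assume i: "i \<in> ?I"
    have "\<bar>pd2 (space_time T) \<psi> (y i, t) * F (wavg N K i \<eta>, \<rho> t)\<bar> \<le> C * C"
      unfolding abs_mult by (intro mult_mono \<psi>b(3) Lb(1) y01 i t u01 \<eta> \<rho>01(3) C abs_ge_zero)
    moreover have "\<bar>\<rho>' t * pd2 ent_dom F (wavg N K i \<eta>, \<rho> t) * \<psi> (y i, t)\<bar> \<le> R * C * C"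
      unfolding abs_mult by (intro mult_mono R \<psi>b(1) Lb(2) y01 i t u01 \<eta> \<rho>01(3) C R0 abs_ge_zero mult_nonneg_nonneg)
    moreover have "C * C * (1 + R) = C * C + R * C * C" by (simp add: algebra_simps)
    ultimately show "\<bar>pd2 (space_time T) \<psi> (y i, t) * F (wavg N K i \<eta>, \<rho> t)
      + \<rho>' t * pd2 ent_dom F (wavg N K i \<eta>, \<rho> t) * \<psi> (y i, t)\<bar> \<le> C * C * (1 + R)"
      using abs_triangle_ineq[of "pd2 (space_time T) \<psi> (y i, t) * F (wavg N K i \<eta>, \<rho> t)"
          "\<rho>' t * pd2 ent_dom F (wavg N K i \<eta>, \<rho> t) * \<psi> (y i, t)"] by simp
  qed (use C R0 in simp)
  note sm = second_moment_time_integral[where U=U and \<Phi>=\<Phi> and \<Phi>'=\<Phi>' and A="real N * (C * C)"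
      and ?A1.0="real N * (C * C * (1 + R))" and B="real N * (C * (2 * C / real K))" and \<Lambda>="\<Lambda> N",
      OF \<Lambda>0 Ucont Ub LU d\<Phi> \<Phi>b \<Phi>'b]
  have fecont: "continuous_on {0..T} (\<lambda>t. fe t \<eta>)" for \<eta>
    unfolding fe_def flux_error_def
    by (intro continuous_on_mult continuous_on_add continuous_on_rabs continuous_on_diff continuous_on_const cont\<rho>)
  have fe0: "0 \<le> fe t \<eta>" for t \<eta> unfolding fe_def by (intro mult_nonneg_nonneg flux_error_nonneg) auto
  \<comment> \<open>A crude bound, finite for each fixed \<open>N\<close>, that provides
    integrability along the paths.\<close>
  define FB where "FB = 6 * C\<^sup>2 * (real K / real N + 1 / real K + real N / (real K)^3 + (\<Sum>\<eta>\<in>configs N. fluctuation N K \<eta>) + 1 + 1)"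
  have fb: "\<bar>fe t \<eta>\<bar> \<le> FB" if t: "t \<in> {0..T}" and \<eta>: "\<eta> \<in> configs N" for t \<eta>
  proof -
    have "fluctuation N K \<eta> \<le> (\<Sum>\<eta>\<in>configs N. fluctuation N K \<eta>)"
      by (rule member_le_sum[OF \<eta> _ finite_configs]) (rule fluctuation_nonneg)
    moreover have "\<bar>wavg N K i \<eta> - \<rho> t\<bar> \<le> 1" if "i = K \<or> i = N - K" for i
    proof -
      have i: "K \<le> i" "i + K \<le> Suc N" using that K by auto
      show ?thesis using wavg_bounds[OF K(1) i \<eta>] \<rho>01(1,2)[OF t] by linarith
    qed
    ultimately have "flux_error N K (\<rho> t) \<eta> \<le> real K / real N + 1 / real K + real N / (real K)^3 + (\<Sum>\<eta>\<in>configs N. fluctuation N K \<eta>) + 1 + 1"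
      unfolding flux_error_def by (intro add_mono order_refl) auto
    then have "fe t \<eta> \<le> FB" unfolding fe_def FB_def by (intro mult_left_mono) auto
    then show ?thesis using fe0[of t \<eta>] by simp
  qed
  have Um: "(\<lambda>t. U t \<eta>) \<in> borel_measurable time" if "\<eta> \<in> configs N" for \<eta>
    by (rule continuous_time_measurable[OF Ucont[OF that]])
  have fem: "(\<lambda>t. fe t \<eta>) \<in> borel_measurable time" for \<eta>
    by (rule continuous_time_measurable[OF fecont])
  define IU where "IU \<omega> = (\<integral>t. U t (X t \<omega>) \<partial>time)" for \<omega>
  define IE where "IE \<omega> = (\<integral>t. fe t (X t \<omega>) \<partial>time)" for \<omega>
  define c1 where "c1 = C\<^sup>2 * (1 + R) * T * (real N powr - a)"
  have c10: "0 \<le> c1" unfolding c1_def using R0 T by (intro mult_nonneg_nonneg) auto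
  have IE0: "0 \<le> IE \<omega>" for \<omega> unfolding IE_def by (intro Bochner_Integration.integral_nonneg fe0)
  have path: "\<bar>entropy_production a T N K F Q \<psi> \<rho> (\<lambda>t. X t \<omega>)\<bar> \<le> c1 + \<bar>IU \<omega>\<bar> + IE \<omega>" if \<omega>: "\<omega> \<in> space M" for \<omega>
  proof -
    have st: "X t \<omega> \<in> configs N" if "t \<in> {0..T}" for t by (rule X_state[OF that \<omega>])
    have rh: "rho_hat N K (X t \<omega>) x \<in> {0..1}" if "t \<in> {0..T}" for t x
      by (rule rho_hat_bounds[OF N K(1) st[OF that]])
    let ?I1 = "LINT z:space_time T|lborel. (case z of (x, t) \<Rightarrow>
          F (rho_hat N K (X t \<omega>) x, \<rho> t) * pd2 (space_time T) \<psi> (x, t)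
          + pd2 ent_dom F (rho_hat N K (X t \<omega>) x, \<rho> t) * vector_derivative \<rho> (at t within {0..T}) * \<psi> (x, t))"
    let ?f = "\<lambda>x t. Q (rho_hat N K (X t \<omega>) x, \<rho> t) * pd1 (space_time T) \<psi> (x, t)"
    let ?I2 = "LINT z:space_time T|lborel. (case z of (x, t) \<Rightarrow> ?f x t)"
    have "\<bar>?I1\<bar> \<le> (C * C * (1 + R)) * measure lborel (space_time T)"
    proof (rule abs_integral_le_measure[OF space_time_lborel(1,2)[OF T]])
      show "0 \<le> C * C * (1 + R)" using C R0 by simp
      fix z assume "z \<in> space_time T"
      then obtain x t where z: "z = (x, t)" and x: "x \<in> {0..1}" and t: "t \<in> {0..T}" by (auto simp: space_time_def)
      have "\<bar>F (rho_hat N K (X t \<omega>) x, \<rho> t) * pd2 (space_time T) \<psi> (x, t)\<bar> \<le> C * C"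
        unfolding abs_mult by (intro mult_mono Lb(1) \<psi>b(3) rh x t \<rho>01(3) C abs_ge_zero)
      moreover have "\<bar>pd2 ent_dom F (rho_hat N K (X t \<omega>) x, \<rho> t) * vector_derivative \<rho> (at t within {0..T}) * \<psi> (x, t)\<bar> \<le> C * R * C"
        unfolding abs_mult \<rho>'[OF t]
        by (intro mult_mono Lb(2) \<psi>b(1) R rh x t \<rho>01(3) C R0 abs_ge_zero mult_nonneg_nonneg)
      moreover have "C * C * (1 + R) = C * C + C * R * C" by (simp add: algebra_simps)
      ultimately show "\<bar>case z of (x, t) \<Rightarrow> F (rho_hat N K (X t \<omega>) x, \<rho> t) * pd2 (space_time T) \<psi> (x, t)
          + pd2 ent_dom F (rho_hat N K (X t \<omega>) x, \<rho> t) * vector_derivative \<rho> (at t within {0..T}) * \<psi> (x, t)\<bar> \<le> C * C * (1 + R)"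
        unfolding z prod.case by (simp only: order_trans[OF abs_triangle_ineq add_mono])
    qed
    then have "\<bar>real N powr (- a) * ?I1\<bar> \<le> real N powr (- a) * ((C * C * (1 + R)) * T)"
      unfolding abs_mult space_time_lborel(3)[OF T] by (simp add: mult_left_mono)
    also have "\<dots> = c1" by (simp add: c1_def power2_eq_square ac_simps)
    finally have 1: "\<bar>real N powr (- a) * ?I1\<bar> \<le> c1" .
    have 2: "\<bar>?I2\<bar> \<le> \<bar>IU \<omega>\<bar> + IE \<omega>"
      unfolding IU_def IE_def
    proof (rule iterated_space_time_integral)
      show "integrable time (\<lambda>t. U t (X t \<omega>))"
        by (rule occupation_path_integrable[OF Um Ub \<omega>])
      show "integrable time (\<lambda>t. fe t (X t \<omega>))"
        by (rule occupation_path_integrable[OF fem fb \<omega>])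
      fix t assume t: "t \<in> {0..T}"
      show "0 \<le> fe t (X t \<omega>)" by (rule fe0)
      show "\<bar>(\<integral>x. indicator {0..1} x * ?f x t \<partial>lborel) - U t (X t \<omega>)\<bar> \<le> fe t (X t \<omega>)"
        unfolding U_def fe_def y_def
      proof (rule flux_error_bound[where F="\<lambda>u. F (u, \<rho> t)" and F'="\<lambda>u. pd1 ent_dom F (u, \<rho> t)" and Q="\<lambda>u. Q (u, \<rho> t)"
            and \<psi>="\<lambda>x. \<psi> (x, t)" and \<psi>'="\<lambda>x. pd1 (space_time T) \<psi> (x, t)" and w="\<rho> t" and p=p, OF K st[OF t] p C])
        show "continuous_on {0..1} (\<lambda>x. pd1 (space_time T) \<psi> (x, t))" by (rule \<psi>c[OF t])
        show "((\<lambda>x. \<psi> (x, t)) has_real_derivative pd1 (space_time T) \<psi> (x, t)) (at x within {0..1})" if "x \<in> {0..1}" for x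
          by (rule \<psi>x[OF that t])
      qed (rule Lb Lv \<psi>b \<rho>01(3) t; assumption?)+
    qed
    have "entropy_production a T N K F Q \<psi> \<rho> (\<lambda>t. X t \<omega>) = real N powr (- a) * ?I1 + ?I2"
      by (simp only: entropy_production_def)
    then show ?thesis using 1 2 abs_triangle_ineq[of "real N powr (- a) * ?I1" ?I2] by linarith
  qed
  have IUint: "integrable M IU" unfolding IU_def[abs_def]
    by (rule occupation_time_integrable[OF Um Ub])
  have IU2int: "integrable M (\<lambda>\<omega>. (IU \<omega>)\<^sup>2)" unfolding IU_def by (rule sm(1))
  have IEint: "integrable M IE" unfolding IE_def[abs_def]
    by (rule occupation_time_integrable[OF fem fb])
  have total: "expectation (\<lambda>\<omega>. \<bar>entropy_production a T N K F Q \<psi> \<rho> (\<lambda>t. X t \<omega>)\<bar>) \<le> c1 + expectation (\<lambda>\<omega>. \<bar>IU \<omega>\<bar>) + expectation IE"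
  proof -
    have "expectation (\<lambda>\<omega>. \<bar>entropy_production a T N K F Q \<psi> \<rho> (\<lambda>t. X t \<omega>)\<bar>) \<le> expectation (\<lambda>\<omega>. c1 + \<bar>IU \<omega>\<bar> + IE \<omega>)"
    \<comment> \<open>This comparison asks for integrability of the larger side only; if the entropy
      production were not measurable in \<open>\<omega>\<close>, its expectation would be
      \<open>0\<close> by convention.\<close>
    proof (rule integral_mono')
      show "integrable M (\<lambda>\<omega>. c1 + \<bar>IU \<omega>\<bar> + IE \<omega>)" using IUint IEint by simp
      show "0 \<le> c1 + \<bar>IU \<omega>\<bar> + IE \<omega>" for \<omega> using c10 IE0[of \<omega>] by simp
    qed (rule path)
    also have "\<dots> = c1 + expectation (\<lambda>\<omega>. \<bar>IU \<omega>\<bar>) + expectation IE"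
      using IUint IEint by (simp add: prob_space)
    finally show ?thesis .
  qed
  \<comment> \<open>With \<open>U\<close> at most \<open>2 C^2 N/K\<close> and \<open>\<Phi>\<close>
    of order \<open>N\<close>, the second moment has order
    \<open>N^2 / (K \<Lambda>) = N^(1-a)/K\<close>.\<close>
  have EIU: "expectation (\<lambda>\<omega>. \<bar>IU \<omega>\<bar>) \<le> \<delta> + 4 * T * C^4 * (2 + T * (1 + R)) * (real N powr (1 - a) / real K) / \<delta>"
  proof -
    have "expectation (\<lambda>\<omega>. \<bar>IU \<omega>\<bar>) \<le> expectation (\<lambda>\<omega>. \<delta> + (IU \<omega>)\<^sup>2 / \<delta>)"
      by (rule integral_mono) (use IUint IU2int abs_le_square[OF \<delta>(1)] in simp_all)
    also have "\<dots> = \<delta> + expectation (\<lambda>\<omega>. (IU \<omega>)\<^sup>2) / \<delta>"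
      using IU2int by (simp add: prob_space)
    also have "\<dots> \<le> \<delta> + (2 * T * (real N * (C * (2 * C / real K))) * ((2 * (real N * (C * C)) + T * (real N * (C * C * (1 + R)))) / \<Lambda> N)) / \<delta>"
      using sm(2) \<delta>(1) unfolding IU_def by (intro add_mono divide_right_mono order_refl) auto
    also have "2 * T * (real N * (C * (2 * C / real K))) * ((2 * (real N * (C * C)) + T * (real N * (C * C * (1 + R)))) / \<Lambda> N)
      = 4 * T * C^4 * (2 + T * (1 + R)) * ((real N)\<^sup>2 / \<Lambda> N / real K)"
      by (simp add: power2_eq_square power4_eq_xxxx algebra_simps add_divide_distrib)
    also have "(real N)\<^sup>2 / \<Lambda> N = real N powr (1 - a)"
    proof -
      have "(real N)\<^sup>2 = real N powr 2" using N0 by (simp add: powr_numeral)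
      then have "(real N)\<^sup>2 / \<Lambda> N = real N powr (2 - (1 + a))" unfolding \<Lambda>_def by (simp only: powr_diff)
      then show ?thesis by simp
    qed
    finally show ?thesis .
  qed
  have EIE: "expectation IE \<le> 12 * C\<^sup>2 * (2 * \<delta> * T + 240 / \<delta> * (T * (real K / real N + real N / (real K)\<^sup>2)
         + 2 * (1 / c + 3 * R / c * T) * (real K * real N powr - a)))"
  proof -
    define m where "m t x = (law t x + bern (\<rho> t) N x) / 2" for t x
    note db = dirichlet_bound[OF finite_markov_process_axioms N p less_imp_le[OF \<Lambda>0] d\<rho> c R m_def]
    let ?D = "\<lambda>t. totalD (\<rho> t) N (m t)"
    let ?a = "real K / real N + real N / (real K)\<^sup>2"
    let ?h = "\<lambda>t. 12 * C\<^sup>2 * (2 * \<delta> + 240 / \<delta> * (?a + real K * ?D t))"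
    have hcont: "continuous_on {0..T} ?h"
      by (intro continuous_on_mult continuous_on_add continuous_on_const db(1))
    have le: "(\<Sum>\<eta>\<in>configs N. law t \<eta> * fe t \<eta>) \<le> ?h t" if t: "t \<in> {0..T}" for t
    proof -
      have m0: "0 \<le> m t \<eta>" and lm: "law t \<eta> \<le> 2 * m t \<eta>" if "\<eta> \<in> configs N" for \<eta>
        using law_nonneg[of t \<eta>] bern_pos[OF that \<rho>01(1,2)[OF t]] by (simp_all add: m_def)
      have m1: "(\<Sum>\<eta>\<in>configs N. m t \<eta>) = 1"
        using law_sum[OF t] sum_bern[of "\<rho> t" N]
        by (simp add: m_def sum_divide_distrib[symmetric] sum.distrib)
      \<comment> \<open>Passing from the law to the mixture doubles the constant
        \<open>6 C^2\<close> of the flux error to \<open>12 C^2\<close>.\<close>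
      have "(\<Sum>\<eta>\<in>configs N. law t \<eta> * fe t \<eta>) \<le> (\<Sum>\<eta>\<in>configs N. 2 * m t \<eta> * fe t \<eta>)"
        by (intro sum_mono mult_right_mono lm fe0)
      also have "\<dots> = 12 * C\<^sup>2 * (\<Sum>\<eta>\<in>configs N. m t \<eta> * flux_error N K (\<rho> t) \<eta>)"
        unfolding sum_distrib_left fe_def by (intro sum.cong refl) simp
      also have "\<dots> \<le> ?h t"
        by (intro mult_left_mono flux_error_average[OF K \<rho>01(1,2)[OF t] \<delta> m0 m1]) auto
      finally show ?thesis .
    qed
    have "expectation IE = (\<integral>t. (\<Sum>\<eta>\<in>configs N. law t \<eta> * fe t \<eta>) \<partial>time)"
      unfolding IE_def by (rule expectation_occupation[OF fem fb])
    also have "\<dots> \<le> (\<integral>t. ?h t \<partial>time)"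
    proof (rule integral_mono'[OF time_integral_continuous(1)[OF hcont]])
      fix t assume "t \<in> space time"
      then have t: "t \<in> {0..T}" by simp
      show "(\<Sum>\<eta>\<in>configs N. law t \<eta> * fe t \<eta>) \<le> ?h t" by (rule le[OF t])
      show "0 \<le> ?h t"
        by (rule order_trans[OF _ le[OF t]]) (intro sum_nonneg mult_nonneg_nonneg law_nonneg fe0)
    qed
    also have "\<dots> = integral {0..T} ?h" by (rule time_integral_continuous(2)[OF hcont])
    also have "\<dots> = 12 * C\<^sup>2 * (2 * \<delta> * T + 240 / \<delta> * (T * ?a + real K * integral {0..T} ?D))"
    proof -
      have Dint: "?D integrable_on {0..T}" by (rule integrable_continuous_real[OF db(1)])
      have "((\<lambda>t. ?D t) has_integral integral {0..T} ?D) {0..T}" by (rule integrable_integral[OF Dint])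
      then have "(?h has_integral 12 * C\<^sup>2 * (T * (2 * \<delta>) + 240 / \<delta> * (T * ?a + real K * integral {0..T} ?D))) {0..T}"
        using has_integral_const_real[of "2 * \<delta>" 0 T] has_integral_const_real[of ?a 0 T] T
        by (intro has_integral_mult_right has_integral_add) simp_all
      then show ?thesis by (simp only: integral_unique mult.commute mult.left_commute)
    qed
    also have "\<dots> \<le> 12 * C\<^sup>2 * (2 * \<delta> * T + 240 / \<delta> * (T * ?a + real K * (2 * (1 / c + 3 * R / c * T) * real N powr - a)))"
    proof -
      have "integral {0..T} ?D \<le> 2 * real N * (1 / c + 3 * R / c * T) / \<Lambda> N"
        using db(2) \<Lambda>0 by (simp add: pos_le_divide_eq mult.commute)
      also have "\<dots> = 2 * (1 / c + 3 * R / c * T) * (real N / \<Lambda> N)" by simp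
      also have "real N / \<Lambda> N = real N powr - a"
      proof -
        have "real N / \<Lambda> N = real N powr 1 / real N powr (1 + a)" using N0 by (simp add: \<Lambda>_def)
        also have "\<dots> = real N powr (1 - (1 + a))" by (rule powr_diff[symmetric])
        finally show ?thesis by simp
      qed
      finally show ?thesis using \<delta>(1) by (intro mult_left_mono add_left_mono) auto
    qed
    finally show ?thesis by (simp only: mult.left_commute[of "real K"])
  qed
  show ?thesis using total EIU EIE unfolding c1_def by linarith
qed

section \<open>Choice of scales and passage to the limit\<close>

lemma Lax_bound_mono:
  assumes "Lax_bound p F Q C" "C \<le> C'"
  shows "Lax_bound p F Q C'"
proof -
  note D = Lax_boundD[OF assms(1)]
  have up: "x \<le> C' * y" if "x \<le> C * y" "0 \<le> y" for x y
    using mult_right_mono[OF assms(2) that(2)] that(1) by linarith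
  show ?thesis
    unfolding Lax_bound_def
  proof (intro conjI ballI)
    show "0 \<le> C'" using D(1) assms(2) by linarith
    fix u w :: real assume uw: "u \<in> {0..1}" "w \<in> {0..1}"
    show "\<bar>F (u, w)\<bar> \<le> C'" by (rule order_trans[OF D(2)[OF uw] assms(2)])
    show "\<bar>pd2 ent_dom F (u, w)\<bar> \<le> C'" by (rule order_trans[OF D(3)[OF uw] assms(2)])
    show "\<bar>pd1 ent_dom F (u, w)\<bar> \<le> C'" by (rule order_trans[OF D(4)[OF uw] assms(2)])
    show "\<bar>Q (u, w)\<bar> \<le> C'" by (rule order_trans[OF D(5)[OF uw] assms(2)])
    show "\<bar>pd1 ent_dom F (u, w)\<bar> \<le> C' * \<bar>u - w\<bar>" by (rule up[OF D(6)[OF uw] abs_ge_zero])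
    show "\<bar>Q (u, w)\<bar> \<le> C' * \<bar>u - w\<bar>" by (rule up[OF D(7)[OF uw] abs_ge_zero])
    fix v :: real assume v: "v \<in> {0..1}"
    show "\<bar>pd1 ent_dom F (v, w) - pd1 ent_dom F (u, w)\<bar> \<le> C' * \<bar>v - u\<bar>"
      by (rule up[OF D(8)[OF uw(1) v uw(2)] abs_ge_zero])
    show "\<bar>F (v, w) - F (u, w) - pd1 ent_dom F (u, w) * (v - u)\<bar> \<le> C' * (v - u)\<^sup>2"
      by (rule up[OF D(9)[OF uw(1) v uw(2)] zero_le_power2])
    show "\<bar>Q (v, w) - Q (u, w) - (2 * p - 1) * (1 - 2 * u) * pd1 ent_dom F (u, w) * (v - u)\<bar> \<le> C' * (v - u)\<^sup>2"
      by (rule up[OF D(10)[OF uw(1) v uw(2)] zero_le_power2])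
  qed
qed

text \<open>Comparison with \<open>K / min (N^a, N)\<close> gives the limits of \<open>K/N\<close>
  and \<open>K N^-a\<close>, and squaring \<open>\<surd>N / K\<close> gives that of
  \<open>N/K^2\<close>.\<close>

lemma block_scale_limits:
  fixes a :: real and K :: "nat \<Rightarrow> nat"
  assumes a: "a > 0"
    and lower: "(\<lambda>N. sqrt (real N)) \<in> o(\<lambda>N. real (K N))"
    and upper: "(\<lambda>N. real (K N)) \<in> o(\<lambda>N. min (real N powr a) (real N))"
  shows "eventually (\<lambda>N. 1 \<le> K N \<and> 2 * K N < N) sequentially"
    and "(\<lambda>N. real N powr - a) \<longlonglongrightarrow> 0"
    and "(\<lambda>N. real (K N) / real N) \<longlonglongrightarrow> 0"
    and "(\<lambda>N. real N / (real (K N))\<^sup>2) \<longlonglongrightarrow> 0"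
    and "(\<lambda>N. real (K N) * real N powr - a) \<longlonglongrightarrow> 0"
    and "(\<lambda>N. real N powr (1 - a) / real (K N)) \<longlonglongrightarrow> 0"
proof -
  have e1: "eventually (\<lambda>N. sqrt (real N) \<le> real (K N)) sequentially"
    using landau_o.smallD[OF lower, of 1] by simp
  \<comment> \<open>The constant \<open>1/4\<close> yields \<open>2 K <= N/2\<close>, hence the
    strict inequality \<open>2 K < N\<close>.\<close>
  have e2: "eventually (\<lambda>N. real (K N) \<le> 1/4 * \<bar>min (real N powr a) (real N)\<bar>) sequentially"
    using landau_o.smallD[OF upper, of "1/4"] by simp
  have ev: "eventually (\<lambda>N. 1 \<le> K N \<and> 2 * K N < N) sequentially"
    using e1 e2 eventually_ge_at_top[of 1]
  proof eventually_elim
    case (elim N)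
    have "1 \<le> sqrt (real N)" using elim(3) by simp
    then have "1 \<le> real (K N)" using elim(1) by linarith
    then have 1: "1 \<le> K N" by simp
    have "\<bar>min (real N powr a) (real N)\<bar> \<le> real N" by (simp add: min_def)
    then have "real (K N) \<le> 1/4 * real N" using elim(2) by linarith
    then have "2 * real (K N) < real N" using elim(3) by linarith
    then have "2 * K N < N" by linarith
    then show ?case using 1 by simp
  qed
  show "eventually (\<lambda>N. 1 \<le> K N \<and> 2 * K N < N) sequentially" by (rule ev)
  have q: "(\<lambda>N. real (K N) / min (real N powr a) (real N)) \<longlonglongrightarrow> 0" by (rule smalloD_tendsto[OF upper])
  have s: "(\<lambda>N. sqrt (real N) / real (K N)) \<longlonglongrightarrow> 0" by (rule smalloD_tendsto[OF lower])
  show "(\<lambda>N. real N powr - a) \<longlonglongrightarrow> 0"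
    by (rule tendsto_neg_powr[OF _ filterlim_real_sequentially]) (use a in simp)
  show KN: "(\<lambda>N. real (K N) / real N) \<longlonglongrightarrow> 0"
  proof (rule tendsto_sandwich[OF _ _ tendsto_const q])
    show "eventually (\<lambda>N. real (K N) / real N \<le> real (K N) / min (real N powr a) (real N)) sequentially"
      using eventually_ge_at_top[of 1] by eventually_elim (auto intro!: divide_left_mono mult_pos_pos simp: min_def)
  qed simp
  show Ka: "(\<lambda>N. real (K N) * real N powr - a) \<longlonglongrightarrow> 0"
  proof (rule tendsto_sandwich[OF _ _ tendsto_const q])
    show "eventually (\<lambda>N. real (K N) * real N powr - a \<le> real (K N) / min (real N powr a) (real N)) sequentially"
      using eventually_ge_at_top[of 1]
    proof eventually_elim
      case (elim N)
      have "real (K N) / real N powr a \<le> real (K N) / min (real N powr a) (real N)"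
        using elim by (auto intro!: divide_left_mono mult_pos_pos simp: min_def)
      then show ?case by (simp add: powr_minus_divide)
    qed
  qed simp
  have "(\<lambda>N. (sqrt (real N) / real (K N))\<^sup>2) \<longlonglongrightarrow> 0\<^sup>2" by (rule tendsto_power[OF s])
  then show NK: "(\<lambda>N. real N / (real (K N))\<^sup>2) \<longlonglongrightarrow> 0" by (simp add: power_divide)
  \<comment> \<open>\<open>N^(1-a)/K\<close> is the product of \<open>N/K^2\<close> and
    \<open>K N^-a\<close>, so it vanishes with them.\<close>
  have "(\<lambda>N. (real N / (real (K N))\<^sup>2) * (real (K N) * real N powr - a)) \<longlonglongrightarrow> 0 * 0" by (rule tendsto_mult[OF NK Ka])
  moreover have "eventually (\<lambda>N. (real N / (real (K N))\<^sup>2) * (real (K N) * real N powr - a) = real N powr (1 - a) / real (K N)) sequentially"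
    using ev
  proof eventually_elim
    case (elim N)
    have "real N powr (1 - a) = real N * real N powr - a"
      using elim by (simp add: powr_diff powr_minus_divide)
    then show ?case using elim by (simp add: power2_eq_square)
  qed
  ultimately show "(\<lambda>N. real N powr (1 - a) / real (K N)) \<longlonglongrightarrow> 0"
    by (simp add: tendsto_cong)
qed

theorem proposition8p3:
  fixes a p T :: real
    and \<rho> :: "real \<Rightarrow> real"
    and K :: "nat \<Rightarrow> nat"
    and \<mu> :: "nat \<Rightarrow> config pmf"
    and M :: "nat \<Rightarrow> 'w measure"
    and \<eta> :: "nat \<Rightarrow> real \<Rightarrow> 'w \<Rightarrow> config"
    and F Q \<psi> :: "real \<times> real \<Rightarrow> real"
  assumes "T > 0" and "a > 0" and "1 / 2 < p" and "p \<le> 1"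
    and "C1_interval 0 T \<rho>" and "\<And>t. t \<in> {0..T} \<Longrightarrow> \<rho> t \<in> {0<..<1}"
    and "(\<lambda>N. sqrt (real N)) \<in> o(\<lambda>N. real (K N))"
    and "(\<lambda>N. real (K N)) \<in> o(\<lambda>N. min (real N powr a) (real N))"
    and "\<And>N. N \<ge> 1 \<Longrightarrow> set_pmf (\<mu> N) \<subseteq> configs N"
    and "\<And>N. N \<ge> 1 \<Longrightarrow>
           markov_process (M N) (configs N) T
             (\<lambda>t f \<xi>. real N powr (1 + a) * L_gen p \<rho> \<rho> N t f \<xi>) (\<mu> N) (\<eta> N)"
    and "boundary_Lax_pair p F Q"
    and "C2_on (space_time T) \<psi>"
    and "\<And>x. x \<in> {0..1} \<Longrightarrow> \<psi> (x, 0) = 0 \<and> \<psi> (x, T) = 0"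
  shows "(\<lambda>N. prob_space.expectation (M N)
            (\<lambda>\<omega>. \<bar>entropy_production a T N (K N) F Q \<psi> \<rho> (\<lambda>t. \<eta> N t \<omega>)\<bar>))
         \<longlonglongrightarrow> 0"
proof -
  note T = assms(1) and a = assms(2)
  obtain c R where c: "0 < c" "\<And>t. t \<in> {0..T} \<Longrightarrow> c \<le> \<rho> t" "\<And>t. t \<in> {0..T} \<Longrightarrow> \<rho> t \<le> 1 - c" and "R \<ge> 0"
    and R: "\<And>t. t \<in> {0..T} \<Longrightarrow> \<bar>vector_derivative \<rho> (at t within {0..T})\<bar> \<le> R"
    and d\<rho>: "\<And>t. t \<in> {0..T} \<Longrightarrow> (\<rho> has_real_derivative vector_derivative \<rho> (at t within {0..T})) (at t within {0..T})"
    by (rule C1_interval_bounds[OF T assms(5,6)]) (assumption | (rule that; assumption))+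
  obtain CL where CL: "Lax_bound p F Q CL" using boundary_Lax_pair_bounds[OF assms(11)] by blast
  have \<psi>1: "C1_on (space_time T) \<psi>" using assms(12) by (simp add: C2_on_def)
  obtain CP where CP: "CP \<ge> 0" "\<And>x t. x \<in> {0..1} \<Longrightarrow> t \<in> {0..T} \<Longrightarrow> \<bar>\<psi> (x, t)\<bar> \<le> CP"
    "\<And>x t. x \<in> {0..1} \<Longrightarrow> t \<in> {0..T} \<Longrightarrow> \<bar>pd1 (space_time T) \<psi> (x, t)\<bar> \<le> CP"
    "\<And>x t. x \<in> {0..1} \<Longrightarrow> t \<in> {0..T} \<Longrightarrow> \<bar>pd2 (space_time T) \<psi> (x, t)\<bar> \<le> CP"
    and \<psi>d: "\<And>x t. x \<in> {0..1} \<Longrightarrow> t \<in> {0..T} \<Longrightarrow> ((\<lambda>x. \<psi> (x, t)) has_real_derivative pd1 (space_time T) \<psi> (x, t)) (at x within {0..1})"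
    "\<And>x t. x \<in> {0..1} \<Longrightarrow> t \<in> {0..T} \<Longrightarrow> ((\<lambda>t. \<psi> (x, t)) has_real_derivative pd2 (space_time T) \<psi> (x, t)) (at t within {0..T})"
    "\<And>t. t \<in> {0..T} \<Longrightarrow> continuous_on {0..1} (\<lambda>x. pd1 (space_time T) \<psi> (x, t))"
    by (rule C1_on_space_time[OF T \<psi>1]) (assumption | (rule that; assumption))+
  define C where "C = max CL CP"
  have LB: "Lax_bound p F Q C" by (rule Lax_bound_mono[OF CL]) (simp add: C_def)
  have CPC: "CP \<le> C" by (simp add: C_def)
  define E where "E N = prob_space.expectation (M N) (\<lambda>\<omega>. \<bar>entropy_production a T N (K N) F Q \<psi> \<rho> (\<lambda>t. \<eta> N t \<omega>)\<bar>)" for N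
  define b where "b \<delta> N = C\<^sup>2 * (1 + R) * T * (real N powr - a) + (\<delta> + 4 * T * C^4 * (2 + T * (1 + R)) * (real N powr (1 - a) / real (K N)) / \<delta>)
      + 12 * C\<^sup>2 * (2 * \<delta> * T + 240 / \<delta> * (T * (real (K N) / real N + real N / (real (K N))\<^sup>2)
         + 2 * (1 / c + 3 * R / c * T) * (real (K N) * real N powr - a)))" for \<delta> N
  note lim = block_scale_limits[OF a assms(7,8)]
  have upper: "eventually (\<lambda>N. E N \<le> b \<delta> N) sequentially" if \<delta>: "0 < \<delta>" "\<delta> \<le> 1" for \<delta>
    using lim(1)
  proof eventually_elim
    case (elim N)
    have N: "1 \<le> N" using elim by linarith
    show ?case
      unfolding E_def b_def
    proof (rule expected_entropy_production[where \<rho>'="\<lambda>t. vector_derivative \<rho> (at t within {0..T})", OF assms(10)[OF N] T _ assms(4) _ _ d\<rho> refl c R assms(11) LB])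
      show "\<bar>\<psi> (x, t)\<bar> \<le> C" if "x \<in> {0..1}" "t \<in> {0..T}" for x t by (rule order_trans[OF CP(2)[OF that] CPC])
      show "\<bar>pd1 (space_time T) \<psi> (x, t)\<bar> \<le> C" if "x \<in> {0..1}" "t \<in> {0..T}" for x t by (rule order_trans[OF CP(3)[OF that] CPC])
      show "\<bar>pd2 (space_time T) \<psi> (x, t)\<bar> \<le> C" if "x \<in> {0..1}" "t \<in> {0..T}" for x t by (rule order_trans[OF CP(4)[OF that] CPC])
      show "0 \<le> p" using assms(3) by linarith
      show "1 \<le> K N" "2 * K N < N" using elim by simp_all
    qed (assumption | rule \<delta> | (rule \<psi>d; assumption))+
  qed
  \<comment> \<open>What survives for fixed \<open>\<delta>\<close> is \<open>\<delta>\<close> from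
    the time integral of \<open>U\<close> and \<open>24 C^2 T \<delta>\<close> from the end blocks
    in the flux error.\<close>
  have blim: "b \<delta> \<longlonglongrightarrow> \<delta> * (1 + 24 * C\<^sup>2 * T)" if "\<delta> \<noteq> 0" for \<delta>
  proof -
    have "b \<delta> \<longlonglongrightarrow> C\<^sup>2 * (1 + R) * T * 0 + (\<delta> + 4 * T * C^4 * (2 + T * (1 + R)) * 0 / \<delta>)
      + 12 * C\<^sup>2 * (2 * \<delta> * T + 240 / \<delta> * (T * (0 + 0) + 2 * (1 / c + 3 * R / c * T) * 0))"
      unfolding b_def[abs_def]
      by (intro tendsto_const lim(2-6) tendsto_add tendsto_mult tendsto_divide that)
    then show ?thesis by (simp add: algebra_simps)
  qed
  have E0: "E N \<ge> 0" for N unfolding E_def by (rule Bochner_Integration.integral_nonneg) simp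
  have "E \<longlonglongrightarrow> 0"
  proof (rule order_tendstoI)
    fix e :: real assume "e < 0"
    then show "eventually (\<lambda>N. e < E N) sequentially" using E0 by (intro always_eventually allI) (rule less_le_trans)
  next
    fix e :: real assume e: "0 < e"
    define D where "D = 1 + 24 * C\<^sup>2 * T"
    have D: "D \<ge> 1" using T by (simp add: D_def)
    \<comment> \<open>Half of \<open>e / D\<close> makes \<open>\<delta> D\<close> strictly smaller
      than \<open>e\<close>, so the limit of \<open>b \<delta>\<close> gives an eventual strict
      inequality; the cap \<open>1\<close> is the hypothesis of the averaged estimates.\<close>
    define \<delta> where "\<delta> = min 1 (e / (2 * D))"
    have \<delta>: "0 < \<delta>" "\<delta> \<le> 1" using e D by (auto simp: \<delta>_def)
    have "\<delta> * D \<le> e / (2 * D) * D" using D by (intro mult_right_mono) (auto simp: \<delta>_def)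
    also have "\<dots> < e" using e D by simp
    finally have De: "\<delta> * D < e" .
    have "b \<delta> \<longlonglongrightarrow> \<delta> * D" unfolding D_def by (rule blim) (use \<delta>(1) in simp)
    then have "eventually (\<lambda>N. b \<delta> N < e) sequentially" using De by (rule order_tendstoD(2))
    then show "eventually (\<lambda>N. E N < e) sequentially"
      using upper[OF \<delta>] by eventually_elim (rule le_less_trans)
  qed
  then show ?thesis unfolding E_def[abs_def] .
qed

end
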